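(* Let $\mathscr{X}$ be a finitely well-complete, locally small, well-pointed cartesian closed category, let $\mathbb{T}$ be a symmetric monoidal monad on $\mathscr{X}$ (with respect to the cartesian structure) with tensor products of algebras, and let $\mathscr{L}:=\mathscr{X}^{\mathbb{T}}$ with its closed symmetric monoidal structure with unit object $R$ and its Eilenberg–Moore adjunction $F\dashv G:\mathscr{L}\to\mathscr{X}$. (1) Given accessible distributions $\mu:[X,R]\to R$ on $X$ and $\nu:[Y,R]\to R$ on $Y$, there is a unique accessible distribution $\mu\otimes\nu:[X\times Y,R]\to R$ on $X\times Y$ such that $$\int_y\int_x f(x,y)\,d\mu\,d\nu=\int f\,d(\mu\otimes\nu)=\int_x\int_y f(x,y)\,d\nu\,d\mu\qquad(\ast)$$ for all maps $f:X\times Y\to GR$ in $\mathscr{X}$. (2) Suppose that the cotensors $[X,R]$ in the $\mathscr{X}$-category $\mathscr{L}$ are reflexive for all $X\in\mathscr{X}$. Given morphisms $\mu:[X,R]\to R$ and $\nu:[Y,R]\to R$ in $\mathscr{L}$, there is a unique morphism $\mu\otimes\nu:[X\times Y,R]\to R$ in $\mathscr{L}$ such that $(\ast)$ holds for all maps $f:X\times Y\to GR$.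
   Context: Finitely well-complete: having finite limits and intersections (fibre products) of arbitrary class-indexed families of strong monomorphisms with common codomain. Well-pointed: the functor $\mathscr{X}(1,-):\mathscr{X}\to\mathbf{Set}$ is faithful; elements of an object $X$ are morphisms $1\to X$, and morphisms of $\mathscr{X}$ are identified with the functions they induce on elements. $\underline{\mathscr{X}}(X,Y)$ is the internal hom; its elements are the maps $X\to Y$. A symmetric monoidal monad $\mathbb{T}=(T,\eta,\mu^{\mathbb{T}})$ on $\mathscr{X}$, with monoidal structure $m_{XY}:TX\times TY\to T(X\times Y)$, is equivalently a commutative $\mathscr{X}$-enriched monad on $\underline{\mathscr{X}}$. It has tensor products of algebras if for all $\mathbb{T}$-algebras $(X,a),(Y,b)$ the pair $\mu^{\mathbb{T}}\cdot Tm_{XY},\;T(a\times b):(T(TX\times TY),\mu^{\mathbb{T}})\rightrightarrows(T(X\times Y),\mu^{\mathbb{T}})$ has a coequalizer in $\mathscr{X}^{\mathbb{T}}$. Then $\mathscr{L}=\mathscr{X}^{\mathbb{T}}$ is closed symmetric monoidal: the tensor product is this coequalizer, the unit object is $R:=F1$, and the internal hom $\underline{\mathscr{L}}(A,B)$ of $A=(X,a)$, $B=(Y,b)$ has underlying object the equalizer of $\underline{\mathscr{X}}(TX,b)\cdot T_{XY},\ \underline{\mathscr{X}}(a,Y):\underline{\mathscr{X}}(X,Y)\rightrightarrows\underline{\mathscr{X}}(TX,Y)$. $\mathscr{L}$ is also an $\mathscr{X}$-category with $\mathscr{L}(A,B)=G\underline{\mathscr{L}}(A,B)$ (the Eilenberg–Moore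 $\mathscr{X}$-category), and $F\dashv G$ is an $\mathscr{X}$-adjunction with unit $\eta$ and counit $\varepsilon$. Cotensors. For $X\in\mathscr{X}$, the cotensor $[X,R]$ in $\mathscr{L}$ is taken to be $\underline{\mathscr{X}}(X,GR)$ with the pointwise $\mathbb{T}$-algebra structure, i.e. $T\underline{\mathscr{X}}(X,GR)\to GR^{X}$ the transpose of $X\times T\underline{\mathscr{X}}(X,GR)\to T(X\times\underline{\mathscr{X}}(X,GR))\xrightarrow{T\mathrm{Ev}}TGR\to GR$ (strength, evaluation, algebra structure); so elements of $[X,R]$ are maps $f:X\to GR$. It is canonically isomorphic in $\mathscr{L}$ to $\underline{\mathscr{L}}(FX,R)$. Distributions. $E^*:=\underline{\mathscr{L}}(E,R)$; $HE:=E^{**}$, with canonical morphism $\mathfrak{d}_E:E\to E^{**}$; $E$ is reflexive if $\mathfrak{d}_E$ is an isomorphism. A natural distribution on $X$ is a morphism $\mu:[X,R]\to R$ in $\mathscr{L}$, i.e. an element of $DX:=\mathscr{L}([X,R],R)\cong G((FX)^{**})$. For such $\mu$ and a map $f:X\to GR$ write $\int_x f(x)\,d\mu:=\int f\,d\mu:=\mu(f)$. $E\in\mathscr{L}$ is functionally complete if $\underline{\mathscr{L}}(h,E)$ is an isomorphism for every $h$ in $\mathscr{L}$ such that $h^{**}$ is an isomorphism. The functionally complete objects form an $\mathscr{L}$-reflective subcategory of $\underline{\mathscr{L}}$, with reflection units $\widetilde{\mathfrak{d}}_E:E\to\widetilde{H}E$; there is a unique $i_E:\widetilde{H}E\to E^{**}$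 with $i_E\cdot\widetilde{\mathfrak{d}}_E=\mathfrak{d}_E$, and it is a strong monomorphism. Put $\widetilde{D}X:=G\widetilde{H}FX$. The embedding $Gi_{FX}:\widetilde{D}X\to G((FX)^{**})\cong DX$ is injective on elements, and an accessible distribution on $X$ is a natural distribution $\mu:[X,R]\to R$ lying in its image. *)

theory Defs
  imports Main
begin

section \<open>Categories\<close>

text \<open>
  The collection of arrows between two objects is always a set in the sense of HOL, so every
  category in this format is locally small. The class of objects and the class of arrows are
  arbitrary sets over arbitrary types.
\<close>

record ('o, 'a) cat =
  Ob :: "'o set"
  Arr :: "'a set"
  Dom :: "'a \<Rightarrow> 'o"
  Cod :: "'a \<Rightarrow> 'o"
  Comp :: "'a \<Rightarrow> 'a \<Rightarrow> 'a"  (infixr "\<cdot>\<index>" 70)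
  Id :: "'o \<Rightarrow> 'a"

definition Hom :: "('o, 'a, 'x) cat_scheme \<Rightarrow> 'o \<Rightarrow> 'o \<Rightarrow> 'a set" where
  "Hom C A B = {f \<in> Arr C. Dom C f = A \<and> Cod C f = B}"

locale category =
  fixes C :: "('o, 'a, 'x) cat_scheme" (structure)
  assumes dom_ob: "f \<in> Arr C \<Longrightarrow> Dom C f \<in> Ob C"
    and cod_ob: "f \<in> Arr C \<Longrightarrow> Cod C f \<in> Ob C"
    and id_hom: "A \<in> Ob C \<Longrightarrow> Id C A \<in> Hom C A A"
    and comp_hom: "f \<in> Hom C A B \<Longrightarrow> g \<in> Hom C B D \<Longrightarrow> g \<cdot> f \<in> Hom C A D"
    and id_right: "f \<in> Hom C A B \<Longrightarrow> f \<cdot> Id C A = f"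
    and id_left: "f \<in> Hom C A B \<Longrightarrow> Id C B \<cdot> f = f"
    and assoc: "f \<in> Hom C A B \<Longrightarrow> g \<in> Hom C B D \<Longrightarrow> h \<in> Hom C D E \<Longrightarrow>
                  (h \<cdot> g) \<cdot> f = h \<cdot> (g \<cdot> f)"

definition iso :: "('o, 'a, 'x) cat_scheme \<Rightarrow> 'a \<Rightarrow> bool" where
  "iso C f \<longleftrightarrow> f \<in> Arr C \<and>
     (\<exists>g \<in> Hom C (Cod C f) (Dom C f).
        g \<cdot>\<^bsub>C\<^esub> f = Id C (Dom C f) \<and> f \<cdot>\<^bsub>C\<^esub> g = Id C (Cod C f))"

definition monic :: "('o, 'a, 'x) cat_scheme \<Rightarrow> 'a \<Rightarrow> bool" where
  "monic C m \<longleftrightarrow> m \<in> Arr C \<and>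
     (\<forall>Z \<in> Ob C. \<forall>u \<in> Hom C Z (Dom C m). \<forall>v \<in> Hom C Z (Dom C m).
        m \<cdot>\<^bsub>C\<^esub> u = m \<cdot>\<^bsub>C\<^esub> v \<longrightarrow> u = v)"

definition epic :: "('o, 'a, 'x) cat_scheme \<Rightarrow> 'a \<Rightarrow> bool" where
  "epic C e \<longleftrightarrow> e \<in> Arr C \<and>
     (\<forall>Z \<in> Ob C. \<forall>u \<in> Hom C (Cod C e) Z. \<forall>v \<in> Hom C (Cod C e) Z.
        u \<cdot>\<^bsub>C\<^esub> e = v \<cdot>\<^bsub>C\<^esub> e \<longrightarrow> u = v)"

definition strong_monic :: "('o, 'a, 'x) cat_scheme \<Rightarrow> 'a \<Rightarrow> bool" where
  "strong_monic C m \<longleftrightarrow> monic C m \<and>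
     (\<forall>e u v. epic C e \<and> u \<in> Hom C (Dom C e) (Dom C m) \<and> v \<in> Hom C (Cod C e) (Cod C m) \<and>
        m \<cdot>\<^bsub>C\<^esub> u = v \<cdot>\<^bsub>C\<^esub> e \<longrightarrow>
        (\<exists>!w. w \<in> Hom C (Cod C e) (Dom C m) \<and> w \<cdot>\<^bsub>C\<^esub> e = u \<and> m \<cdot>\<^bsub>C\<^esub> w = v))"

definition is_equalizer :: "('o, 'a, 'x) cat_scheme \<Rightarrow> 'a \<Rightarrow> 'a \<Rightarrow> 'a \<Rightarrow> bool" where
  "is_equalizer C f g k \<longleftrightarrow> k \<in> Hom C (Dom C k) (Dom C f) \<and> f \<cdot>\<^bsub>C\<^esub> k = g \<cdot>\<^bsub>C\<^esub> k \<and>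
     (\<forall>Z. \<forall>u \<in> Hom C Z (Dom C f). f \<cdot>\<^bsub>C\<^esub> u = g \<cdot>\<^bsub>C\<^esub> u \<longrightarrow>
        (\<exists>!v. v \<in> Hom C Z (Dom C k) \<and> k \<cdot>\<^bsub>C\<^esub> v = u))"

definition is_coequalizer :: "('o, 'a, 'x) cat_scheme \<Rightarrow> 'a \<Rightarrow> 'a \<Rightarrow> 'a \<Rightarrow> bool" where
  "is_coequalizer C f g q \<longleftrightarrow> q \<in> Hom C (Cod C f) (Cod C q) \<and> q \<cdot>\<^bsub>C\<^esub> f = q \<cdot>\<^bsub>C\<^esub> g \<and>
     (\<forall>Z. \<forall>u \<in> Hom C (Cod C f) Z. u \<cdot>\<^bsub>C\<^esub> f = u \<cdot>\<^bsub>C\<^esub> g \<longrightarrow>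
        (\<exists>!v. v \<in> Hom C (Cod C q) Z \<and> v \<cdot>\<^bsub>C\<^esub> q = u))"

text \<open>
  Diagrams are indexed by a directed graph with vertex set \<open>V\<close>, edge set \<open>E\<close>, source \<open>s\<close> and
  target \<open>t\<close>; they assign the object \<open>D v\<close> to a vertex and the arrow \<open>d e\<close> to an edge.
\<close>

definition is_cone ::
  "('o, 'a, 'x) cat_scheme \<Rightarrow> 'v set \<Rightarrow> 'e set \<Rightarrow> ('e \<Rightarrow> 'v) \<Rightarrow> ('e \<Rightarrow> 'v) \<Rightarrow>
   ('v \<Rightarrow> 'o) \<Rightarrow> ('e \<Rightarrow> 'a) \<Rightarrow> 'o \<Rightarrow> ('v \<Rightarrow> 'a) \<Rightarrow> bool" where
  "is_cone C V E s t D d P p \<longleftrightarrow> P \<in> Ob C \<and> (\<forall>v \<in> V. p v \<in> Hom C P (D v)) \<and>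
     (\<forall>e \<in> E. d e \<cdot>\<^bsub>C\<^esub> p (s e) = p (t e))"

definition has_finite_limits :: "('o, 'a, 'x) cat_scheme \<Rightarrow> bool" where
  "has_finite_limits C \<longleftrightarrow>
     (\<forall>(V :: nat set) (E :: nat set) s t D d.
        finite V \<and> finite E \<and> (\<forall>v \<in> V. D v \<in> Ob C) \<and>
        (\<forall>e \<in> E. s e \<in> V \<and> t e \<in> V \<and> d e \<in> Hom C (D (s e)) (D (t e))) \<longrightarrow>
        (\<exists>P p. is_cone C V E s t D d P p \<and>
           (\<forall>Q q. is_cone C V E s t D d Q q \<longrightarrow>
              (\<exists>!u. u \<in> Hom C Q P \<and> (\<forall>v \<in> V. p v \<cdot>\<^bsub>C\<^esub> u = q v)))))"

text \<open>
  The fibre product of a family of arrows with common codomain \<open>B\<close> is given by \<open>p : P \<rightarrow> B\<close>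
  and legs \<open>l m\<close>. A family of monomorphisms, whatever its index class, has the same fibre product
  as the set \<open>M\<close> of its members. The empty family is included.
\<close>

definition has_strong_intersections :: "('o, 'a, 'x) cat_scheme \<Rightarrow> bool" where
  "has_strong_intersections C \<longleftrightarrow>
     (\<forall>B \<in> Ob C. \<forall>M. (\<forall>m \<in> M. strong_monic C m \<and> Cod C m = B) \<longrightarrow>
        (\<exists>P p l. p \<in> Hom C P B \<and> (\<forall>m \<in> M. l m \<in> Hom C P (Dom C m) \<and> m \<cdot>\<^bsub>C\<^esub> l m = p) \<and>
           (\<forall>Q q k. q \<in> Hom C Q B \<and>
              (\<forall>m \<in> M. k m \<in> Hom C Q (Dom C m) \<and> m \<cdot>\<^bsub>C\<^esub> k m = q) \<longrightarrow>
              (\<exists>!u. u \<in> Hom C Q P \<and> p \<cdot>\<^bsub>C\<^esub> u = q \<and> (\<forall>m \<in> M. l m \<cdot>\<^bsub>C\<^esub> u = k m)))))"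

definition finitely_well_complete :: "('o, 'a, 'x) cat_scheme \<Rightarrow> bool" where
  "finitely_well_complete C \<longleftrightarrow> has_finite_limits C \<and> has_strong_intersections C"


section \<open>Cartesian closed categories\<close>

text \<open>
  \<open>Exp C X Y\<close> is the internal hom from \<open>X\<close> to \<open>Y\<close>; its evaluation has domain
  \<open>X \<^bold>\<times> Exp C X Y\<close>, in this order.
\<close>

record ('o, 'a) ccc = "('o, 'a) cat" +
  One :: "'o"
  Prod :: "'o \<Rightarrow> 'o \<Rightarrow> 'o"  (infixr "\<^bold>\<times>\<index>" 75)
  Fst :: "'o \<Rightarrow> 'o \<Rightarrow> 'a"
  Snd :: "'o \<Rightarrow> 'o \<Rightarrow> 'a"
  Exp :: "'o \<Rightarrow> 'o \<Rightarrow> 'o"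
  Ev :: "'o \<Rightarrow> 'o \<Rightarrow> 'a"

definition pair :: "('o, 'a) ccc \<Rightarrow> 'a \<Rightarrow> 'a \<Rightarrow> 'a"  ("\<langle>_,/ _\<rangle>\<index>") where
  "pair C f g = (THE h. h \<in> Hom C (Dom C f) (Prod C (Cod C f) (Cod C g)) \<and>
     Fst C (Cod C f) (Cod C g) \<cdot>\<^bsub>C\<^esub> h = f \<and> Snd C (Cod C f) (Cod C g) \<cdot>\<^bsub>C\<^esub> h = g)"

definition prod_map :: "('o, 'a) ccc \<Rightarrow> 'a \<Rightarrow> 'a \<Rightarrow> 'a"  (infixr "\<boxtimes>\<index>" 75) where
  "prod_map C f g = pair C (f \<cdot>\<^bsub>C\<^esub> Fst C (Dom C f) (Dom C g)) (g \<cdot>\<^bsub>C\<^esub> Snd C (Dom C f) (Dom C g))"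

definition swap :: "('o, 'a) ccc \<Rightarrow> 'o \<Rightarrow> 'o \<Rightarrow> 'a" where
  "swap C A B = pair C (Snd C A B) (Fst C A B)"

definition prod_assoc :: "('o, 'a) ccc \<Rightarrow> 'o \<Rightarrow> 'o \<Rightarrow> 'o \<Rightarrow> 'a" where
  "prod_assoc C A B D =
     (let p = Fst C (Prod C A B) D; q = Snd C (Prod C A B) D
      in pair C (Fst C A B \<cdot>\<^bsub>C\<^esub> p) (pair C (Snd C A B \<cdot>\<^bsub>C\<^esub> p) q))"

locale cartesian_closed = category C for C :: "('o, 'a) ccc" (structure) +
  assumes one_ob: "One C \<in> Ob C"
    and one_terminal: "A \<in> Ob C \<Longrightarrow> \<exists>!h. h \<in> Hom C A (One C)"
    and prod_ob: "A \<in> Ob C \<Longrightarrow> B \<in> Ob C \<Longrightarrow> A \<^bold>\<times> B \<in> Ob C"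
    and fst_hom: "A \<in> Ob C \<Longrightarrow> B \<in> Ob C \<Longrightarrow> Fst C A B \<in> Hom C (A \<^bold>\<times> B) A"
    and snd_hom: "A \<in> Ob C \<Longrightarrow> B \<in> Ob C \<Longrightarrow> Snd C A B \<in> Hom C (A \<^bold>\<times> B) B"
    and prod_universal: "f \<in> Hom C Z A \<Longrightarrow> g \<in> Hom C Z B \<Longrightarrow>
          \<exists>!h. h \<in> Hom C Z (A \<^bold>\<times> B) \<and> Fst C A B \<cdot> h = f \<and> Snd C A B \<cdot> h = g"
    and exp_ob: "A \<in> Ob C \<Longrightarrow> B \<in> Ob C \<Longrightarrow> Exp C A B \<in> Ob C"
    and ev_hom: "A \<in> Ob C \<Longrightarrow> B \<in> Ob C \<Longrightarrow> Ev C A B \<in> Hom C (A \<^bold>\<times> Exp C A B) B"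
    and exp_universal: "A \<in> Ob C \<Longrightarrow> B \<in> Ob C \<Longrightarrow> Z \<in> Ob C \<Longrightarrow> f \<in> Hom C (A \<^bold>\<times> Z) B \<Longrightarrow>
          \<exists>!g. g \<in> Hom C Z (Exp C A B) \<and> Ev C A B \<cdot> (Id C A \<boxtimes> g) = f"

text \<open>Transposition of \<open>f : X \<^bold>\<times> Z \<rightarrow> Y\<close> to \<open>Z \<rightarrow> Exp C X Y\<close>.\<close>

definition curry_map :: "('o, 'a) ccc \<Rightarrow> 'o \<Rightarrow> 'o \<Rightarrow> 'a \<Rightarrow> 'a" where
  "curry_map C X Z f = (THE g. g \<in> Hom C Z (Exp C X (Cod C f)) \<and>
     Ev C X (Cod C f) \<cdot>\<^bsub>C\<^esub> prod_map C (Id C X) g = f)"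

definition exp_post :: "('o, 'a) ccc \<Rightarrow> 'o \<Rightarrow> 'a \<Rightarrow> 'a" where
  "exp_post C X f = curry_map C X (Exp C X (Dom C f)) (f \<cdot>\<^bsub>C\<^esub> Ev C X (Dom C f))"

definition exp_pre :: "('o, 'a) ccc \<Rightarrow> 'a \<Rightarrow> 'o \<Rightarrow> 'a" where
  "exp_pre C f Y = curry_map C (Dom C f) (Exp C (Cod C f) Y)
     (Ev C (Cod C f) Y \<cdot>\<^bsub>C\<^esub> prod_map C f (Id C (Exp C (Cod C f) Y)))"

text \<open>The element of \<open>Exp C X Y\<close> corresponding to a map \<open>f : X \<rightarrow> Y\<close>.\<close>

definition name_of :: "('o, 'a) ccc \<Rightarrow> 'a \<Rightarrow> 'a" where
  "name_of C f = curry_map C (Dom C f) (One C) (f \<cdot>\<^bsub>C\<^esub> Fst C (Dom C f) (One C))"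

definition elements :: "('o, 'a) ccc \<Rightarrow> 'o \<Rightarrow> 'a set" where
  "elements C X = Hom C (One C) X"

definition well_pointed :: "('o, 'a) ccc \<Rightarrow> bool" where
  "well_pointed C \<longleftrightarrow>
     (\<forall>X \<in> Ob C. \<forall>Y \<in> Ob C. \<forall>f \<in> Hom C X Y. \<forall>g \<in> Hom C X Y.
        (\<forall>x \<in> elements C X. f \<cdot>\<^bsub>C\<^esub> x = g \<cdot>\<^bsub>C\<^esub> x) \<longrightarrow> f = g)"

text \<open>The morphism \<open>X \<rightarrow> Y\<close> that induces the function \<open>\<phi>\<close> on elements.\<close>

definition map_of_fun :: "('o, 'a) ccc \<Rightarrow> 'o \<Rightarrow> 'o \<Rightarrow> ('a \<Rightarrow> 'a) \<Rightarrow> 'a" where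
  "map_of_fun C X Y \<phi> = (THE g. g \<in> Hom C X Y \<and> (\<forall>x \<in> elements C X. g \<cdot>\<^bsub>C\<^esub> x = \<phi> x))"


section \<open>Symmetric monoidal monads and their algebras\<close>

record ('o, 'a) mon_monad =
  TO :: "'o \<Rightarrow> 'o"
  TA :: "'a \<Rightarrow> 'a"
  unit :: "'o \<Rightarrow> 'a"
  mult :: "'o \<Rightarrow> 'a"
  mon :: "'o \<Rightarrow> 'o \<Rightarrow> 'a"

text \<open>
  The nullary structure map \<open>One C \<rightarrow> TO T (One C)\<close> of the monoidal functor is not a separate datum:
  since the monad unit is a monoidal transformation, it has to be \<open>unit T (One C)\<close>. With this
  value the nullary conditions on the unit and on the multiplication hold automatically.
\<close>

locale symmetric_monoidal_monad = cartesian_closed C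
  for C :: "('o, 'a) ccc" (structure) +
  fixes T :: "('o, 'a) mon_monad"
  assumes TO_ob: "A \<in> Ob C \<Longrightarrow> TO T A \<in> Ob C"
    and TA_hom: "f \<in> Hom C A B \<Longrightarrow> TA T f \<in> Hom C (TO T A) (TO T B)"
    and TA_id: "A \<in> Ob C \<Longrightarrow> TA T (Id C A) = Id C (TO T A)"
    and TA_comp: "f \<in> Hom C A B \<Longrightarrow> g \<in> Hom C B D \<Longrightarrow> TA T (g \<cdot> f) = TA T g \<cdot> TA T f"
    and unit_hom: "A \<in> Ob C \<Longrightarrow> unit T A \<in> Hom C A (TO T A)"
    and unit_natural: "f \<in> Hom C A B \<Longrightarrow> unit T B \<cdot> f = TA T f \<cdot> unit T A"
    and mult_hom: "A \<in> Ob C \<Longrightarrow> mult T A \<in> Hom C (TO T (TO T A)) (TO T A)"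
    and mult_natural: "f \<in> Hom C A B \<Longrightarrow> mult T B \<cdot> TA T (TA T f) = TA T f \<cdot> mult T A"
    and unit_left: "A \<in> Ob C \<Longrightarrow> mult T A \<cdot> unit T (TO T A) = Id C (TO T A)"
    and unit_right: "A \<in> Ob C \<Longrightarrow> mult T A \<cdot> TA T (unit T A) = Id C (TO T A)"
    and mult_assoc: "A \<in> Ob C \<Longrightarrow> mult T A \<cdot> mult T (TO T A) = mult T A \<cdot> TA T (mult T A)"
    and mon_hom: "A \<in> Ob C \<Longrightarrow> B \<in> Ob C \<Longrightarrow>
          mon T A B \<in> Hom C (TO T A \<^bold>\<times> TO T B) (TO T (A \<^bold>\<times> B))"
    and mon_natural: "f \<in> Hom C A A' \<Longrightarrow> g \<in> Hom C B B' \<Longrightarrow>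
          TA T (f \<boxtimes> g) \<cdot> mon T A B = mon T A' B' \<cdot> (TA T f \<boxtimes> TA T g)"
    and mon_assoc: "A \<in> Ob C \<Longrightarrow> B \<in> Ob C \<Longrightarrow> D \<in> Ob C \<Longrightarrow>
          TA T (prod_assoc C A B D) \<cdot> mon T (A \<^bold>\<times> B) D \<cdot> (mon T A B \<boxtimes> Id C (TO T D)) =
          mon T A (B \<^bold>\<times> D) \<cdot> (Id C (TO T A) \<boxtimes> mon T B D) \<cdot> prod_assoc C (TO T A) (TO T B) (TO T D)"
    and mon_unit_left: "A \<in> Ob C \<Longrightarrow>
          TA T (Snd C (One C) A) \<cdot> mon T (One C) A \<cdot> (unit T (One C) \<boxtimes> Id C (TO T A)) =
          Snd C (One C) (TO T A)"
    and mon_unit_right: "A \<in> Ob C \<Longrightarrow>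
          TA T (Fst C A (One C)) \<cdot> mon T A (One C) \<cdot> (Id C (TO T A) \<boxtimes> unit T (One C)) =
          Fst C (TO T A) (One C)"
    and mon_symmetric: "A \<in> Ob C \<Longrightarrow> B \<in> Ob C \<Longrightarrow>
          TA T (swap C A B) \<cdot> mon T A B = mon T B A \<cdot> swap C (TO T A) (TO T B)"
    and unit_monoidal: "A \<in> Ob C \<Longrightarrow> B \<in> Ob C \<Longrightarrow>
          mon T A B \<cdot> (unit T A \<boxtimes> unit T B) = unit T (A \<^bold>\<times> B)"
    and mult_monoidal: "A \<in> Ob C \<Longrightarrow> B \<in> Ob C \<Longrightarrow>
          mult T (A \<^bold>\<times> B) \<cdot> TA T (mon T A B) \<cdot> mon T (TO T A) (TO T B) =
          mon T A B \<cdot> (mult T A \<boxtimes> mult T B)"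

text \<open>
  Objects of the Eilenberg-Moore category are pairs of a carrier and a structure map; arrows are
  triples of a source algebra, an underlying map and a target algebra.
\<close>

type_synonym ('o, 'a) alg = "'o \<times> 'a"
type_synonym ('o, 'a) alg_map = "('o, 'a) alg \<times> 'a \<times> ('o, 'a) alg"

definition EM ::
  "('o, 'a) ccc \<Rightarrow> ('o, 'a) mon_monad \<Rightarrow> (('o, 'a) alg, ('o, 'a) alg_map) cat" where
  "EM C T =
    (let algs = {(X, a). X \<in> Ob C \<and> a \<in> Hom C (TO T X) X \<and> a \<cdot>\<^bsub>C\<^esub> unit T X = Id C X \<and>
                         a \<cdot>\<^bsub>C\<^esub> mult T X = a \<cdot>\<^bsub>C\<^esub> TA T a}
     in \<lparr> Ob = algs,
          Arr = {(A, f, B). A \<in> algs \<and> B \<in> algs \<and> f \<in> Hom C (fst A) (fst B) \<and>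
                            f \<cdot>\<^bsub>C\<^esub> snd A = snd B \<cdot>\<^bsub>C\<^esub> TA T f},
          Dom = (\<lambda>(A, f, B). A),
          Cod = (\<lambda>(A, f, B). B),
          Comp = (\<lambda>(B', g, D) (A, f, B). (A, g \<cdot>\<^bsub>C\<^esub> f, D)),
          Id = (\<lambda>A. (A, Id C (fst A), A)) \<rparr>)"

text \<open>The locale below makes no assumptions; it only fixes data, so its constants are unconditional.\<close>

locale monad_data =
  fixes C :: "('o, 'a) ccc" (structure)
    and T :: "('o, 'a) mon_monad"
begin

abbreviation L :: "(('o, 'a) alg, ('o, 'a) alg_map) cat" where
  "L \<equiv> EM C T"

definition free :: "'o \<Rightarrow> ('o, 'a) alg" where
  "free X = (TO T X, mult T X)"

abbreviation GO :: "('o, 'a) alg \<Rightarrow> 'o" where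
  "GO A \<equiv> fst A"

definition GA :: "('o, 'a) alg_map \<Rightarrow> 'a" where
  "GA h = fst (snd h)"

definition R :: "('o, 'a) alg" where
  "R = free (One C)"

definition has_tensor_products :: bool where
  "has_tensor_products \<longleftrightarrow> (\<forall>A \<in> Ob L. \<forall>B \<in> Ob L.
     let S = free (TO T (GO A) \<^bold>\<times> TO T (GO B));
         P = free (GO A \<^bold>\<times> GO B)
     in \<exists>q. is_coequalizer L
          (S, mult T (GO A \<^bold>\<times> GO B) \<cdot> TA T (mon T (GO A) (GO B)), P)
          (S, TA T (snd A \<boxtimes> snd B), P) q)"


subsection \<open>Cotensors and internal homs\<close>

text \<open>The strength \<open>X \<^bold>\<times> TO T Y \<rightarrow> TO T (X \<^bold>\<times> Y)\<close> and its mirror image.\<close>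

definition strength :: "'o \<Rightarrow> 'o \<Rightarrow> 'a" where
  "strength X Y = mon T X Y \<cdot> (unit T X \<boxtimes> Id C (TO T Y))"

definition costrength :: "'o \<Rightarrow> 'o \<Rightarrow> 'a" where
  "costrength X Y = mon T X Y \<cdot> (Id C (TO T X) \<boxtimes> unit T Y)"

text \<open>The action \<open>Exp C X Y \<rightarrow> Exp C (TO T X) (TO T Y)\<close> of the enriched functor.\<close>

definition T_enriched :: "'o \<Rightarrow> 'o \<Rightarrow> 'a" where
  "T_enriched X Y = curry_map C (TO T X) (Exp C X Y) (TA T (Ev C X Y) \<cdot> costrength X (Exp C X Y))"

definition cotensor :: "'o \<Rightarrow> ('o, 'a) alg \<Rightarrow> ('o, 'a) alg" where
  "cotensor X A =
     (Exp C X (GO A),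
      curry_map C X (TO T (Exp C X (GO A)))
        (snd A \<cdot> TA T (Ev C X (GO A)) \<cdot> strength X (Exp C X (GO A))))"

text \<open>
  \<open>hom_incl A B\<close> is a chosen equalizer. Its domain carries the unique algebra structure for which
  it is a homomorphism into the cotensor \<open>cotensor (GO A) B\<close>.
\<close>

definition hom_incl :: "('o, 'a) alg \<Rightarrow> ('o, 'a) alg \<Rightarrow> 'a" where
  "hom_incl A B = (SOME k. is_equalizer C
     (exp_post C (TO T (GO A)) (snd B) \<cdot> T_enriched (GO A) (GO B))
     (exp_pre C (snd A) (GO B)) k)"

definition ihom :: "('o, 'a) alg \<Rightarrow> ('o, 'a) alg \<Rightarrow> ('o, 'a) alg" where
  "ihom A B =
     (let k = hom_incl A B; E = Dom C k
      in (E, THE h. h \<in> Hom C (TO T E) E \<and> k \<cdot> h = snd (cotensor (GO A) B) \<cdot> TA T k))"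

text \<open>The contravariant action of \<open>ihom\<close> on \<open>h : A \<rightarrow> B\<close>, an arrow \<open>ihom B E \<rightarrow> ihom A E\<close>.\<close>

definition ihom_map :: "('o, 'a) alg_map \<Rightarrow> ('o, 'a) alg \<Rightarrow> ('o, 'a) alg_map" where
  "ihom_map h E =
     (let A = Dom L h; B = Cod L h
      in (ihom B E,
          THE g. g \<in> Hom C (GO (ihom B E)) (GO (ihom A E)) \<and>
                 hom_incl A E \<cdot> g = exp_pre C (GA h) (GO E) \<cdot> hom_incl B E,
          ihom A E))"


subsection \<open>Duals, reflexivity and functional completeness\<close>

definition dual :: "('o, 'a) alg \<Rightarrow> ('o, 'a) alg" where
  "dual E = ihom E R"

definition dual_map :: "('o, 'a) alg_map \<Rightarrow> ('o, 'a) alg_map" where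
  "dual_map h = ihom_map h R"

text \<open>
  The canonical arrow \<open>E \<rightarrow> dual (dual E)\<close>, i.e. the transpose of the evaluation
  \<open>GO (dual E) \<^bold>\<times> GO E \<rightarrow> GO R\<close>.
\<close>

definition bidual_unit :: "('o, 'a) alg \<Rightarrow> ('o, 'a) alg_map" where
  "bidual_unit E =
     (E,
      THE d. d \<in> Hom C (GO E) (GO (dual (dual E))) \<and>
             hom_incl (dual E) R \<cdot> d =
               curry_map C (GO (dual E)) (GO E)
                 (Ev C (GO E) (GO R) \<cdot> (Id C (GO E) \<boxtimes> hom_incl E R) \<cdot> swap C (GO (dual E)) (GO E)),
      dual (dual E))"

definition reflexive :: "('o, 'a) alg \<Rightarrow> bool" where
  "reflexive E \<longleftrightarrow> iso L (bidual_unit E)"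

definition functionally_complete :: "('o, 'a) alg \<Rightarrow> bool" where
  "functionally_complete E \<longleftrightarrow> E \<in> Ob L \<and>
     (\<forall>h \<in> Arr L. iso L (dual_map (dual_map h)) \<longrightarrow> iso L (ihom_map h E))"

text \<open>\<open>d\<close> is the unit at \<open>E\<close> of the enriched reflection onto the functionally complete objects.\<close>

definition is_fc_reflection :: "('o, 'a) alg \<Rightarrow> ('o, 'a) alg_map \<Rightarrow> bool" where
  "is_fc_reflection E d \<longleftrightarrow> d \<in> Hom L E (Cod L d) \<and> functionally_complete (Cod L d) \<and>
     (\<forall>B. functionally_complete B \<longrightarrow> iso L (ihom_map d B))"


subsection \<open>Distributions\<close>

definition natural_distribution :: "'o \<Rightarrow> ('o, 'a) alg_map \<Rightarrow> bool" where
  "natural_distribution X \<mu> \<longleftrightarrow> \<mu> \<in> Hom L (cotensor X R) R"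

text \<open>
  The underlying map of the canonical isomorphism from \<open>dual (free X)\<close> to \<open>cotensor X R\<close>, which is
  restriction along the unit \<open>X \<rightarrow> TO T X\<close>.
\<close>

definition restrict_free :: "'o \<Rightarrow> 'a" where
  "restrict_free X = exp_pre C (unit T X) (GO R) \<cdot> hom_incl (free X) R"

text \<open>
  The element of \<open>dual (dual (free X))\<close> that corresponds to \<open>\<mu>\<close> names the composite of \<open>\<mu>\<close> with
  \<open>restrict_free X\<close>.
\<close>

definition dist_element :: "'o \<Rightarrow> ('o, 'a) alg_map \<Rightarrow> 'a" where
  "dist_element X \<mu> =
     (THE q. q \<in> elements C (GO (dual (dual (free X)))) \<and>
             hom_incl (dual (free X)) R \<cdot> q = name_of C (GA \<mu> \<cdot> restrict_free X))"

text \<open>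
  A reflection and its comparison \<open>i\<close> with the bidual are unique up to isomorphism, so the image
  does not depend on the choice of \<open>d\<close>.
\<close>

definition accessible :: "'o \<Rightarrow> ('o, 'a) alg_map \<Rightarrow> bool" where
  "accessible X \<mu> \<longleftrightarrow> natural_distribution X \<mu> \<and>
     (\<exists>d i. is_fc_reflection (free X) d \<and>
        i \<in> Hom L (Cod L d) (dual (dual (free X))) \<and> i \<cdot>\<^bsub>L\<^esub> d = bidual_unit (free X) \<and>
        (\<exists>p \<in> elements C (GO (Cod L d)). GA i \<cdot> p = dist_element X \<mu>))"

text \<open>The value \<open>\<mu>(f)\<close>, an element of \<open>GO R\<close>, for a map \<open>f : X \<rightarrow> GO R\<close>.\<close>

definition integral :: "('o, 'a) alg_map \<Rightarrow> 'a \<Rightarrow> 'a" where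
  "integral \<mu> f = GA \<mu> \<cdot> name_of C f"

definition integral_over :: "'o \<Rightarrow> ('o, 'a) alg_map \<Rightarrow> ('a \<Rightarrow> 'a) \<Rightarrow> 'a" where
  "integral_over X \<mu> \<phi> = integral \<mu> (map_of_fun C X (GO R) \<phi>)"

definition fubini ::
  "'o \<Rightarrow> 'o \<Rightarrow> ('o, 'a) alg_map \<Rightarrow> ('o, 'a) alg_map \<Rightarrow> ('o, 'a) alg_map \<Rightarrow> bool" where
  "fubini X Y \<mu> \<nu> \<rho> \<longleftrightarrow> (\<forall>f \<in> Hom C (X \<^bold>\<times> Y) (GO R).
     integral_over Y \<nu> (\<lambda>y. integral_over X \<mu> (\<lambda>x. f \<cdot> \<langle>x, y\<rangle>)) = integral \<rho> f \<and>
     integral \<rho> f = integral_over X \<mu> (\<lambda>x. integral_over Y \<nu> (\<lambda>y. f \<cdot> \<langle>x, y\<rangle>)))"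

end

end

theory Submission
  imports Defs
begin

text \<open>
  By well-pointedness everything can be checked on elements. The iterated integral
  \<open>f \<mapsto> \<mu> (\<lambda>x. \<nu> (f (x, -)))\<close> is always a natural distribution on the product, and a distribution is
  determined by its values, so uniqueness is immediate. For fixed \<open>\<nu>\<close> and \<open>f\<close> the two iterated
  integrals are functionals of \<open>\<mu>\<close> that agree at the points \<open>\<delta>\<^sub>x\<close>. If \<open>[X, R]\<close> is reflexive, every functional
  on \<open>[X, R]*\<close> is the evaluation at some \<open>g : X \<rightarrow> GR\<close>, hence is determined by its values at the points.
  If \<open>\<mu>\<close> is accessible, it lies in the functionally complete reflection of \<open>F X\<close>; since \<open>R\<close> is
  functionally complete, functionals on this reflection are determined by their restrictions to \<open>F X\<close>,
  hence again by their values at the points. The same argument shows that the product distribution is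
  accessible: extending \<open>(y, x) \<mapsto> \<delta>\<^bsub>(x, y)\<^esub>\<close> first along the reflection of \<open>F Y\<close>, then along that of \<open>F X\<close>,
  one obtains an element of the reflection of \<open>F (X \<times> Y)\<close> that names it. The reflection itself is the
  intersection of all functionally complete strong subalgebras of \<open>E**\<close> that contain the image of \<open>E\<close>.
\<close>

section \<open>Calculus of arrows\<close>

text \<open>Functional completeness is an invertibility condition on internal homs. It is traded for
  unique extension along \<open>h\<close> of maps with a parameter in an arbitrary object
  \<open>Z\<close> (\<open>orth\<close>, \<open>iso_ihom_map_iff\<close>). The parameter makes this
  the enriched condition, and it is also what allows the product distribution to be extended one
  variable at a time. Commutativity of the monad is used as the interchange of two iterated
  extensions (\<open>commutativity\<close>): it makes extension of maps linear in the map, so that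
  the homomorphisms form a subalgebra of a cotensor. Fubini's identity is reduced to a condition on
  one factor: \<open>determined\<close> is asked of \<open>\<mu>\<close>, while \<open>\<nu>\<close>
  may be any natural distribution. Accessibility speaks of some reflection, so only the universal
  property of the reflections of \<open>F X\<close> and \<open>F Y\<close> is available; the
  construction by intersections provides one for \<open>F (X \<times> Y)\<close>. Elements of a
  reflection are compared inside the bidual of \<open>F X\<close>, whereas distributions act on
  \<open>[X, R]\<close>; the isomorphism \<open>restrict_free\<close> with inverse
  \<open>extend_free\<close> mediates between the two.\<close>

text \<open>Weak congruence rules: the side conditions of the typing rules below would otherwise normalize
  the same composites again and again.\<close>

definition is_arr :: "('o, 'a, 'x) cat_scheme \<Rightarrow> 'a \<Rightarrow> bool" where
  "is_arr C f \<longleftrightarrow> f \<in> Arr C"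

lemma dom_weak_cong [cong]: "Dom C f = Dom C f" by (rule refl)

lemma cod_weak_cong [cong]: "Cod C f = Cod C f" by (rule refl)

lemma is_arr_weak_cong [cong]: "is_arr C f = is_arr C f" by (rule refl)

context category
begin

abbreviation arr :: "'a \<Rightarrow> bool" where
  "arr \<equiv> is_arr C"

lemma in_Arr [simp]: "f \<in> Arr C \<longleftrightarrow> arr f"
  by (simp add: is_arr_def)

lemma Hom_iff: "f \<in> Hom C A B \<longleftrightarrow> arr f \<and> Dom C f = A \<and> Cod C f = B"
  by (simp add: Hom_def)

lemma HomD:
  assumes "f \<in> Hom C A B"
  shows "arr f" "Dom C f = A" "Cod C f = B" "A \<in> Ob C" "B \<in> Ob C"
  using assms dom_ob cod_ob by (auto simp: Hom_def)

lemma comp_arr [simp]: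
  assumes "arr f" "arr g" "Dom C g = Cod C f"
  shows "arr (g \<cdot> f)" "Dom C (g \<cdot> f) = Dom C f" "Cod C (g \<cdot> f) = Cod C g"
  using comp_hom[of f "Dom C f" "Cod C f" g "Cod C g"] assms by (auto simp: Hom_def)

lemma id_arr [simp]:
  assumes "A \<in> Ob C"
  shows "arr (Id C A)" "Dom C (Id C A) = A" "Cod C (Id C A) = A"
  using id_hom[OF assms] by (auto simp: Hom_def)

lemma comp_id [simp]:
  assumes "arr f"
  shows "Dom C f = A \<Longrightarrow> f \<cdot> Id C A = f" "Cod C f = B \<Longrightarrow> Id C B \<cdot> f = f"
  using id_right[of f] id_left[of f] assms by (auto simp: Hom_def)

lemma comp_assoc [simp]:
  assumes "arr f" "arr g" "arr h" "Dom C g = Cod C f" "Dom C h = Cod C g"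
  shows "(h \<cdot> g) \<cdot> f = h \<cdot> (g \<cdot> f)"
  using assoc[of f _ _ g _ h] assms by (auto simp: Hom_def)

lemma dom_cod_ob [simp]: "arr f \<Longrightarrow> Dom C f \<in> Ob C" "arr f \<Longrightarrow> Cod C f \<in> Ob C"
  by (auto simp: dom_ob cod_ob)

section \<open>Monomorphisms, equalizers and strong intersections\<close>

lemma monicD:
  assumes "monic C m" "arr u" "arr v" "Cod C u = Dom C m" "Cod C v = Dom C m"
    and "m \<cdot> u = m \<cdot> v"
  shows "u = v"
proof -
  have "arr m" using assms(1) by (simp add: monic_def)
  then have "Dom C u = Dom C v" using assms by (metis comp_arr(2))
  then have "u \<in> Hom C (Dom C u) (Dom C m)" "v \<in> Hom C (Dom C u) (Dom C m)" "Dom C u \<in> Ob C"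
    using assms by (auto simp: Hom_iff)
  then show ?thesis using assms(1,6) unfolding monic_def by blast
qed

lemma monicI:
  assumes "arr m"
    and "\<And>u v. arr u \<Longrightarrow> arr v \<Longrightarrow> Dom C u = Dom C v \<Longrightarrow> Cod C u = Dom C m \<Longrightarrow>
           Cod C v = Dom C m \<Longrightarrow> m \<cdot> u = m \<cdot> v \<Longrightarrow> u = v"
  shows "monic C m"
  using assms by (auto simp: monic_def Hom_def)

lemma epicD:
  assumes "epic C e" "arr u" "arr v" "Dom C u = Cod C e" "Dom C v = Cod C e"
    and "Cod C u = Cod C v" "u \<cdot> e = v \<cdot> e"
  shows "u = v"
proof -
  have "u \<in> Hom C (Cod C e) (Cod C u)" "v \<in> Hom C (Cod C e) (Cod C u)" "Cod C u \<in> Ob C"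
    using assms by (auto simp: Hom_def)
  then show ?thesis using assms(1,7) unfolding epic_def by blast
qed

lemma equalizer_monic: "is_equalizer C f g k \<Longrightarrow> arr f \<Longrightarrow> arr g \<Longrightarrow> Dom C g = Dom C f \<Longrightarrow> monic C k"
proof (rule monicI)
  assume eq: "is_equalizer C f g k" and fg: "arr f" "arr g" "Dom C g = Dom C f"
  then show k: "arr k" by (simp add: is_equalizer_def Hom_def)
  have k': "Cod C k = Dom C f" "f \<cdot> k = g \<cdot> k" using eq by (auto simp: is_equalizer_def Hom_def)
  fix u v assume uv: "arr u" "arr v" "Dom C u = Dom C v" "Cod C u = Dom C k"
    "Cod C v = Dom C k" "k \<cdot> u = k \<cdot> v"
  have "k \<cdot> u \<in> Hom C (Dom C u) (Dom C f)" using k k' uv by (simp add: Hom_def)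
  moreover have "f \<cdot> (k \<cdot> u) = g \<cdot> (k \<cdot> u)"
    using k k' uv fg comp_assoc[of u k f] comp_assoc[of u k g] by simp
  ultimately have "\<exists>!w. w \<in> Hom C (Dom C u) (Dom C k) \<and> k \<cdot> w = k \<cdot> u"
    using eq by (simp add: is_equalizer_def)
  moreover have "u \<in> Hom C (Dom C u) (Dom C k)" "v \<in> Hom C (Dom C u) (Dom C k)"
    using uv by (auto simp: Hom_def)
  ultimately show "u = v" using uv by metis
qed

text \<open>Cancelling the monomorphism \<open>m\<close> yields both the upper triangle and the
  uniqueness of the diagonal, so only the lower triangle has to be found.\<close>

lemma strong_monicI:
  assumes "monic C m"
    and "\<And>e u v. epic C e \<Longrightarrow> u \<in> Hom C (Dom C e) (Dom C m) \<Longrightarrow> v \<in> Hom C (Cod C e) (Cod C m) \<Longrightarrow>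
        m \<cdot> u = v \<cdot> e \<Longrightarrow> \<exists>w. w \<in> Hom C (Cod C e) (Dom C m) \<and> m \<cdot> w = v"
  shows "strong_monic C m"
  unfolding strong_monic_def
proof (intro conjI allI impI; (elim conjE)?)
  show "monic C m" by fact
  fix e u v assume h: "epic C e" "u \<in> Hom C (Dom C e) (Dom C m)" "v \<in> Hom C (Cod C e) (Cod C m)"
        "m \<cdot> u = v \<cdot> e"
  then obtain w where w: "w \<in> Hom C (Cod C e) (Dom C m)" "m \<cdot> w = v" using assms(2) by blast
  have e: "arr e" and m: "arr m" using h(1) assms(1) by (auto simp: epic_def monic_def)
  have "m \<cdot> (w \<cdot> e) = m \<cdot> u" using w e m h by (simp add: Hom_def flip: comp_assoc)
  then have "w \<cdot> e = u" using monicD[OF assms(1), of "w \<cdot> e" u] w e h by (simp add: Hom_def)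
  moreover have "w' = w" if "w' \<in> Hom C (Cod C e) (Dom C m)" "m \<cdot> w' = v" for w'
    using monicD[OF assms(1), of w' w] that w by (simp add: Hom_def)
  ultimately show "\<exists>!w. w \<in> Hom C (Cod C e) (Dom C m) \<and> w \<cdot> e = u \<and> m \<cdot> w = v"
    using w by blast
qed

lemma equalizer_universal:
  "is_equalizer C f g k \<Longrightarrow> u \<in> Hom C Z (Dom C f) \<Longrightarrow> f \<cdot> u = g \<cdot> u \<Longrightarrow>
    \<exists>!v. v \<in> Hom C Z (Dom C k) \<and> k \<cdot> v = u"
  by (simp add: is_equalizer_def)

lemma equalizer_strong_monic:
  \<comment> \<open>The epimorphism \<open>e\<close> cancels from the equation of the two composites
    with \<open>v \<cdot> e\<close>; hence \<open>v\<close> itself equalizes the pair and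
    factors.\<close>
  assumes eq: "is_equalizer C f g k" and fg: "arr f" "arr g" "Dom C g = Dom C f" "Cod C g = Cod C f"
  shows "strong_monic C k"
proof (rule strong_monicI)
  show "monic C k" using equalizer_monic[OF eq] fg by simp
  have k: "arr k" "Cod C k = Dom C f" "f \<cdot> k = g \<cdot> k"
    using eq by (auto simp: is_equalizer_def Hom_def)
  fix e u v assume h: "epic C e" "u \<in> Hom C (Dom C e) (Dom C k)" "v \<in> Hom C (Cod C e) (Cod C k)"
        "k \<cdot> u = v \<cdot> e"
  have e: "arr e" using h by (simp add: epic_def)
  have u: "arr u" "Dom C u = Dom C e" "Cod C u = Dom C k" using h by (auto simp: Hom_def)
  have v: "arr v" "Dom C v = Cod C e" "Cod C v = Dom C f" using h k by (auto simp: Hom_def)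
  have "f \<cdot> (v \<cdot> e) = g \<cdot> (v \<cdot> e)"
    using h(4) k u fg comp_assoc[of u k f] comp_assoc[of u k g] by simp
  then have "(f \<cdot> v) \<cdot> e = (g \<cdot> v) \<cdot> e" using e v fg by simp
  then have "f \<cdot> v = g \<cdot> v" using epicD[OF h(1), of "f \<cdot> v" "g \<cdot> v"] v fg by simp
  then show "\<exists>w. w \<in> Hom C (Cod C e) (Dom C k) \<and> k \<cdot> w = v"
    using ex1_implies_ex[OF equalizer_universal[OF eq, of v "Cod C e"]] v k by (simp add: Hom_iff)
qed

text \<open>The diagonal is found against \<open>m\<close> first and then against \<open>n\<close>.
  This puts an equalizer inside an intersection back among the subobjects that were
  intersected.\<close>

lemma strong_monic_comp:
  assumes m: "strong_monic C m" and n: "strong_monic C n" and mn: "Dom C m = Cod C n"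
  shows "strong_monic C (m \<cdot> n)"
proof (rule strong_monicI)
  have mm: "monic C m" "monic C n" using m n by (auto simp: strong_monic_def)
  then have a: "arr m" "arr n" by (auto simp: monic_def)
  show "monic C (m \<cdot> n)"
  proof (rule monicI)
    show "arr (m \<cdot> n)" using a mn by simp
    fix u v assume "arr u" "arr v" "Dom C u = Dom C v" "Cod C u = Dom C (m \<cdot> n)"
      "Cod C v = Dom C (m \<cdot> n)" "(m \<cdot> n) \<cdot> u = (m \<cdot> n) \<cdot> v"
    then show "u = v"
      using a mn monicD[OF mm(1), of "n \<cdot> u" "n \<cdot> v"] monicD[OF mm(2), of u v] by simp
  qed
  fix e u v assume h: "epic C e" "u \<in> Hom C (Dom C e) (Dom C (m \<cdot> n))"
    "v \<in> Hom C (Cod C e) (Cod C (m \<cdot> n))" "(m \<cdot> n) \<cdot> u = v \<cdot> e"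
  have "m \<cdot> (n \<cdot> u) = v \<cdot> e" "n \<cdot> u \<in> Hom C (Dom C e) (Dom C m)" "v \<in> Hom C (Cod C e) (Cod C m)"
    using h a mn by (auto simp: Hom_def)
  then obtain w where w: "w \<in> Hom C (Cod C e) (Dom C m)" "w \<cdot> e = n \<cdot> u" "m \<cdot> w = v"
    using m h(1) unfolding strong_monic_def by metis
  have "u \<in> Hom C (Dom C e) (Dom C n)" "w \<in> Hom C (Cod C e) (Cod C n)" using h w mn a by (auto simp: Hom_def)
  then obtain w' where w': "w' \<in> Hom C (Cod C e) (Dom C n)" "n \<cdot> w' = w"
    using n h(1) w(2) unfolding strong_monic_def by metis
  then show "\<exists>w. w \<in> Hom C (Cod C e) (Dom C (m \<cdot> n)) \<and> (m \<cdot> n) \<cdot> w = v"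
    using w a mn by (intro exI[of _ w']) (simp add: Hom_def)
qed

text \<open>The parallel pair is encoded as the graph with vertices \<open>0\<close>, \<open>1\<close> and edges \<open>0\<close>, \<open>1\<close>.\<close>

lemma equalizer_exists:
  assumes lim: "has_finite_limits C" and f: "f \<in> Hom C A B" and g: "g \<in> Hom C A B"
  shows "\<exists>k. is_equalizer C f g k"
proof -
  define D where "D = (\<lambda>v::nat. if v = 0 then A else B)"
  define d where "d = (\<lambda>e::nat. if e = 0 then f else g)"
  have "\<exists>P p. is_cone C {0,1::nat} {0,1::nat} (\<lambda>_. 0) (\<lambda>_. 1) D d P p \<and>
           (\<forall>Q q. is_cone C {0,1::nat} {0,1::nat} (\<lambda>_. 0) (\<lambda>_. 1) D d Q q \<longrightarrow>
              (\<exists>!u. u \<in> Hom C Q P \<and> (\<forall>v \<in> {0,1}. p v \<cdot> u = q v)))"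
    by (rule lim[unfolded has_finite_limits_def, rule_format])
      (use f g HomD[OF f] in \<open>auto simp: D_def d_def\<close>)
  then obtain P p where cone: "is_cone C {0,1::nat} {0,1::nat} (\<lambda>_. 0) (\<lambda>_. 1) D d P p"
    and univ: "\<And>Q q. is_cone C {0,1::nat} {0,1::nat} (\<lambda>_. 0) (\<lambda>_. 1) D d Q q \<Longrightarrow>
              (\<exists>!u. u \<in> Hom C Q P \<and> (\<forall>v \<in> {0,1}. p v \<cdot> u = q v))" by blast
  have p: "p 0 \<in> Hom C P A" "f \<cdot> p 0 = p 1" "g \<cdot> p 0 = p 1"
    using cone by (auto simp: is_cone_def D_def d_def)
  have "is_equalizer C f g (p 0)"
    unfolding is_equalizer_def
  proof (intro conjI allI ballI impI)
    show "p 0 \<in> Hom C (Dom C (p 0)) (Dom C f)" using p HomD[OF f] HomD[OF p(1)] by simp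
    show "f \<cdot> p 0 = g \<cdot> p 0" using p by simp
    fix Z u assume u: "u \<in> Hom C Z (Dom C f)" and e: "f \<cdot> u = g \<cdot> u"
    have "is_cone C {0,1::nat} {0,1::nat} (\<lambda>_. 0) (\<lambda>_. 1) D d Z (\<lambda>v. if v = 0 then u else f \<cdot> u)"
      using u e HomD[OF f] HomD[OF u] f comp_hom[of u Z A f B] by (auto simp: is_cone_def D_def d_def)
    from univ[OF this]
    have ex: "\<exists>!w. w \<in> Hom C Z P \<and> p 0 \<cdot> w = u \<and> p 1 \<cdot> w = f \<cdot> u" by simp
    have "p 1 \<cdot> w = f \<cdot> u" if "w \<in> Hom C Z P" "p 0 \<cdot> w = u" for w
      using that p(1) f unfolding p(2)[symmetric] by (simp add: Hom_def)
    then show "\<exists>!v. v \<in> Hom C Z (Dom C (p 0)) \<and> p 0 \<cdot> v = u"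
      using ex HomD[OF p(1)] by metis
  qed
  then show ?thesis by blast
qed

text \<open>A factorization through a monomorphism is unique, so the legs of the limit need not be
  remembered and mere factorizations suffice. Strongness is inherited because the diagonals into all
  members have the same composite \<open>v\<close>, which then factors through the
  intersection.\<close>

lemma strong_intersection:
  assumes int: "has_strong_intersections C" and B: "B \<in> Ob C"
    and M': "\<forall>m \<in> M. strong_monic C m \<and> Cod C m = B"
  shows "\<exists>P p. p \<in> Hom C P B \<and> (\<forall>m \<in> M. \<exists>l \<in> Hom C P (Dom C m). m \<cdot> l = p) \<and> strong_monic C p \<and>
    (\<forall>Q q. q \<in> Hom C Q B \<longrightarrow> (\<forall>m \<in> M. \<exists>k \<in> Hom C Q (Dom C m). m \<cdot> k = q) \<longrightarrow>
      (\<exists>u \<in> Hom C Q P. p \<cdot> u = q))"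
proof -
  have M: "\<And>m. m \<in> M \<Longrightarrow> strong_monic C m \<and> Cod C m = B" using M' by blast
  note int[unfolded has_strong_intersections_def, THEN bspec, OF B, THEN spec[of _ M], THEN mp, OF M']
  then obtain P p l where p: "p \<in> Hom C P B"
    and l': "\<forall>m \<in> M. l m \<in> Hom C P (Dom C m) \<and> m \<cdot> l m = p"
    and univ': "\<forall>Q q k. q \<in> Hom C Q B \<and> (\<forall>m \<in> M. k m \<in> Hom C Q (Dom C m) \<and> m \<cdot> k m = q) \<longrightarrow>
      (\<exists>!u. u \<in> Hom C Q P \<and> p \<cdot> u = q \<and> (\<forall>m \<in> M. l m \<cdot> u = k m))"
    by (elim exE conjE)
  have l: "l m \<in> Hom C P (Dom C m) \<and> m \<cdot> l m = p" if "m \<in> M" for m using l' that by blast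
  have univ: "\<exists>!u. u \<in> Hom C Q P \<and> p \<cdot> u = q \<and> (\<forall>m \<in> M. l m \<cdot> u = k m)"
    if "q \<in> Hom C Q B" "\<And>m. m \<in> M \<Longrightarrow> k m \<in> Hom C Q (Dom C m) \<and> m \<cdot> k m = q" for Q q k
    by (rule univ'[rule_format]) (use that in blast)
  note pa = HomD(1-3)[OF p]
  have univ': "\<exists>u \<in> Hom C Q P. p \<cdot> u = q"
    if q: "q \<in> Hom C Q B" and "\<And>m. m \<in> M \<Longrightarrow> \<exists>k \<in> Hom C Q (Dom C m). m \<cdot> k = q" for Q q
  proof -
    from that(2) have "\<forall>m. \<exists>k. m \<in> M \<longrightarrow> k \<in> Hom C Q (Dom C m) \<and> m \<cdot> k = q" by blast
    then obtain k where "\<forall>m. m \<in> M \<longrightarrow> k m \<in> Hom C Q (Dom C m) \<and> m \<cdot> k m = q"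
      using choice by (metis (full_types))
    then show ?thesis using univ[OF q, of k] by blast
  qed
  have mp: "monic C p"
  proof (rule monicI)
    fix u v assume uv: "arr u" "arr v" "Dom C u = Dom C v" "Cod C u = Dom C p" "Cod C v = Dom C p"
      "p \<cdot> u = p \<cdot> v"
    have lu: "l m \<cdot> u = l m \<cdot> v" if m: "m \<in> M" for m
    proof -
      have mm: "monic C m" using M[OF m] by (simp add: strong_monic_def)
      then have ma: "arr m" by (simp add: monic_def)
      have lm: "arr (l m)" "Dom C (l m) = P" "Cod C (l m) = Dom C m" "m \<cdot> l m = p"
        using l[OF m] by (auto simp: Hom_iff)
      have "m \<cdot> (l m \<cdot> u) = m \<cdot> (l m \<cdot> v)"
        using arg_cong[OF lm(4), of "\<lambda>f. f \<cdot> u"] arg_cong[OF lm(4), of "\<lambda>f. f \<cdot> v"] lm(1-3) uv pa ma by simp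
      then show ?thesis using monicD[OF mm, of "l m \<cdot> u" "l m \<cdot> v"] lm(1-3) uv pa by simp
    qed
    have "p \<cdot> u \<in> Hom C (Dom C v) B" using uv pa by (simp add: Hom_iff)
    moreover have "l m \<cdot> u \<in> Hom C (Dom C v) (Dom C m) \<and> m \<cdot> (l m \<cdot> u) = p \<cdot> u" if m: "m \<in> M" for m
    proof -
      have ma: "arr m" using M[OF m] by (simp add: strong_monic_def monic_def)
      have lm: "arr (l m)" "Dom C (l m) = P" "Cod C (l m) = Dom C m" "m \<cdot> l m = p"
        using l[OF m] by (auto simp: Hom_iff)
      show ?thesis using arg_cong[OF lm(4), of "\<lambda>f. f \<cdot> u"] lm(1-3) uv(1,3,4) pa ma by (simp add: Hom_iff)
    qed
    ultimately have "\<exists>!w. w \<in> Hom C (Dom C v) P \<and> p \<cdot> w = p \<cdot> u \<and> (\<forall>m \<in> M. l m \<cdot> w = l m \<cdot> u)"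
      by (rule univ)
    moreover have "u \<in> Hom C (Dom C v) P" "v \<in> Hom C (Dom C v) P" using uv pa by (auto simp: Hom_iff)
    ultimately show "u = v" using uv(6) lu by metis
  qed (use pa in simp)
  have "strong_monic C p"
  proof (rule strong_monicI[OF mp])
    fix e u v assume h: "epic C e" "u \<in> Hom C (Dom C e) (Dom C p)" "v \<in> Hom C (Cod C e) (Cod C p)"
        "p \<cdot> u = v \<cdot> e"
    have "\<exists>k \<in> Hom C (Cod C e) (Dom C m). m \<cdot> k = v" if m: "m \<in> M" for m
    proof -
      have ma: "arr m" "Cod C m = B" using M[OF m] by (simp_all add: strong_monic_def monic_def)
      have lm: "arr (l m)" "Dom C (l m) = P" "Cod C (l m) = Dom C m" "m \<cdot> l m = p"
        using l[OF m] by (auto simp: Hom_iff)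
      have ua: "arr u" "Dom C u = Dom C e" "Cod C u = P" using h(2) pa by (auto simp: Hom_iff)
      have "m \<cdot> (l m \<cdot> u) = v \<cdot> e"
        unfolding h(4)[symmetric] using arg_cong[OF lm(4), of "\<lambda>f. f \<cdot> u"] lm(1-3) ua ma by simp
      moreover have "l m \<cdot> u \<in> Hom C (Dom C e) (Dom C m)" "v \<in> Hom C (Cod C e) (Cod C m)"
        using lm(1-3) ua ma h(3) pa by (auto simp: Hom_iff)
      ultimately show ?thesis
        using M[OF m] h(1) unfolding strong_monic_def by metis
    qed
    then show "\<exists>w. w \<in> Hom C (Cod C e) (Dom C p) \<and> p \<cdot> w = v"
      using univ'[of v "Cod C e"] h(3) pa by auto
  qed
  moreover have "\<forall>m \<in> M. \<exists>l \<in> Hom C P (Dom C m). m \<cdot> l = p" using l by blast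
  ultimately show ?thesis using p univ' by blast
qed

end

section \<open>Products, exponentials and names of maps\<close>

context cartesian_closed
begin

lemma one_in_ob [simp]: "One C \<in> Ob C"
  by (rule one_ob)

lemma prod_exp_ob [simp]:
  assumes "A \<in> Ob C" "B \<in> Ob C" shows "A \<^bold>\<times> B \<in> Ob C" "Exp C A B \<in> Ob C"
  using assms by (auto intro: prod_ob exp_ob)

lemma fst_snd_arr [simp]:
  assumes "A \<in> Ob C" "B \<in> Ob C"
  shows "arr (Fst C A B)" "Dom C (Fst C A B) = A \<^bold>\<times> B" "Cod C (Fst C A B) = A"
    "arr (Snd C A B)" "Dom C (Snd C A B) = A \<^bold>\<times> B" "Cod C (Snd C A B) = B"
  using fst_hom[OF assms] snd_hom[OF assms] by (auto simp: Hom_def)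

lemma ev_arr [simp]:
  assumes "A \<in> Ob C" "B \<in> Ob C"
  shows "arr (Ev C A B)" "Dom C (Ev C A B) = A \<^bold>\<times> Exp C A B" "Cod C (Ev C A B) = B"
  using ev_hom[OF assms] by (auto simp: Hom_def)

lemma pair_props:
  assumes "arr f" "arr g" "Dom C f = Dom C g"
  shows "\<langle>f, g\<rangle> \<in> Hom C (Dom C f) (Cod C f \<^bold>\<times> Cod C g) \<and> Fst C (Cod C f) (Cod C g) \<cdot> \<langle>f, g\<rangle> = f \<and>
    Snd C (Cod C f) (Cod C g) \<cdot> \<langle>f, g\<rangle> = g"
  unfolding pair_def
  by (rule theI', rule prod_universal) (use assms in \<open>simp_all add: Hom_def\<close>)

lemma pair_arr [simp]:
  assumes "arr f" "arr g" "Dom C f = Dom C g"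
  shows "arr (\<langle>f, g\<rangle>)" "Dom C \<langle>f, g\<rangle> = Dom C g" "Cod C \<langle>f, g\<rangle> = Cod C f \<^bold>\<times> Cod C g"
  using pair_props[OF assms] assms by (auto simp: Hom_def)

lemma fst_snd_pair [simp]:
  assumes "arr f" "arr g" "Dom C f = Dom C g" "Cod C f = A" "Cod C g = B"
  shows "Fst C A B \<cdot> \<langle>f, g\<rangle> = f" "Snd C A B \<cdot> \<langle>f, g\<rangle> = g"
  using pair_props[of f g] assms by auto

lemma pair_eqI:
  assumes "arr h" "Cod C h = A \<^bold>\<times> B" "A \<in> Ob C" "B \<in> Ob C"
    "Fst C A B \<cdot> h = f" "Snd C A B \<cdot> h = g"
  shows "\<langle>f, g\<rangle> = h"
proof -
  have fg: "f \<in> Hom C (Dom C h) A" "g \<in> Hom C (Dom C h) B" using assms by (auto simp: Hom_def)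
  have "h \<in> Hom C (Dom C h) (A \<^bold>\<times> B) \<and> Fst C A B \<cdot> h = f \<and> Snd C A B \<cdot> h = g"
    using assms by (simp add: Hom_def)
  moreover have "\<langle>f, g\<rangle> \<in> Hom C (Dom C h) (A \<^bold>\<times> B) \<and> Fst C A B \<cdot> \<langle>f, g\<rangle> = f \<and>
      Snd C A B \<cdot> \<langle>f, g\<rangle> = g"
    using pair_props[of f g] HomD[OF fg(1)] HomD[OF fg(2)] by simp
  ultimately show ?thesis using prod_universal[OF fg] by blast
qed

lemma pair_comp [simp]:
  assumes "arr f" "arr g" "Dom C f = Dom C g" "arr h" "Cod C h = Dom C g"
  shows "\<langle>f, g\<rangle> \<cdot> h = \<langle>f \<cdot> h, g \<cdot> h\<rangle>"
  by (rule pair_eqI[symmetric, of _ "Cod C f" "Cod C g"])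
    (use assms in \<open>simp_all flip: comp_assoc\<close>)

lemma pair_eta [simp]:
  assumes "A \<in> Ob C" "B \<in> Ob C"
  shows "\<langle>Fst C A B, Snd C A B\<rangle> = Id C (A \<^bold>\<times> B)"
    "arr h \<Longrightarrow> Cod C h = A \<^bold>\<times> B \<Longrightarrow> \<langle>Fst C A B \<cdot> h, Snd C A B \<cdot> h\<rangle> = h"
  using assms by (auto intro: pair_eqI)

lemma prod_map_eq [simp]:
  "f \<boxtimes> g = \<langle>f \<cdot> Fst C (Dom C f) (Dom C g), g \<cdot> Snd C (Dom C f) (Dom C g)\<rangle>"
  by (simp add: prod_map_def)

lemma prod_map_arr [simp]:
  assumes "arr f" "arr g"
  shows "arr (f \<boxtimes> g)" "Dom C (f \<boxtimes> g) = Dom C f \<^bold>\<times> Dom C g" "Cod C (f \<boxtimes> g) = Cod C f \<^bold>\<times> Cod C g"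
  unfolding prod_map_eq using assms by auto

lemma swap_eq [simp]: "swap C A B = \<langle>Snd C A B, Fst C A B\<rangle>"
  by (simp add: swap_def)

lemma swap_arr [simp]:
  assumes "A \<in> Ob C" "B \<in> Ob C"
  shows "arr (swap C A B)" "Dom C (swap C A B) = A \<^bold>\<times> B" "Cod C (swap C A B) = B \<^bold>\<times> A"
  unfolding swap_eq using assms by auto

lemma curry_props:
  assumes "X \<in> Ob C" "Z \<in> Ob C" "arr f" "Dom C f = X \<^bold>\<times> Z"
  shows "curry_map C X Z f \<in> Hom C Z (Exp C X (Cod C f)) \<and>
     Ev C X (Cod C f) \<cdot> (Id C X \<boxtimes> curry_map C X Z f) = f"
  unfolding curry_map_def
  by (rule theI', rule exp_universal) (use assms in \<open>simp_all add: Hom_def del: prod_map_eq\<close>)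

lemma curry_arr [simp]:
  assumes "X \<in> Ob C" "Z \<in> Ob C" "arr f" "Dom C f = X \<^bold>\<times> Z"
  shows "arr (curry_map C X Z f)" "Dom C (curry_map C X Z f) = Z"
    "Cod C (curry_map C X Z f) = Exp C X (Cod C f)"
  using curry_props[OF assms] by (auto simp: Hom_def)

text \<open>Two forms, since \<open>simp\<close> removes identities: a curried map that stands alone
  does not match the pattern with a right factor \<open>z\<close>. The same holds for
  \<open>ev_name\<close>.\<close>

lemma ev_curry [simp]:
  assumes "X \<in> Ob C" "Z \<in> Ob C" "arr f" "Dom C f = X \<^bold>\<times> Z" "Cod C f = Y" "arr x" "Cod C x = X"
  shows "Dom C x = Z \<Longrightarrow> Ev C X Y \<cdot> \<langle>x, curry_map C X Z f\<rangle> = f \<cdot> \<langle>x, Id C Z\<rangle>"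
    "arr z \<Longrightarrow> Cod C z = Z \<Longrightarrow> Dom C x = Dom C z \<Longrightarrow>
      Ev C X Y \<cdot> \<langle>x, curry_map C X Z f \<cdot> z\<rangle> = f \<cdot> \<langle>x, z\<rangle>"
proof -
  have 1: "Ev C X Y \<cdot> \<langle>x, curry_map C X Z f \<cdot> z\<rangle> = f \<cdot> \<langle>x, z\<rangle>"
    if "arr z" "Cod C z = Z" "Dom C x = Dom C z" for z
  proof -
    have "f \<cdot> \<langle>x, z\<rangle> = (Ev C X (Cod C f) \<cdot> (Id C X \<boxtimes> curry_map C X Z f)) \<cdot> \<langle>x, z\<rangle>"
      using curry_props[OF assms(1-4)] by simp
    also have "\<dots> = Ev C X Y \<cdot> \<langle>x, curry_map C X Z f \<cdot> z\<rangle>"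
      using assms that dom_cod_ob(2)[of f] by simp
    finally show ?thesis by simp
  qed
  then show "arr z \<Longrightarrow> Cod C z = Z \<Longrightarrow> Dom C x = Dom C z \<Longrightarrow>
      Ev C X Y \<cdot> \<langle>x, curry_map C X Z f \<cdot> z\<rangle> = f \<cdot> \<langle>x, z\<rangle>" by simp
  show "Dom C x = Z \<Longrightarrow> Ev C X Y \<cdot> \<langle>x, curry_map C X Z f\<rangle> = f \<cdot> \<langle>x, Id C Z\<rangle>"
    using 1[of "Id C Z"] assms by simp
qed

lemma curry_eqI:
  assumes "u \<in> Hom C Z (Exp C X Y)" "v \<in> Hom C Z (Exp C X Y)" "X \<in> Ob C" "Y \<in> Ob C"
    and "Ev C X Y \<cdot> \<langle>Fst C X Z, u \<cdot> Snd C X Z\<rangle> = Ev C X Y \<cdot> \<langle>Fst C X Z, v \<cdot> Snd C X Z\<rangle>"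
  shows "u = v"
proof -
  have "Z \<in> Ob C" using HomD[OF assms(1)] by simp
  then have "\<exists>!g. g \<in> Hom C Z (Exp C X Y) \<and>
      Ev C X Y \<cdot> (Id C X \<boxtimes> g) = Ev C X Y \<cdot> \<langle>Fst C X Z, u \<cdot> Snd C X Z\<rangle>"
    using HomD[OF assms(1)] assms(3,4)
    by (intro exp_universal) (simp_all add: Hom_def del: prod_map_eq)
  moreover have "Ev C X Y \<cdot> (Id C X \<boxtimes> g) = Ev C X Y \<cdot> \<langle>Fst C X Z, g \<cdot> Snd C X Z\<rangle>"
    if "g \<in> Hom C Z (Exp C X Y)" for g
    using HomD[OF that] assms(3) by simp
  ultimately show ?thesis using assms(1,2,5) by metis
qed

definition bang :: "'o \<Rightarrow> 'a" where
  "bang A = (THE h. h \<in> Hom C A (One C))"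

lemma bang_hom: "A \<in> Ob C \<Longrightarrow> bang A \<in> Hom C A (One C)"
  unfolding bang_def by (rule theI') (rule one_terminal)

lemma bang_arr [simp]:
  assumes "A \<in> Ob C"
  shows "arr (bang A)" "Dom C (bang A) = A" "Cod C (bang A) = One C"
  using bang_hom[OF assms] by (auto simp: Hom_def)

lemma bang_unique: "arr f \<Longrightarrow> Cod C f = One C \<Longrightarrow> f = bang (Dom C f)"
  using one_terminal[of "Dom C f"] bang_hom[of "Dom C f"] dom_cod_ob(1)[of f]
  unfolding Hom_iff by blast

lemma bang_comp [simp]: "arr f \<Longrightarrow> Cod C f = B \<Longrightarrow> bang B \<cdot> f = bang (Dom C f)"
  using bang_unique[of "bang B \<cdot> f"] dom_cod_ob(2)[of f] by auto

lemma bang_one [simp]: "bang (One C) = Id C (One C)"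
  using bang_unique[of "Id C (One C)"] by simp

lemma elements_iff [simp]: "x \<in> elements C X \<longleftrightarrow> arr x \<and> Dom C x = One C \<and> Cod C x = X"
  by (simp add: elements_def Hom_def)

lemma name_arr [simp]:
  assumes "arr f" "Dom C f = X"
  shows "arr (name_of C f)" "Dom C (name_of C f) = One C" "Cod C (name_of C f) = Exp C X (Cod C f)"
  unfolding name_of_def using assms dom_cod_ob(1)[of f] by auto

lemma ev_name [simp]:
  assumes "arr f" "Dom C f = X" "Cod C f = Y" "arr x" "Cod C x = X"
  shows "Dom C x = One C \<Longrightarrow> Ev C X Y \<cdot> \<langle>x, name_of C f\<rangle> = f \<cdot> x"
    "arr u \<Longrightarrow> Cod C u = One C \<Longrightarrow> Dom C x = Dom C u \<Longrightarrow>
      Ev C X Y \<cdot> \<langle>x, name_of C f \<cdot> u\<rangle> = f \<cdot> x"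
  unfolding name_of_def using assms dom_cod_ob(1)[of f] by auto

end

section \<open>Extensionality on elements\<close>

locale well_pointed_ccc = cartesian_closed C for C :: "('o, 'a) ccc" (structure) +
  assumes well_pointed: "well_pointed C"
begin

abbreviation ev :: "'o \<Rightarrow> 'o \<Rightarrow> 'a \<Rightarrow> 'a \<Rightarrow> 'a" where
  "ev X Y x u \<equiv> Ev C X Y \<cdot> \<langle>x, u\<rangle>"

abbreviation el :: "'o \<Rightarrow> 'a set" where
  "el \<equiv> elements C"

lemma map_eqI:
  assumes "f \<in> Hom C X Y" "g \<in> Hom C X Y"
    and "\<And>x. x \<in> el X \<Longrightarrow> f \<cdot> x = g \<cdot> x"
  shows "f = g"
  using well_pointed assms HomD[OF assms(1)] unfolding well_pointed_def by blast

lemma map2_eqI: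
  assumes "f \<in> Hom C (X \<^bold>\<times> Y) Z" "g \<in> Hom C (X \<^bold>\<times> Y) Z" "X \<in> Ob C" "Y \<in> Ob C"
    and "\<And>x y. x \<in> el X \<Longrightarrow> y \<in> el Y \<Longrightarrow> f \<cdot> \<langle>x, y\<rangle> = g \<cdot> \<langle>x, y\<rangle>"
  shows "f = g"
proof (rule map_eqI[OF assms(1,2)])
  fix z assume "z \<in> el (X \<^bold>\<times> Y)"
  then show "f \<cdot> z = g \<cdot> z"
    using assms(3-4) assms(5)[of "Fst C X Y \<cdot> z" "Snd C X Y \<cdot> z"] by simp
qed

lemma exp_eqI:
  assumes "u \<in> Hom C Z (Exp C X Y)" "v \<in> Hom C Z (Exp C X Y)" "X \<in> Ob C" "Y \<in> Ob C"
    and "\<And>x z. x \<in> el X \<Longrightarrow> z \<in> el Z \<Longrightarrow>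
      ev X Y x (u \<cdot> z) = ev X Y x (v \<cdot> z)"
  shows "u = v"
proof (rule curry_eqI[OF assms(1-4)])
  show "ev X Y (Fst C X Z) (u \<cdot> Snd C X Z) = ev X Y (Fst C X Z) (v \<cdot> Snd C X Z)"
    by (rule map2_eqI[of _ X Z Y]) (use assms HomD[OF assms(1)] in \<open>auto simp: Hom_def\<close>)
qed

lemma exp_element_eqI:
  assumes "u \<in> el (Exp C X Y)" "v \<in> el (Exp C X Y)" "X \<in> Ob C" "Y \<in> Ob C"
    and "\<And>x. x \<in> el X \<Longrightarrow> ev X Y x u = ev X Y x v"
  shows "u = v"
proof (rule exp_eqI[of _ "One C" X Y])
  fix x z assume "x \<in> el X" "z \<in> el (One C)"
  moreover from this have "z = Id C (One C)" using bang_unique[of z] by simp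
  ultimately show "ev X Y x (u \<cdot> z) = ev X Y x (v \<cdot> z)" using assms by simp
qed (use assms in \<open>auto simp: Hom_def\<close>)

end

section \<open>The monad and its algebras on elements\<close>

locale symmetric_monoidal_monad_setting =
  symmetric_monoidal_monad C T + well_pointed_ccc C + monad_data C T
  for C :: "('o, 'a) ccc" (structure) and T :: "('o, 'a) mon_monad" +
  assumes finitely_well_complete: "finitely_well_complete C"
begin

lemma TO_in_ob [simp]: "A \<in> Ob C \<Longrightarrow> TO T A \<in> Ob C"
  by (rule TO_ob)

lemma TA_arr [simp]:
  assumes "arr f"
  shows "arr (TA T f)" "Dom C (TA T f) = TO T (Dom C f)" "Cod C (TA T f) = TO T (Cod C f)"
  using TA_hom[of f "Dom C f" "Cod C f"] assms by (auto simp: Hom_def)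

lemma TA_comp_arr [simp]:
  "arr f \<Longrightarrow> arr g \<Longrightarrow> Dom C g = Cod C f \<Longrightarrow> TA T (g \<cdot> f) = TA T g \<cdot> TA T f"
  using TA_comp[of f "Dom C f" "Cod C f" g "Cod C g"] by (simp add: Hom_def)

declare TA_id [simp]

lemma unit_mult_arr [simp]:
  assumes "A \<in> Ob C"
  shows "arr (unit T A)" "Dom C (unit T A) = A" "Cod C (unit T A) = TO T A"
    "arr (mult T A)" "Dom C (mult T A) = TO T (TO T A)" "Cod C (mult T A) = TO T A"
  using unit_hom[OF assms] mult_hom[OF assms] by (auto simp: Hom_def)

lemma unit_comp [simp]: "arr f \<Longrightarrow> Cod C f = B \<Longrightarrow> unit T B \<cdot> f = TA T f \<cdot> unit T (Dom C f)"
  using unit_natural[of f "Dom C f" "Cod C f"] by (auto simp: Hom_def)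

lemma mult_comp:
  assumes "arr f" "Dom C f = A" "Cod C f = B"
  shows "mult T B \<cdot> TA T (TA T f) = TA T f \<cdot> mult T A"
  using mult_natural[of f A B] assms by (simp add: Hom_def)

lemma mon_arr [simp]:
  assumes "A \<in> Ob C" "B \<in> Ob C"
  shows "arr (mon T A B)" "Dom C (mon T A B) = TO T A \<^bold>\<times> TO T B"
    "Cod C (mon T A B) = TO T (A \<^bold>\<times> B)"
  using mon_hom[OF assms] by (auto simp: Hom_def)

text \<open>Naturality in the shape in which it is met once products of arrows have been rewritten
  to pairings.\<close>

lemma mon_comp:
  assumes "arr f" "arr g" "arr s" "arr t" "Dom C s = Dom C t"
    "Cod C s = TO T (Dom C f)" "Cod C t = TO T (Dom C g)" "Cod C f = A" "Cod C g = B"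
  shows "mon T A B \<cdot> \<langle>TA T f \<cdot> s, TA T g \<cdot> t\<rangle> =
    TA T (f \<boxtimes> g) \<cdot> (mon T (Dom C f) (Dom C g) \<cdot> \<langle>s, t\<rangle>)"
proof -
  have "TA T (f \<boxtimes> g) \<cdot> mon T (Dom C f) (Dom C g) = mon T A B \<cdot> (TA T f \<boxtimes> TA T g)"
    by (rule mon_natural) (use assms in \<open>auto simp: Hom_def\<close>)
  then have "(TA T (f \<boxtimes> g) \<cdot> mon T (Dom C f) (Dom C g)) \<cdot> \<langle>s, t\<rangle> =
      (mon T A B \<cdot> (TA T f \<boxtimes> TA T g)) \<cdot> \<langle>s, t\<rangle>" by simp
  moreover have "A \<in> Ob C" "B \<in> Ob C" using assms by auto
  ultimately show ?thesis using assms by simp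
qed

section \<open>The two strengths and commutativity of the monad\<close>

lemma strength_arr [simp]:
  assumes "A \<in> Ob C" "B \<in> Ob C"
  shows "arr (strength A B)" "Dom C (strength A B) = A \<^bold>\<times> TO T B"
    "Cod C (strength A B) = TO T (A \<^bold>\<times> B)"
    "arr (costrength A B)" "Dom C (costrength A B) = TO T A \<^bold>\<times> B"
    "Cod C (costrength A B) = TO T (A \<^bold>\<times> B)"
  unfolding strength_def costrength_def using assms by auto

text \<open>Naturality in the arrow \<open>x\<close> out of \<open>One C\<close> reduces the claim
  to the parameter object \<open>One C\<close>. There it is the right unit law of the monoidal
  functor, from which \<open>TA T (Fst C Y (One C))\<close> is cancelled by means of its
  inverse.\<close>

lemma costrength_slice:
  assumes "x \<in> el X" "X \<in> Ob C" "Y \<in> Ob C"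
  shows "costrength Y X \<cdot> \<langle>Id C (TO T Y), x \<cdot> bang (TO T Y)\<rangle> = TA T \<langle>Id C Y, x \<cdot> bang Y\<rangle>"
proof -
  let ?e = "\<langle>Id C (TO T Y), unit T (One C) \<cdot> bang (TO T Y)\<rangle>"
  have snd: "Snd C Y (One C) = bang (Y \<^bold>\<times> One C)" "Snd C (TO T Y) (One C) = bang (TO T Y \<^bold>\<times> One C)"
    using bang_unique[of "Snd C Y (One C)"] bang_unique[of "Snd C (TO T Y) (One C)"] assms by simp_all
  have "\<langle>Id C Y, bang Y\<rangle> \<cdot> Fst C Y (One C) = Id C (Y \<^bold>\<times> One C)"
    using assms pair_eta(1)[of Y "One C"] by (simp add: snd del: pair_eta)
  then have i: "TA T \<langle>Id C Y, bang Y\<rangle> \<cdot> TA T (Fst C Y (One C)) = Id C (TO T (Y \<^bold>\<times> One C))"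
    using assms by (simp flip: TA_comp_arr)
  have "TA T (Fst C Y (One C)) \<cdot> (mon T Y (One C) \<cdot> (Id C (TO T Y) \<boxtimes> unit T (One C))) =
      Fst C (TO T Y) (One C)"
    using mon_unit_right[of Y] assms by simp
  then have "(TA T (Fst C Y (One C)) \<cdot> (mon T Y (One C) \<cdot> (Id C (TO T Y) \<boxtimes> unit T (One C)))) \<cdot>
      \<langle>Id C (TO T Y), bang (TO T Y)\<rangle> = Fst C (TO T Y) (One C) \<cdot> \<langle>Id C (TO T Y), bang (TO T Y)\<rangle>"
    by simp
  then have "TA T (Fst C Y (One C)) \<cdot> (mon T Y (One C) \<cdot> ?e) = Id C (TO T Y)"
    using assms by (simp del: unit_comp)
  then have "(TA T \<langle>Id C Y, bang Y\<rangle> \<cdot> TA T (Fst C Y (One C))) \<cdot> (mon T Y (One C) \<cdot> ?e) =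
      TA T \<langle>Id C Y, bang Y\<rangle>"
    using assms by simp
  then have m: "mon T Y (One C) \<cdot> ?e = TA T \<langle>Id C Y, bang Y\<rangle>"
    unfolding i using assms by simp
  have "unit T X \<cdot> (x \<cdot> bang (TO T Y)) = (unit T X \<cdot> x) \<cdot> bang (TO T Y)"
    using assms by (simp del: unit_comp)
  also have "\<dots> = TA T x \<cdot> (unit T (One C) \<cdot> bang (TO T Y))"
    using assms by (subst unit_comp) (simp_all del: unit_comp)
  finally have ux: "unit T X \<cdot> (x \<cdot> bang (TO T Y)) = TA T x \<cdot> (unit T (One C) \<cdot> bang (TO T Y))" .
  have "costrength Y X \<cdot> \<langle>Id C (TO T Y), x \<cdot> bang (TO T Y)\<rangle> =
      mon T Y X \<cdot> \<langle>TA T (Id C Y) \<cdot> Id C (TO T Y), TA T x \<cdot> (unit T (One C) \<cdot> bang (TO T Y))\<rangle>"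
    using assms ux by (simp add: costrength_def del: unit_comp)
  also have "\<dots> = TA T (Id C Y \<boxtimes> x) \<cdot> (mon T Y (One C) \<cdot> ?e)"
    by (subst mon_comp) (use assms in simp_all)
  also have "\<dots> = TA T (Id C Y \<boxtimes> x) \<cdot> TA T \<langle>Id C Y, bang Y\<rangle>"
    using m by simp
  also have "\<dots> = TA T ((Id C Y \<boxtimes> x) \<cdot> \<langle>Id C Y, bang Y\<rangle>)"
    using assms by (subst TA_comp_arr) simp_all
  also have "\<dots> = TA T \<langle>Id C Y, x \<cdot> bang Y\<rangle>"
    using assms by simp
  finally show ?thesis .
qed

lemma strength_slice:
  assumes "x \<in> el X" "X \<in> Ob C" "Y \<in> Ob C"
  shows "strength X Y \<cdot> \<langle>x \<cdot> bang (TO T Y), Id C (TO T Y)\<rangle> = TA T \<langle>x \<cdot> bang Y, Id C Y\<rangle>"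
proof -
  let ?z = "\<langle>x \<cdot> bang (TO T Y), Id C (TO T Y)\<rangle>"
  have "TA T (swap C Y X) \<cdot> mon T Y X = mon T X Y \<cdot> swap C (TO T Y) (TO T X)"
    using mon_symmetric[of Y X] assms by simp
  then have "(TA T (swap C Y X) \<cdot> mon T Y X) \<cdot> \<langle>Id C (TO T Y), unit T X \<cdot> (x \<cdot> bang (TO T Y))\<rangle> =
      (mon T X Y \<cdot> swap C (TO T Y) (TO T X)) \<cdot> \<langle>Id C (TO T Y), unit T X \<cdot> (x \<cdot> bang (TO T Y))\<rangle>"
    by simp
  then have "strength X Y \<cdot> ?z =
      TA T (swap C Y X) \<cdot> (costrength Y X \<cdot> \<langle>Id C (TO T Y), x \<cdot> bang (TO T Y)\<rangle>)"
    using assms by (simp add: strength_def costrength_def del: unit_comp)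
  also have "\<dots> = TA T (swap C Y X \<cdot> \<langle>Id C Y, x \<cdot> bang Y\<rangle>)"
    unfolding costrength_slice[OF assms] using assms by (subst TA_comp_arr) simp_all
  finally show ?thesis using assms by simp
qed

text \<open>With the units inserted, either composite becomes the left-hand side of
  \<open>mult_monoidal\<close>, and the two unit laws of the monad remove them again, one on each
  factor. That both composites agree is commutativity of the monad in the sense of Kock.\<close>

lemma mult_strength_costrength:
  assumes "X \<in> Ob C" "Y \<in> Ob C"
  shows "mult T (X \<^bold>\<times> Y) \<cdot> (TA T (strength X Y) \<cdot> costrength X (TO T Y)) = mon T X Y"
    "mult T (X \<^bold>\<times> Y) \<cdot> (TA T (costrength X Y) \<cdot> strength (TO T X) Y) = mon T X Y"
proof -
  let ?p = "Fst C (TO T X) (TO T Y)" and ?q = "Snd C (TO T X) (TO T Y)"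
  have *: "mult T (X \<^bold>\<times> Y) \<cdot> (TA T (mon T X Y) \<cdot> (mon T (TO T X) (TO T Y) \<cdot> \<langle>s, t\<rangle>)) =
      mon T X Y \<cdot> \<langle>mult T X \<cdot> s, mult T Y \<cdot> t\<rangle>"
    if "arr s" "arr t" "Dom C s = Dom C t" "Cod C s = TO T (TO T X)" "Cod C t = TO T (TO T Y)"
    for s t
    using arg_cong[OF mult_monoidal[of X Y], of "\<lambda>h. h \<cdot> \<langle>s, t\<rangle>"] assms that by simp
  have "TA T (strength X Y) \<cdot> costrength X (TO T Y) =
      TA T (mon T X Y) \<cdot> (TA T (unit T X \<boxtimes> Id C (TO T Y)) \<cdot>
        (mon T X (TO T Y) \<cdot> \<langle>?p, unit T (TO T Y) \<cdot> ?q\<rangle>))"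
    using assms by (simp add: strength_def costrength_def del: unit_comp)
  also have "TA T (unit T X \<boxtimes> Id C (TO T Y)) \<cdot> (mon T X (TO T Y) \<cdot> \<langle>?p, unit T (TO T Y) \<cdot> ?q\<rangle>) =
      mon T (TO T X) (TO T Y) \<cdot> \<langle>TA T (unit T X) \<cdot> ?p, unit T (TO T Y) \<cdot> ?q\<rangle>"
    using mon_comp[of "unit T X" "Id C (TO T Y)" ?p "unit T (TO T Y) \<cdot> ?q" "TO T X" "TO T Y"] assms
    by (simp del: unit_comp prod_map_eq)
  finally have "mult T (X \<^bold>\<times> Y) \<cdot> (TA T (strength X Y) \<cdot> costrength X (TO T Y)) =
      mon T X Y \<cdot> \<langle>(mult T X \<cdot> TA T (unit T X)) \<cdot> ?p, (mult T Y \<cdot> unit T (TO T Y)) \<cdot> ?q\<rangle>"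
    using assms by (simp add: * del: unit_comp)
  then show "mult T (X \<^bold>\<times> Y) \<cdot> (TA T (strength X Y) \<cdot> costrength X (TO T Y)) = mon T X Y"
    unfolding unit_left[OF assms(2)] unit_right[OF assms(1)] using assms by simp
  have "TA T (costrength X Y) \<cdot> strength (TO T X) Y =
      TA T (mon T X Y) \<cdot> (TA T (Id C (TO T X) \<boxtimes> unit T Y) \<cdot>
        (mon T (TO T X) Y \<cdot> \<langle>unit T (TO T X) \<cdot> ?p, ?q\<rangle>))"
    using assms by (simp add: strength_def costrength_def del: unit_comp)
  also have "TA T (Id C (TO T X) \<boxtimes> unit T Y) \<cdot> (mon T (TO T X) Y \<cdot> \<langle>unit T (TO T X) \<cdot> ?p, ?q\<rangle>) =
      mon T (TO T X) (TO T Y) \<cdot> \<langle>unit T (TO T X) \<cdot> ?p, TA T (unit T Y) \<cdot> ?q\<rangle>"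
    using mon_comp[of "Id C (TO T X)" "unit T Y" "unit T (TO T X) \<cdot> ?p" ?q "TO T X" "TO T Y"] assms
    by (simp del: unit_comp prod_map_eq)
  finally have "mult T (X \<^bold>\<times> Y) \<cdot> (TA T (costrength X Y) \<cdot> strength (TO T X) Y) =
      mon T X Y \<cdot> \<langle>(mult T X \<cdot> unit T (TO T X)) \<cdot> ?p, (mult T Y \<cdot> TA T (unit T Y)) \<cdot> ?q\<rangle>"
    using assms by (simp add: * del: unit_comp)
  then show "mult T (X \<^bold>\<times> Y) \<cdot> (TA T (costrength X Y) \<cdot> strength (TO T X) Y) = mon T X Y"
    unfolding unit_left[OF assms(1)] unit_right[OF assms(2)] using assms by simp
qed

section \<open>Algebras and their homomorphisms\<close>

lemma Ob_L_iff: "A \<in> Ob L \<longleftrightarrow> fst A \<in> Ob C \<and> snd A \<in> Hom C (TO T (fst A)) (fst A) \<and>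
    snd A \<cdot> unit T (fst A) = Id C (fst A) \<and> snd A \<cdot> mult T (fst A) = snd A \<cdot> TA T (snd A)"
  by (cases A) (simp add: EM_def)

lemma alg_arr [simp]:
  assumes "A \<in> Ob L"
  shows "fst A \<in> Ob C" "arr (snd A)" "Dom C (snd A) = TO T (fst A)" "Cod C (snd A) = fst A"
    "snd A \<cdot> unit T (fst A) = Id C (fst A)"
  using assms by (auto simp: Ob_L_iff Hom_def)

lemma alg_mult: "A \<in> Ob L \<Longrightarrow> snd A \<cdot> mult T (fst A) = snd A \<cdot> TA T (snd A)"
  using Ob_L_iff by blast

text \<open>Naturality of the unit is a rewrite rule at this point and moves \<open>unit\<close> to
  the right of \<open>f\<close>; the unit law of an algebra must be recognized in that
  shape.\<close>

lemma alg_unit_comp [simp]: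
  assumes "A \<in> Ob L" "arr f" "Cod C f = fst A"
  shows "snd A \<cdot> (TA T f \<cdot> unit T (Dom C f)) = f"
proof -
  have "snd A \<cdot> (TA T f \<cdot> unit T (Dom C f)) = (snd A \<cdot> unit T (fst A)) \<cdot> f"
    using assms by (simp del: alg_arr(5))
  then show ?thesis using assms by (simp del: comp_assoc)
qed

text \<open>Homomorphisms are handled as bare arrows of the base category; the triples of
  \<open>L\<close> are unpacked in \<open>Arr_L_iff\<close> and \<open>Hom_L_iff\<close>.\<close>

definition lin :: "('o, 'a) alg \<Rightarrow> ('o, 'a) alg \<Rightarrow> 'a \<Rightarrow> bool" where
  "lin A B f \<longleftrightarrow> A \<in> Ob L \<and> B \<in> Ob L \<and> f \<in> Hom C (fst A) (fst B) \<and> f \<cdot> snd A = snd B \<cdot> TA T f"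

lemma linD:
  assumes "lin A B f"
  shows "A \<in> Ob L" "B \<in> Ob L" "arr f" "Dom C f = fst A" "Cod C f = fst B"
    "f \<cdot> snd A = snd B \<cdot> TA T f"
  using assms by (auto simp: lin_def Hom_def)

lemma lin_apply: "lin A B f \<Longrightarrow> arr t \<Longrightarrow> Cod C t = TO T (fst A) \<Longrightarrow> f \<cdot> (snd A \<cdot> t) = snd B \<cdot> (TA T f \<cdot> t)"
  using arg_cong[OF linD(6)[of A B f], of "\<lambda>h. h \<cdot> t"] linD(1-5)[of A B f] by simp

lemma linI:
  assumes "A \<in> Ob L" "B \<in> Ob L" "f \<in> Hom C (fst A) (fst B)"
    and "\<And>t. t \<in> el (TO T (fst A)) \<Longrightarrow> f \<cdot> (snd A \<cdot> t) = snd B \<cdot> (TA T f \<cdot> t)"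
  shows "lin A B f"
  unfolding lin_def
proof (intro conjI assms)
  show "f \<cdot> snd A = snd B \<cdot> TA T f"
    by (rule map_eqI[of _ "TO T (fst A)" "fst B"]) (use assms in \<open>auto simp: Hom_def\<close>)
qed

lemma lin_comp:
  assumes "lin A B f" "lin B D g"
  shows "lin A D (g \<cdot> f)"
proof (rule linI)
  fix t assume t: "t \<in> el (TO T (fst A))"
  have "(g \<cdot> f) \<cdot> (snd A \<cdot> t) = g \<cdot> (snd B \<cdot> (TA T f \<cdot> t))"
    using t linD[OF assms(1)] linD[OF assms(2)] lin_apply[OF assms(1), of t] by simp
  also have "\<dots> = snd D \<cdot> (TA T (g \<cdot> f) \<cdot> t)"
    using t linD[OF assms(1)] linD[OF assms(2)] lin_apply[OF assms(2), of "TA T f \<cdot> t"] by simp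
  finally show "(g \<cdot> f) \<cdot> (snd A \<cdot> t) = snd D \<cdot> (TA T (g \<cdot> f) \<cdot> t)" .
qed (use linD[OF assms(1)] linD[OF assms(2)] in \<open>auto simp: Hom_def\<close>)

lemma Arr_L_iff: "(A, f, B) \<in> Arr L \<longleftrightarrow> lin A B f"
  unfolding lin_def by (auto simp: EM_def Let_def Hom_def)

lemma L_arrE:
  assumes "h \<in> Arr L"
  obtains A f B where "h = (A, f, B)" "lin A B f"
  using assms Arr_L_iff by (metis prod_cases3)

lemma L_simps [simp]: "Dom L (A, f, B) = A" "Cod L (A, f, B) = B" "Id L A = (A, Id C (fst A), A)"
  "(B', g, D) \<cdot>\<^bsub>L\<^esub> (A, f, B) = (A, g \<cdot> f, D)" "GA (A, f, B) = f"
  unfolding EM_def Let_def GA_def by simp_all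

lemma Hom_L_iff: "h \<in> Hom L A B \<longleftrightarrow> (\<exists>f. h = (A, f, B) \<and> lin A B f)"
proof
  assume h: "h \<in> Hom L A B"
  then have "h \<in> Arr L" by (simp add: Hom_def)
  then obtain A' f B' where "h = (A', f, B')" "lin A' B' f" by (rule L_arrE)
  then show "\<exists>f. h = (A, f, B) \<and> lin A B f" using h by (simp add: Hom_def)
qed (auto simp: Hom_def Arr_L_iff)

lemma iso_inverse:
  assumes "iso C f"
  obtains g where "arr g" "Dom C g = Cod C f" "Cod C g = Dom C f"
    "g \<cdot> f = Id C (Dom C f)" "f \<cdot> g = Id C (Cod C f)" "arr f"
  using assms by (auto simp: iso_def Hom_def)

lemma lin_inverse:
  assumes f: "lin A B f" and g: "arr g" "Dom C g = fst B" "Cod C g = fst A"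
    and gf: "g \<cdot> f = Id C (fst A)" "f \<cdot> g = Id C (fst B)"
  shows "lin B A g"
  unfolding lin_def
proof (intro conjI)
  have "g \<cdot> snd B = g \<cdot> (snd B \<cdot> TA T (f \<cdot> g))"
    unfolding gf using linD[OF f] g by simp
  also have "\<dots> = (g \<cdot> f) \<cdot> (snd A \<cdot> TA T g)"
    using linD(1-5)[OF f] g lin_apply[OF f, of "TA T g"] by simp
  finally show "g \<cdot> snd B = snd A \<cdot> TA T g"
    unfolding gf using linD[OF f] g by simp
qed (use linD[OF f] g in \<open>auto simp: Hom_def\<close>)

text \<open>The inverse of a homomorphism is again one, so the forgetful functor reflects
  isomorphisms.\<close>

lemma iso_L_iff: "lin A B f \<Longrightarrow> iso L (A, f, B) \<longleftrightarrow> iso C f"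
proof
  assume f: "lin A B f" and "iso L (A, f, B)"
  then have "\<exists>h \<in> Hom L B A. h \<cdot>\<^bsub>L\<^esub> (A, f, B) = Id L A \<and> (A, f, B) \<cdot>\<^bsub>L\<^esub> h = Id L B"
    by (simp add: iso_def)
  then obtain h where h: "h \<in> Hom L B A" "h \<cdot>\<^bsub>L\<^esub> (A, f, B) = Id L A"
    "(A, f, B) \<cdot>\<^bsub>L\<^esub> h = Id L B" by blast
  from h(1) obtain g where g: "h = (B, g, A)" "lin B A g" unfolding Hom_L_iff by blast
  then have "g \<cdot> f = Id C (fst A)" "f \<cdot> g = Id C (fst B)" using h(2,3) by simp_all
  then show "iso C f" using linD(3-5)[OF f] linD(3-5)[OF g(2)]
    by (auto simp: iso_def Hom_def intro!: bexI[of _ g])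
next
  assume f: "lin A B f" and "iso C f"
  then obtain g where g: "arr g" "Dom C g = fst B" "Cod C g = fst A"
    "g \<cdot> f = Id C (fst A)" "f \<cdot> g = Id C (fst B)"
    using linD[OF f] by (auto elim!: iso_inverse)
  then have "(B, g, A) \<in> Hom L B A" using lin_inverse[OF f] by (simp add: Hom_L_iff)
  then show "iso L (A, f, B)" using f g
    by (auto simp: iso_def Arr_L_iff intro!: bexI[of _ "(B, g, A)"])
qed

text \<open>Here \<open>lift1 B Y X \<phi>\<close> sends \<open>(s, x)\<close> to the integral of \<open>\<phi>(-, x)\<close> against \<open>s\<close>, computed in the
  algebra \<open>B\<close>; \<open>lift2\<close> integrates over the second variable.\<close>

definition lift1 :: "('o, 'a) alg \<Rightarrow> 'o \<Rightarrow> 'o \<Rightarrow> 'a \<Rightarrow> 'a" where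
  "lift1 B Y X \<phi> = snd B \<cdot> (TA T \<phi> \<cdot> costrength Y X)"

definition lift2 :: "('o, 'a) alg \<Rightarrow> 'o \<Rightarrow> 'o \<Rightarrow> 'a \<Rightarrow> 'a" where
  "lift2 B Y X \<phi> = snd B \<cdot> (TA T \<phi> \<cdot> strength Y X)"

lemma lift_arr [simp]:
  assumes "B \<in> Ob L" "Y \<in> Ob C" "X \<in> Ob C" "arr (\<phi>)" "Dom C \<phi> = Y \<^bold>\<times> X" "Cod C \<phi> = fst B"
  shows "arr (lift1 B Y X \<phi>)" "Dom C (lift1 B Y X \<phi>) = TO T Y \<^bold>\<times> X" "Cod C (lift1 B Y X \<phi>) = fst B"
    "arr (lift2 B Y X \<phi>)" "Dom C (lift2 B Y X \<phi>) = Y \<^bold>\<times> TO T X" "Cod C (lift2 B Y X \<phi>) = fst B"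
  unfolding lift1_def lift2_def using assms by auto

lemma lift1_slice:
  assumes "B \<in> Ob L" "Y \<in> Ob C" "X \<in> Ob C" "arr (\<phi>)" "Dom C \<phi> = Y \<^bold>\<times> X" "Cod C \<phi> = fst B"
    "x \<in> el X" "s \<in> el (TO T Y)"
  shows "lift1 B Y X \<phi> \<cdot> \<langle>s, x\<rangle> = snd B \<cdot> (TA T (\<phi> \<cdot> \<langle>Id C Y, x \<cdot> bang Y\<rangle>) \<cdot> s)"
proof -
  have "lift1 B Y X \<phi> \<cdot> \<langle>s, x\<rangle> =
      snd B \<cdot> (TA T \<phi> \<cdot> ((costrength Y X \<cdot> \<langle>Id C (TO T Y), x \<cdot> bang (TO T Y)\<rangle>) \<cdot> s))"
    using assms by (simp add: lift1_def)
  then show ?thesis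
    unfolding costrength_slice[OF assms(7,3,2)] using assms by simp
qed

lemma lift2_slice:
  assumes "B \<in> Ob L" "Y \<in> Ob C" "X \<in> Ob C" "arr (\<phi>)" "Dom C \<phi> = Y \<^bold>\<times> X" "Cod C \<phi> = fst B"
    "y \<in> el Y" "s \<in> el (TO T X)"
  shows "lift2 B Y X \<phi> \<cdot> \<langle>y, s\<rangle> = snd B \<cdot> (TA T (\<phi> \<cdot> \<langle>y \<cdot> bang X, Id C X\<rangle>) \<cdot> s)"
proof -
  have "lift2 B Y X \<phi> \<cdot> \<langle>y, s\<rangle> =
      snd B \<cdot> (TA T \<phi> \<cdot> ((strength Y X \<cdot> \<langle>y \<cdot> bang (TO T X), Id C (TO T X)\<rangle>) \<cdot> s))"
    using assms by (simp add: lift2_def)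
  then show ?thesis
    unfolding strength_slice[OF assms(7,2,3)] using assms by simp
qed

text \<open>Fubini's theorem for elements \<open>s\<close>, \<open>t\<close> of free algebras: the
  two sides are the two composites of the strengths, which both equal \<open>mon\<close>. The inner
  integrals \<open>h\<close> and \<open>g\<close> are described by their values only, so that any
  arrow with these values may be used.\<close>

lemma commutativity:
  assumes B: "B \<in> Ob L" and X: "X \<in> Ob C" and Y: "Y \<in> Ob C" and f: "f \<in> Hom C (X \<^bold>\<times> Y) (fst B)"
    and s: "s \<in> el (TO T X)" and t: "t \<in> el (TO T Y)"
    and h: "h \<in> Hom C X (fst B)"
      "\<And>x. x \<in> el X \<Longrightarrow> h \<cdot> x = snd B \<cdot> (TA T (f \<cdot> \<langle>x \<cdot> bang Y, Id C Y\<rangle>) \<cdot> t)"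
    and g: "g \<in> Hom C Y (fst B)"
      "\<And>y. y \<in> el Y \<Longrightarrow> g \<cdot> y = snd B \<cdot> (TA T (f \<cdot> \<langle>Id C X, y \<cdot> bang X\<rangle>) \<cdot> s)"
  shows "snd B \<cdot> (TA T h \<cdot> s) = snd B \<cdot> (TA T g \<cdot> t)"
proof -
  have fa: "arr f" "Dom C f = X \<^bold>\<times> Y" "Cod C f = fst B" using f by (auto simp: Hom_def)
  have hl: "h = lift2 B X Y f \<cdot> \<langle>Id C X, t \<cdot> bang X\<rangle>"
    by (rule map_eqI[OF h(1)]) (use fa B X Y t in \<open>auto simp: Hom_def h(2) lift2_slice\<close>)
  have gl: "g = lift1 B X Y f \<cdot> \<langle>s \<cdot> bang Y, Id C Y\<rangle>"
    by (rule map_eqI[OF g(1)]) (use fa B X Y s in \<open>auto simp: Hom_def g(2) lift1_slice\<close>)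
  \<comment> \<open>The associativity law of \<open>B\<close> trades two applications of its
    structure map for one \<open>mult\<close> below \<open>TA T f\<close>, where the two strengths
    meet.\<close>
  have bb: "snd B \<cdot> (TA T (snd B) \<cdot> (TA T (TA T f) \<cdot> u)) =
      snd B \<cdot> (TA T f \<cdot> (mult T (X \<^bold>\<times> Y) \<cdot> u))"
    if u: "arr u" "Cod C u = TO T (TO T (X \<^bold>\<times> Y))" for u
  proof -
    have "snd B \<cdot> (TA T (snd B) \<cdot> (TA T (TA T f) \<cdot> u)) = (snd B \<cdot> TA T (snd B)) \<cdot> (TA T (TA T f) \<cdot> u)"
      using B fa u X Y by simp
    also have "\<dots> = snd B \<cdot> ((mult T (fst B) \<cdot> TA T (TA T f)) \<cdot> u)"
      unfolding alg_mult[OF B, symmetric] using B fa u X Y by simp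
    also have "\<dots> = snd B \<cdot> (TA T f \<cdot> (mult T (X \<^bold>\<times> Y) \<cdot> u))"
      using B fa u X Y by (subst mult_comp[of f "X \<^bold>\<times> Y"]) simp_all
    finally show ?thesis .
  qed
  have "snd B \<cdot> (TA T h \<cdot> s) = lift1 B X (TO T Y) (lift2 B X Y f) \<cdot> \<langle>s, t\<rangle>"
    using B fa X Y s t by (subst lift1_slice) (simp_all add: hl)
  also have "\<dots> = snd B \<cdot> (TA T f \<cdot>
      ((mult T (X \<^bold>\<times> Y) \<cdot> (TA T (strength X Y) \<cdot> costrength X (TO T Y))) \<cdot> \<langle>s, t\<rangle>))"
    using B fa X Y s t by (simp add: lift1_def lift2_def bb)
  also have "\<dots> = snd B \<cdot> (TA T f \<cdot>
      ((mult T (X \<^bold>\<times> Y) \<cdot> (TA T (costrength X Y) \<cdot> strength (TO T X) Y)) \<cdot> \<langle>s, t\<rangle>))"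
    by (simp only: mult_strength_costrength[OF X Y])
  also have "\<dots> = lift2 B (TO T X) Y (lift1 B X Y f) \<cdot> \<langle>s, t\<rangle>"
    using B fa X Y s t by (simp add: lift1_def lift2_def bb)
  also have "\<dots> = snd B \<cdot> (TA T g \<cdot> t)"
    using B fa X Y s t by (subst lift2_slice) (simp_all add: gl)
  finally show ?thesis .
qed

section \<open>Cotensors and internal homs on elements\<close>

lemma free_simps [simp]: "fst (free X) = TO T X" "snd (free X) = mult T X"
  by (simp_all add: free_def)

lemma free_alg [simp]: "X \<in> Ob C \<Longrightarrow> free X \<in> Ob L"
  unfolding Ob_L_iff using mult_hom unit_left mult_assoc by simp

lemma R_alg [simp]: "R \<in> Ob L"
  by (simp add: R_def)

section \<open>Subalgebras and equalizers of homomorphisms\<close>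

lemma sub_alg:
  assumes p: "monic C p" "Dom C p = P" "Cod C p = fst D" and D: "D \<in> Ob L"
    and e: "e \<in> Hom C (TO T P) P" "p \<cdot> e = snd D \<cdot> TA T p"
  shows "(P, e) \<in> Ob L" "lin (P, e) D p"
proof -
  have pa: "arr p" using p by (simp add: monic_def)
  then have P: "P \<in> Ob C" using p by auto
  note ea = HomD(1-3)[OF e(1)]
  have pe: "p \<cdot> (e \<cdot> u) = snd D \<cdot> (TA T p \<cdot> u)" if "arr u" "Cod C u = TO T P" for u
    using arg_cong[OF e(2), of "\<lambda>h. h \<cdot> u"] that pa p ea D P by simp
  have "p \<cdot> (e \<cdot> unit T P) = p \<cdot> Id C P"
    using alg_unit_comp[OF D pa p(3)] pa p P ea by (simp add: pe)
  then have 1: "e \<cdot> unit T P = Id C P"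
    using monicD[OF p(1), of "e \<cdot> unit T P" "Id C P"] p P ea by simp
  have "p \<cdot> (e \<cdot> mult T P) = snd D \<cdot> (mult T (fst D) \<cdot> TA T (TA T p))"
    using pa p P ea D by (simp add: pe mult_comp[of p P])
  also have "\<dots> = (snd D \<cdot> mult T (fst D)) \<cdot> TA T (TA T p)"
    using pa p P D by simp
  also have "\<dots> = snd D \<cdot> TA T (snd D \<cdot> TA T p)"
    unfolding alg_mult[OF D] using pa p P D by simp
  also have "\<dots> = p \<cdot> (e \<cdot> TA T e)"
    unfolding e(2)[symmetric] using pa p P ea D by (simp add: pe)
  finally have 2: "e \<cdot> mult T P = e \<cdot> TA T e"
    using monicD[OF p(1), of "e \<cdot> mult T P" "e \<cdot> TA T e"] p P ea by simp
  show "(P, e) \<in> Ob L" unfolding Ob_L_iff using P e 1 2 by simp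
  then show "lin (P, e) D p" using D e pa p by (simp add: lin_def Hom_def)
qed

lemma lin_factor:
  assumes m: "lin M D m" "monic C m" and f: "lin A D f"
    and w: "w \<in> Hom C (fst A) (fst M)" "m \<cdot> w = f"
  shows "lin A M w"
proof (rule linI)
  fix t assume t: "t \<in> el (TO T (fst A))"
  note ar = linD(1-5)[OF m(1)] linD(1-5)[OF f] HomD(1-3)[OF w(1)]
  have "m \<cdot> (w \<cdot> (snd A \<cdot> t)) = f \<cdot> (snd A \<cdot> t)"
    using t ar unfolding w(2)[symmetric] by simp
  also have "\<dots> = m \<cdot> (snd M \<cdot> (TA T w \<cdot> t))"
    using t ar lin_apply[OF f, of t] lin_apply[OF m(1), of "TA T w \<cdot> t"] unfolding w(2)[symmetric] by simp
  finally show "w \<cdot> (snd A \<cdot> t) = snd M \<cdot> (TA T w \<cdot> t)"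
    using monicD[OF m(2), of "w \<cdot> (snd A \<cdot> t)" "snd M \<cdot> (TA T w \<cdot> t)"] t ar by simp
qed (use m f w linD in auto)

text \<open>By linearity \<open>u\<close> and \<open>v\<close> agree on
  \<open>snd A \<cdot> TA T k\<close>, which therefore factors through \<open>k\<close>: the
  forgetful functor creates equalizers.\<close>

lemma equalizer_alg:
  assumes u: "lin A B u" and v: "lin A B v" and k: "is_equalizer C u v k"
  shows "\<exists>!e. e \<in> Hom C (TO T (Dom C k)) (Dom C k) \<and> k \<cdot> e = snd A \<cdot> TA T k"
proof -
  note ar = linD(1-5)[OF u] linD(1-5)[OF v]
  have ka: "arr k" "Cod C k = fst A" "u \<cdot> k = v \<cdot> k"
    using k ar by (auto simp: is_equalizer_def Hom_def)
  have "u \<cdot> (snd A \<cdot> TA T k) = snd B \<cdot> TA T (u \<cdot> k)"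
    using ar ka(1,2) lin_apply[OF u, of "TA T k"] by simp
  also have "\<dots> = v \<cdot> (snd A \<cdot> TA T k)"
    unfolding ka(3) using ar ka(1,2) lin_apply[OF v, of "TA T k"] by simp
  finally show ?thesis
    using equalizer_universal[OF k, of "snd A \<cdot> TA T k" "TO T (Dom C k)"] ar(1-5) ka(1,2)
    by (simp add: Hom_iff)
qed

section \<open>Cotensors as algebras of functions\<close>

text \<open>Evaluation at a fixed element, as an arrow, can be a homomorphism. These arrows are
  jointly monic (\<open>evx_eqI\<close>), which reduces statements about cotensors to their
  values.\<close>

definition evx :: "'o \<Rightarrow> 'o \<Rightarrow> 'a \<Rightarrow> 'a" where
  "evx X Y x = ev X Y (x \<cdot> bang (Exp C X Y)) (Id C (Exp C X Y))"

lemma evx_arr [simp]: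
  assumes "X \<in> Ob C" "Y \<in> Ob C" "arr x" "Dom C x = One C" "Cod C x = X"
  shows "arr (evx X Y x)" "Dom C (evx X Y x) = Exp C X Y" "Cod C (evx X Y x) = Y"
  unfolding evx_def using assms by auto

lemma evx_apply [simp]:
  assumes "X \<in> Ob C" "Y \<in> Ob C" "arr x" "Dom C x = One C" "Cod C x = X"
    "arr u" "Cod C u = Exp C X Y" "Dom C u = One C"
  shows "evx X Y x \<cdot> u = ev X Y x u"
  using assms by (simp add: evx_def)

lemma evx_eqI:
  assumes "u \<in> Hom C Z (Exp C X Y)" "v \<in> Hom C Z (Exp C X Y)" "X \<in> Ob C" "Y \<in> Ob C"
    and "\<And>x. x \<in> el X \<Longrightarrow> evx X Y x \<cdot> u = evx X Y x \<cdot> v"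
  shows "u = v"
proof (rule exp_eqI[OF assms(1-4)])
  fix x z assume xz: "x \<in> el X" "z \<in> el Z"
  have "(evx X Y x \<cdot> u) \<cdot> z = (evx X Y x \<cdot> v) \<cdot> z" using assms(5)[OF xz(1)] by simp
  then show "ev X Y x (u \<cdot> z) = ev X Y x (v \<cdot> z)"
    using xz assms(3,4) HomD(1-3)[OF assms(1)] HomD(1-3)[OF assms(2)] by simp
qed

lemma fst_cotensor [simp]: "fst (cotensor X A) = Exp C X (fst A)"
  by (simp add: cotensor_def)

lemma snd_cotensor:
  "snd (cotensor X A) = curry_map C X (TO T (Exp C X (fst A))) (lift2 A X (Exp C X (fst A)) (Ev C X (fst A)))"
  by (simp add: cotensor_def lift2_def)

lemma snd_cotensor_arr:
  assumes "X \<in> Ob C" "A \<in> Ob L"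
  shows "arr (snd (cotensor X A))" "Dom C (snd (cotensor X A)) = TO T (Exp C X (fst A))"
    "Cod C (snd (cotensor X A)) = Exp C X (fst A)"
  unfolding snd_cotensor using assms by simp_all

text \<open>The structure map is the transpose of an extension along the strength; fixing
  \<open>x\<close> turns the strength into a functorial image, so the operations are
  pointwise.\<close>

lemma evx_snd_cotensor:
  assumes "X \<in> Ob C" "A \<in> Ob L" "x \<in> el X"
  shows "evx X (fst A) x \<cdot> snd (cotensor X A) = snd A \<cdot> TA T (evx X (fst A) x)"
proof (rule map_eqI[of _ "TO T (Exp C X (fst A))" "fst A"])
  fix t assume t: "t \<in> el (TO T (Exp C X (fst A)))"
  have "(evx X (fst A) x \<cdot> snd (cotensor X A)) \<cdot> t =
      lift2 A X (Exp C X (fst A)) (Ev C X (fst A)) \<cdot> \<langle>x, t\<rangle>"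
    using assms t by (simp add: snd_cotensor)
  also have "\<dots> = snd A \<cdot> (TA T (evx X (fst A) x) \<cdot> t)"
    unfolding evx_def by (rule lift2_slice) (use assms t in simp_all)
  finally show "(evx X (fst A) x \<cdot> snd (cotensor X A)) \<cdot> t = (snd A \<cdot> TA T (evx X (fst A) x)) \<cdot> t"
    using assms t by simp
qed (use assms snd_cotensor_arr[OF assms(1,2)] in \<open>auto simp: Hom_iff\<close>)

lemma cotensor_alg [simp]:
  assumes X: "X \<in> Ob C" and A: "A \<in> Ob L"
  shows "cotensor X A \<in> Ob L"
  unfolding Ob_L_iff
proof (intro conjI)
  let ?E = "Exp C X (fst A)" and ?c = "snd (cotensor X A)"
  note ca = snd_cotensor_arr[OF assms]
  have e: "evx X (fst A) x \<cdot> (?c \<cdot> u) = snd A \<cdot> (TA T (evx X (fst A) x) \<cdot> u)"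
    if "x \<in> el X" "arr u" "Cod C u = TO T ?E" for x u
    using arg_cong[OF evx_snd_cotensor[OF assms that(1)], of "\<lambda>h. h \<cdot> u"] that ca X A by simp
  show "fst (cotensor X A) \<in> Ob C" using assms by simp
  show "?c \<in> Hom C (TO T (fst (cotensor X A))) (fst (cotensor X A))" using ca by (simp add: Hom_iff)
  have "?c \<cdot> unit T ?E = Id C ?E"
  proof (rule evx_eqI[of _ ?E X "fst A"])
    fix x assume x: "x \<in> el X"
    have "snd A \<cdot> (TA T (evx X (fst A) x) \<cdot> unit T ?E) = evx X (fst A) x"
      using alg_unit_comp[OF A, of "evx X (fst A) x"] x X A by (simp del: alg_unit_comp)
    then show "evx X (fst A) x \<cdot> (?c \<cdot> unit T ?E) = evx X (fst A) x \<cdot> Id C ?E"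
      using e[OF x, of "unit T ?E"] x X A by simp
  qed (use X A ca in \<open>auto simp: Hom_iff\<close>)
  then show "?c \<cdot> unit T (fst (cotensor X A)) = Id C (fst (cotensor X A))" by simp
  have "?c \<cdot> mult T ?E = ?c \<cdot> TA T ?c"
  proof (rule evx_eqI[of _ "TO T (TO T ?E)" X "fst A"])
    fix x assume x: "x \<in> el X"
    let ?x = "evx X (fst A) x"
    have "?x \<cdot> (?c \<cdot> mult T ?E) = snd A \<cdot> (mult T (fst A) \<cdot> TA T (TA T ?x))"
      using e[OF x, of "mult T ?E"] x X A by (simp add: mult_comp[of ?x ?E])
    also have "\<dots> = (snd A \<cdot> mult T (fst A)) \<cdot> TA T (TA T ?x)"
      using x X A by simp
    also have "\<dots> = snd A \<cdot> TA T (snd A \<cdot> TA T ?x)"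
      unfolding alg_mult[OF A] using x X A by simp
    also have "\<dots> = ?x \<cdot> (?c \<cdot> TA T ?c)"
      unfolding evx_snd_cotensor[OF X A x, symmetric] using e[OF x, of "TA T ?c"] x X A ca by simp
    finally show "?x \<cdot> (?c \<cdot> mult T ?E) = ?x \<cdot> (?c \<cdot> TA T ?c)" .
  qed (use X A ca in \<open>auto simp: Hom_iff\<close>)
  then show "?c \<cdot> mult T (fst (cotensor X A)) = ?c \<cdot> TA T ?c" by simp
qed

lemma evx_lin:
  assumes "X \<in> Ob C" "A \<in> Ob L" "x \<in> el X"
  shows "lin (cotensor X A) A (evx X (fst A) x)"
  using assms evx_snd_cotensor[OF assms] by (simp add: lin_def Hom_def)

lemma lin_into_cotensor:
  assumes "X \<in> Ob C" "A \<in> Ob L" "D \<in> Ob L" "u \<in> Hom C (fst D) (Exp C X (fst A))"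
    and "\<And>x. x \<in> el X \<Longrightarrow> lin D A (evx X (fst A) x \<cdot> u)"
  shows "lin D (cotensor X A) u"
  unfolding lin_def
proof (intro conjI)
  note ua = HomD(1-3)[OF assms(4)]
  show "u \<cdot> snd D = snd (cotensor X A) \<cdot> TA T u"
  proof (rule evx_eqI[of _ "TO T (fst D)" X "fst A"])
    fix x assume x: "x \<in> el X"
    have "evx X (fst A) x \<cdot> (u \<cdot> snd D) = snd A \<cdot> (TA T (evx X (fst A) x) \<cdot> TA T u)"
      using linD(6)[OF assms(5)[OF x]] assms(1-3) x ua by simp
    also have "\<dots> = evx X (fst A) x \<cdot> (snd (cotensor X A) \<cdot> TA T u)"
      using arg_cong[OF evx_snd_cotensor[OF assms(1,2) x], of "\<lambda>h. h \<cdot> TA T u"] assms(1-3) x ua by simp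
    finally show "evx X (fst A) x \<cdot> (u \<cdot> snd D) = evx X (fst A) x \<cdot> (snd (cotensor X A) \<cdot> TA T u)" .
  qed (use assms ua in \<open>auto simp: Hom_iff\<close>)
qed (use assms in auto)

section \<open>The parallel pair defining the internal hom\<close>

lemma exp_pre_props:
  assumes "arr f" "Dom C f = X" "Cod C f = X'" "Y \<in> Ob C"
  shows "arr (exp_pre C f Y)" "Dom C (exp_pre C f Y) = Exp C X' Y" "Cod C (exp_pre C f Y) = Exp C X Y"
    "arr x \<Longrightarrow> Cod C x = X \<Longrightarrow> arr u \<Longrightarrow> Cod C u = Exp C X' Y \<Longrightarrow> Dom C x = Dom C u \<Longrightarrow>
      ev X Y x (exp_pre C f Y \<cdot> u) = ev X' Y (f \<cdot> x) u"
proof -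
  have "X \<in> Ob C" "X' \<in> Ob C" using assms by auto
  then show "arr (exp_pre C f Y)" "Dom C (exp_pre C f Y) = Exp C X' Y" "Cod C (exp_pre C f Y) = Exp C X Y"
    "arr x \<Longrightarrow> Cod C x = X \<Longrightarrow> arr u \<Longrightarrow> Cod C u = Exp C X' Y \<Longrightarrow> Dom C x = Dom C u \<Longrightarrow>
      ev X Y x (exp_pre C f Y \<cdot> u) = ev X' Y (f \<cdot> x) u"
    unfolding exp_pre_def using assms by simp_all
qed

lemma exp_post_props:
  assumes "arr f" "Dom C f = Y" "Cod C f = Y'" "X \<in> Ob C"
  shows "arr (exp_post C X f)" "Dom C (exp_post C X f) = Exp C X Y" "Cod C (exp_post C X f) = Exp C X Y'"
    "arr x \<Longrightarrow> Cod C x = X \<Longrightarrow> arr u \<Longrightarrow> Cod C u = Exp C X Y \<Longrightarrow> Dom C x = Dom C u \<Longrightarrow>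
      ev X Y' x (exp_post C X f \<cdot> u) = f \<cdot> (ev X Y x u)"
proof -
  have "Y \<in> Ob C" "Y' \<in> Ob C" using assms by auto
  then show "arr (exp_post C X f)" "Dom C (exp_post C X f) = Exp C X Y"
    "Cod C (exp_post C X f) = Exp C X Y'"
    "arr x \<Longrightarrow> Cod C x = X \<Longrightarrow> arr u \<Longrightarrow> Cod C u = Exp C X Y \<Longrightarrow> Dom C x = Dom C u \<Longrightarrow>
      ev X Y' x (exp_post C X f \<cdot> u) = f \<cdot> (ev X Y x u)"
    unfolding exp_post_def using assms by simp_all
qed

text \<open>On elements this sends \<open>f\<close> to \<open>snd B \<cdot> TA T f\<close>
  (\<open>ev_extend\<close>). It agrees with precomposition by \<open>snd A\<close> exactly at the
  homomorphisms, whence the equalizer in \<open>hom_incl\<close>.\<close>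

definition extend :: "('o, 'a) alg \<Rightarrow> ('o, 'a) alg \<Rightarrow> 'a" where
  "extend A B = exp_post C (TO T (fst A)) (snd B) \<cdot> T_enriched (fst A) (fst B)"

lemma T_enriched_arr:
  assumes "X \<in> Ob C" "Y \<in> Ob C"
  shows "arr (T_enriched X Y)" "Dom C (T_enriched X Y) = Exp C X Y"
    "Cod C (T_enriched X Y) = Exp C (TO T X) (TO T Y)"
  unfolding T_enriched_def using assms by simp_all

lemma extend_arr:
  assumes "A \<in> Ob L" "B \<in> Ob L"
  shows "arr (extend A B)" "Dom C (extend A B) = Exp C (fst A) (fst B)"
    "Cod C (extend A B) = Exp C (TO T (fst A)) (fst B)"
  unfolding extend_def
  using assms T_enriched_arr[of "fst A" "fst B"] exp_post_props[of "snd B" "TO T (fst B)" "fst B" "TO T (fst A)"]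
  by simp_all

lemma ev_extend:
  assumes A: "A \<in> Ob L" and B: "B \<in> Ob L" and t: "t \<in> el (TO T (fst A))"
    and u: "u \<in> el (Exp C (fst A) (fst B))"
  shows "ev (TO T (fst A)) (fst B) t (extend A B \<cdot> u) =
    snd B \<cdot> (TA T (ev (fst A) (fst B) (Id C (fst A)) (u \<cdot> bang (fst A))) \<cdot> t)"
proof -
  note ep = exp_post_props[of "snd B" "TO T (fst B)" "fst B" "TO T (fst A)"]
  note te = T_enriched_arr[of "fst A" "fst B"]
  have "ev (TO T (fst A)) (fst B) t (extend A B \<cdot> u) =
      snd B \<cdot> (ev (TO T (fst A)) (TO T (fst B)) t (T_enriched (fst A) (fst B) \<cdot> u))"
    unfolding extend_def using A B t u te ep by simp
  also have "\<dots> = lift1 B (fst A) (Exp C (fst A) (fst B)) (Ev C (fst A) (fst B)) \<cdot> \<langle>t, u\<rangle>"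
    unfolding T_enriched_def lift1_def using A B t u by simp
  also have "\<dots> = snd B \<cdot> (TA T (ev (fst A) (fst B) (Id C (fst A)) (u \<cdot> bang (fst A))) \<cdot> t)"
    by (rule lift1_slice) (use A B t u in simp_all)
  finally show ?thesis .
qed

text \<open>Here commutativity of the monad is used. At each \<open>s\<close>, the map
  \<open>f \<mapsto> snd B \<cdot> TA T f \<cdot> s\<close> has to respect the pointwise operation
  given by \<open>t\<close>, which is the interchange of integration against \<open>s\<close> and
  against \<open>t\<close>.\<close>

lemma extend_lin:
  assumes A: "A \<in> Ob L" and B: "B \<in> Ob L"
  shows "lin (cotensor (fst A) B) (cotensor (TO T (fst A)) B) (extend A B)"
proof (rule lin_into_cotensor)
  let ?E = "Exp C (fst A) (fst B)" and ?c = "snd (cotensor (fst A) B)"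
  note ea = extend_arr[OF assms]
  fix s assume s: "s \<in> el (TO T (fst A))"
  let ?g = "evx (TO T (fst A)) (fst B) s \<cdot> extend A B"
  have g: "?g \<in> Hom C ?E (fst B)" using A B ea s by (simp add: Hom_iff)
  have gy: "?g \<cdot> y = snd B \<cdot> (TA T (ev (fst A) (fst B) (Id C (fst A)) (y \<cdot> bang (fst A))) \<cdot> s)"
    if "y \<in> el ?E" for y
    using ev_extend[OF A B s that] A B ea s that by simp
  show "lin (cotensor (fst A) B) B ?g"
  proof (rule linI)
    fix t assume t: "t \<in> el (TO T (fst (cotensor (fst A) B)))"
    let ?h = "ev (fst A) (fst B) (Id C (fst A)) ((?c \<cdot> t) \<cdot> bang (fst A))"
    have "?g \<cdot> (?c \<cdot> t) = snd B \<cdot> (TA T ?h \<cdot> s)"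
      using gy[of "?c \<cdot> t"] A B t by simp
    also have "\<dots> = snd B \<cdot> (TA T ?g \<cdot> t)"
    proof (rule commutativity[of B "fst A" ?E "Ev C (fst A) (fst B)"])
      fix x assume x: "x \<in> el (fst A)"
      have "?h \<cdot> x = (evx (fst A) (fst B) x \<cdot> ?c) \<cdot> t"
        using A B t x by simp
      also have "\<dots> = snd B \<cdot> (TA T (evx (fst A) (fst B) x) \<cdot> t)"
        unfolding evx_snd_cotensor[OF alg_arr(1)[OF A] B x] using A B t x by simp
      finally show "?h \<cdot> x =
        snd B \<cdot> (TA T (ev (fst A) (fst B) (x \<cdot> bang ?E) (Id C ?E)) \<cdot> t)"
        unfolding evx_def .
    qed (use A B s t g gy in \<open>auto simp: Hom_iff\<close>)
    finally show "?g \<cdot> (?c \<cdot> t) = snd B \<cdot> (TA T ?g \<cdot> t)" .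
  qed (use A B g in auto)
qed (use A B extend_arr[OF A B] in \<open>auto simp: Hom_iff\<close>)

lemma exp_pre_lin:
  assumes f: "f \<in> Hom C X X'" and B: "B \<in> Ob L"
  shows "lin (cotensor X' B) (cotensor X B) (exp_pre C f (fst B))"
proof (rule lin_into_cotensor)
  note ar = HomD(1-3)[OF f]
  note pre = exp_pre_props[of f X X' "fst B"]
  fix x assume x: "x \<in> el X"
  have "evx X (fst B) x \<cdot> exp_pre C f (fst B) = evx X' (fst B) (f \<cdot> x)"
    by (rule map_eqI[of _ "Exp C X' (fst B)" "fst B"]) (use pre ar B x in \<open>auto simp: Hom_iff\<close>)
  then show "lin (cotensor X' B) B (evx X (fst B) x \<cdot> exp_pre C f (fst B))"
    using evx_lin[OF HomD(5)[OF f] B, of "f \<cdot> x"] ar x by simp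
qed (use HomD(1-3)[OF f] B exp_pre_props[of f X X' "fst B"] in \<open>auto simp: Hom_iff\<close>)

lemma hom_incl_equalizer:
  assumes "A \<in> Ob L" "B \<in> Ob L"
  shows "is_equalizer C (extend A B) (exp_pre C (snd A) (fst B)) (hom_incl A B)"
  unfolding hom_incl_def extend_def
proof (rule someI_ex, rule equalizer_exists)
  show "has_finite_limits C" using finitely_well_complete by (simp add: finitely_well_complete_def)
qed (use assms extend_arr[OF assms] exp_pre_props[of "snd A" _ _ "fst B"]
    in \<open>auto simp: Hom_iff simp flip: extend_def\<close>)

text \<open>Both arrows of the parallel pair are homomorphisms of cotensors, so the equalizer
  carries exactly one compatible structure, the one that \<open>THE\<close> in \<open>ihom\<close>
  selects.\<close>

lemma hom_incl_props:
  assumes A: "A \<in> Ob L" and B: "B \<in> Ob L"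
  shows "fst (ihom A B) = Dom C (hom_incl A B)" "ihom A B \<in> Ob L" "monic C (hom_incl A B)"
    "lin (ihom A B) (cotensor (fst A) B) (hom_incl A B)"
proof -
  let ?k = "hom_incl A B"
  note eq = hom_incl_equalizer[OF assms]
  note ar = extend_arr[OF assms] exp_pre_props[of "snd A" "TO T (fst A)" "fst A" "fst B"]
  show m: "monic C ?k" using equalizer_monic[OF eq] ar A B by simp
  have pl: "lin (cotensor (fst A) B) (cotensor (TO T (fst A)) B) (exp_pre C (snd A) (fst B))"
    by (rule exp_pre_lin) (use A B in \<open>auto simp: Hom_iff\<close>)
  let ?P = "\<lambda>h. h \<in> Hom C (TO T (Dom C ?k)) (Dom C ?k) \<and> ?k \<cdot> h = snd (cotensor (fst A) B) \<cdot> TA T ?k"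
  have e: "ihom A B = (Dom C ?k, THE h. ?P h)" by (simp add: ihom_def Let_def)
  have P: "?P (snd (ihom A B))"
    unfolding e snd_conv by (rule theI') (rule equalizer_alg[OF extend_lin[OF assms] pl eq])
  show "fst (ihom A B) = Dom C ?k" by (simp add: e)
  have k: "Cod C ?k = fst (cotensor (fst A) B)"
    using eq ar A B by (auto simp: is_equalizer_def Hom_def)
  have "(Dom C ?k, snd (ihom A B)) = ihom A B" by (simp add: e)
  then show "ihom A B \<in> Ob L" "lin (ihom A B) (cotensor (fst A) B) ?k"
    using sub_alg[OF m refl k _ conjunct1[OF P] conjunct2[OF P]] A B by auto
qed

abbreviation ap :: "('o, 'a) alg \<Rightarrow> ('o, 'a) alg \<Rightarrow> 'a \<Rightarrow> 'a \<Rightarrow> 'a" where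
  "ap A B a p \<equiv> ev (fst A) (fst B) a (hom_incl A B \<cdot> p)"

lemma ihom_alg [simp]: "A \<in> Ob L \<Longrightarrow> B \<in> Ob L \<Longrightarrow> ihom A B \<in> Ob L"
  by (rule hom_incl_props)

lemma hom_incl_arr [simp]:
  assumes "A \<in> Ob L" "B \<in> Ob L"
  shows "arr (hom_incl A B)" "Dom C (hom_incl A B) = fst (ihom A B)"
    "Cod C (hom_incl A B) = Exp C (fst A) (fst B)"
  using linD[OF hom_incl_props(4)[OF assms]] by simp_all

lemma element_lin:
  assumes A: "A \<in> Ob L" and B: "B \<in> Ob L" and p: "p \<in> el (fst (ihom A B))"
  shows "lin A B (ev (fst A) (fst B) (Id C (fst A)) ((hom_incl A B \<cdot> p) \<cdot> bang (fst A)))" (is "lin A B ?f")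
proof (rule linI)
  let ?k = "hom_incl A B"
  note ar = extend_arr[OF A B] exp_pre_props[of "snd A" "TO T (fst A)" "fst A" "fst B"]
  fix t assume t: "t \<in> el (TO T (fst A))"
  have "extend A B \<cdot> ?k = exp_pre C (snd A) (fst B) \<cdot> ?k"
    using hom_incl_equalizer[OF A B] by (simp add: is_equalizer_def)
  then have "(extend A B \<cdot> ?k) \<cdot> p = (exp_pre C (snd A) (fst B) \<cdot> ?k) \<cdot> p" by simp
  then have "extend A B \<cdot> (?k \<cdot> p) = exp_pre C (snd A) (fst B) \<cdot> (?k \<cdot> p)"
    using A B p ar by simp
  then have "ev (TO T (fst A)) (fst B) t (extend A B \<cdot> (?k \<cdot> p)) =
      ev (TO T (fst A)) (fst B) t (exp_pre C (snd A) (fst B) \<cdot> (?k \<cdot> p))" by simp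
  then show "?f \<cdot> (snd A \<cdot> t) = snd B \<cdot> (TA T ?f \<cdot> t)"
    using ev_extend[OF A B t, of "?k \<cdot> p"] A B p t ar by simp
qed (use A B p in \<open>auto simp: Hom_iff\<close>)

section \<open>Maps linear in one variable and their transposes\<close>

text \<open>The morphisms from \<open>Z\<close> to the internal hom, in transposed form. Linearity
  can be tested at one element of \<open>Z\<close> at a time because the category is
  well-pointed.\<close>

definition phom :: "('o, 'a) alg \<Rightarrow> 'o \<Rightarrow> ('o, 'a) alg \<Rightarrow> 'a set" where
  "phom A Z B = {q \<in> Hom C (fst A \<^bold>\<times> Z) (fst B).
     \<forall>z \<in> el Z. lin A B (q \<cdot> \<langle>Id C (fst A), z \<cdot> bang (fst A)\<rangle>)}"

lemma phomD:
  assumes "q \<in> phom A Z B"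
  shows "arr q" "Dom C q = fst A \<^bold>\<times> Z" "Cod C q = fst B"
    "z \<in> el Z \<Longrightarrow> lin A B (q \<cdot> \<langle>Id C (fst A), z \<cdot> bang (fst A)\<rangle>)"
  using assms by (auto simp: phom_def Hom_def)

lemma phomI:
  assumes "q \<in> Hom C (fst A \<^bold>\<times> Z) (fst B)" "A \<in> Ob L" "Z \<in> Ob C"
    and "\<And>z. z \<in> el Z \<Longrightarrow> \<exists>f. lin A B f \<and> (\<forall>a \<in> el (fst A). q \<cdot> \<langle>a, z\<rangle> = f \<cdot> a)"
  shows "q \<in> phom A Z B"
  unfolding phom_def
proof (intro CollectI conjI ballI assms(1))
  fix z assume z: "z \<in> el Z"
  then obtain f where f: "lin A B f" "\<forall>a \<in> el (fst A). q \<cdot> \<langle>a, z\<rangle> = f \<cdot> a"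
    using assms(4) by blast
  have "q \<cdot> \<langle>Id C (fst A), z \<cdot> bang (fst A)\<rangle> = f"
    by (rule map_eqI[of _ "fst A" "fst B"]) (use z f linD[OF f(1)] HomD(1-3)[OF assms(1)] assms(2,3) in \<open>auto simp: Hom_iff\<close>)
  then show "lin A B (q \<cdot> \<langle>Id C (fst A), z \<cdot> bang (fst A)\<rangle>)" using f by simp
qed

lemma phom_ext:
  assumes q: "q \<in> phom A Z B" and r: "r \<in> phom A Z B" and "A \<in> Ob L" "Z \<in> Ob C"
    and "\<And>a z. a \<in> el (fst A) \<Longrightarrow> z \<in> el Z \<Longrightarrow> q \<cdot> \<langle>a, z\<rangle> = r \<cdot> \<langle>a, z\<rangle>"
  shows "q = r"
  by (rule map2_eqI[of _ "fst A" Z "fst B"])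
    (use assms phomD(1-3)[OF q] phomD(1-3)[OF r] in \<open>auto simp: Hom_iff\<close>)

text \<open>At an element \<open>z\<close>, the parallel pair compares
  \<open>snd B \<cdot> TA T f\<close> with \<open>f \<cdot> snd A\<close> for the slice
  \<open>f\<close> of \<open>q\<close>; linearity of the slices is thus what the factorization
  requires.\<close>

lemma transpose_ex1:
  assumes A: "A \<in> Ob L" and B: "B \<in> Ob L" and Z: "Z \<in> Ob C" and q: "q \<in> phom A Z B"
  shows "\<exists>!v. v \<in> Hom C Z (fst (ihom A B)) \<and> hom_incl A B \<cdot> v = curry_map C (fst A) Z q"
proof -
  let ?c = "curry_map C (fst A) Z q"
  note qa = phomD(1-3)[OF q]
  note ar = extend_arr[OF A B] exp_pre_props[of "snd A" "TO T (fst A)" "fst A" "fst B"]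
  have "extend A B \<cdot> ?c = exp_pre C (snd A) (fst B) \<cdot> ?c"
  proof (rule exp_eqI[of _ Z "TO T (fst A)" "fst B"])
    fix t z assume t: "t \<in> el (TO T (fst A))" and z: "z \<in> el Z"
    let ?f = "q \<cdot> \<langle>Id C (fst A), z \<cdot> bang (fst A)\<rangle>"
    have fe: "ev (fst A) (fst B) (Id C (fst A)) ((?c \<cdot> z) \<cdot> bang (fst A)) = ?f"
      using z qa A B Z by simp
    have "ev (TO T (fst A)) (fst B) t (extend A B \<cdot> (?c \<cdot> z)) = snd B \<cdot> (TA T ?f \<cdot> t)"
      unfolding fe[symmetric] by (rule ev_extend[OF A B t]) (use z qa A B Z in simp)
    then have "ev (TO T (fst A)) (fst B) t ((extend A B \<cdot> ?c) \<cdot> z) = snd B \<cdot> (TA T ?f \<cdot> t)"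
      using z qa A B ar(1-3) Z by (simp del: TA_comp_arr)
    also have "\<dots> = ?f \<cdot> (snd A \<cdot> t)"
      using lin_apply[OF phomD(4)[OF q z], of t] t by simp
    also have "\<dots> = ev (TO T (fst A)) (fst B) t ((exp_pre C (snd A) (fst B) \<cdot> ?c) \<cdot> z)"
      using z qa A B ar t Z by simp
    finally show "ev (TO T (fst A)) (fst B) t ((extend A B \<cdot> ?c) \<cdot> z) =
      ev (TO T (fst A)) (fst B) t ((exp_pre C (snd A) (fst B) \<cdot> ?c) \<cdot> z)" .
  qed (use A B qa ar Z in \<open>auto simp: Hom_iff\<close>)
  moreover have "?c \<in> Hom C Z (Dom C (extend A B))" using A B qa ar Z by (auto simp: Hom_iff)
  ultimately show ?thesis
    using hom_incl_equalizer[OF A B] unfolding is_equalizer_def hom_incl_props(1)[OF A B] by blast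
qed

definition transpose :: "('o, 'a) alg \<Rightarrow> ('o, 'a) alg \<Rightarrow> 'o \<Rightarrow> 'a \<Rightarrow> 'a" where
  "transpose A B Z q = (THE v. v \<in> Hom C Z (fst (ihom A B)) \<and> hom_incl A B \<cdot> v = curry_map C (fst A) Z q)"

lemma transpose_props:
  assumes A: "A \<in> Ob L" and B: "B \<in> Ob L" and Z: "Z \<in> Ob C" and q: "q \<in> phom A Z B"
  shows "arr (transpose A B Z q)" "Dom C (transpose A B Z q) = Z"
    "Cod C (transpose A B Z q) = fst (ihom A B)"
    "arr z \<Longrightarrow> Cod C z = Z \<Longrightarrow> arr a \<Longrightarrow> Cod C a = fst A \<Longrightarrow> Dom C a = Dom C z \<Longrightarrow>
      ap A B a (transpose A B Z q \<cdot> z) = q \<cdot> \<langle>a, z\<rangle>"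
proof -
  let ?v = "transpose A B Z q"
  have *: "?v \<in> Hom C Z (fst (ihom A B)) \<and> hom_incl A B \<cdot> ?v = curry_map C (fst A) Z q"
    unfolding transpose_def by (rule theI') (rule transpose_ex1[OF assms])
  then show v: "arr ?v" "Dom C ?v = Z" "Cod C ?v = fst (ihom A B)"
    by (auto simp: Hom_iff)
  show "ap A B a (?v \<cdot> z) = q \<cdot> \<langle>a, z\<rangle>"
    if "arr z" "Cod C z = Z" "arr a" "Cod C a = fst A" "Dom C a = Dom C z"
  proof -
    have "hom_incl A B \<cdot> (?v \<cdot> z) = (hom_incl A B \<cdot> ?v) \<cdot> z" using A B v that by simp
    also have "\<dots> = curry_map C (fst A) Z q \<cdot> z" using * by simp
    finally show ?thesis using that phomD(1-3)[OF q] A B Z by simp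
  qed
qed

lemma ihom_ext:
  assumes "u \<in> Hom C Z (fst (ihom A B))" "v \<in> Hom C Z (fst (ihom A B))" "A \<in> Ob L" "B \<in> Ob L"
    and "\<And>a z. a \<in> el (fst A) \<Longrightarrow> z \<in> el Z \<Longrightarrow>
      ap A B a (u \<cdot> z) = ap A B a (v \<cdot> z)"
  shows "u = v"
proof -
  note ar = HomD(1-3)[OF assms(1)] HomD(1-3)[OF assms(2)]
  have "hom_incl A B \<cdot> u = hom_incl A B \<cdot> v"
    by (rule exp_eqI[of _ Z "fst A" "fst B"]) (use ar assms in \<open>auto simp: Hom_iff\<close>)
  then show ?thesis using monicD[OF hom_incl_props(3), of A B u v] ar assms by simp
qed

lemma ihom_element_ext:
  assumes "u \<in> el (fst (ihom A B))" "v \<in> el (fst (ihom A B))" "A \<in> Ob L" "B \<in> Ob L"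
    and "\<And>a. a \<in> el (fst A) \<Longrightarrow>
      ap A B a u = ap A B a v"
  shows "u = v"
proof (rule ihom_ext[OF _ _ assms(3,4)])
  fix a z assume "a \<in> el (fst A)" "z \<in> el (One C)"
  moreover from this have "z = Id C (One C)" using bang_unique[of z] by simp
  ultimately show "ap A B a (u \<cdot> z) =
      ap A B a (v \<cdot> z)" using assms by simp
qed (use assms in \<open>auto simp: Hom_iff\<close>)

lemma ev_hom_incl_lin:
  assumes "A \<in> Ob L" "B \<in> Ob L" "a \<in> el (fst A)"
  shows "lin (ihom A B) B (evx (fst A) (fst B) a \<cdot> hom_incl A B)"
  by (rule lin_comp[OF hom_incl_props(4) evx_lin]) (use assms in simp_all)

lemma lin_into_ihom:
  assumes "A \<in> Ob L" "B \<in> Ob L" "D \<in> Ob L" "w \<in> Hom C (fst D) (fst (ihom A B))"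
    and "\<And>a. a \<in> el (fst A) \<Longrightarrow> \<exists>f. lin D B f \<and>
      (\<forall>d \<in> el (fst D). ap A B a (w \<cdot> d) = f \<cdot> d)"
  shows "lin D (ihom A B) w"
proof (rule lin_factor[OF hom_incl_props(4,3)])
  note wa = HomD(1-3)[OF assms(4)]
  show "lin D (cotensor (fst A) B) (hom_incl A B \<cdot> w)"
  proof (rule lin_into_cotensor)
    fix a assume a: "a \<in> el (fst A)"
    obtain f where f: "lin D B f"
      "\<forall>d \<in> el (fst D). ap A B a (w \<cdot> d) = f \<cdot> d"
      using assms(5)[OF a] by blast
    have "evx (fst A) (fst B) a \<cdot> (hom_incl A B \<cdot> w) = f"
    proof (rule map_eqI[of _ "fst D" "fst B"])
      fix d assume d: "d \<in> el (fst D)"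
      show "(evx (fst A) (fst B) a \<cdot> (hom_incl A B \<cdot> w)) \<cdot> d = f \<cdot> d"
        using f(2)[rule_format, OF d] d a wa assms(1-2) by simp
    qed (use wa a assms(1-2) linD(3-5)[OF f(1)] in \<open>auto simp: Hom_iff\<close>)
    then show "lin D B (evx (fst A) (fst B) a \<cdot> (hom_incl A B \<cdot> w))" using f by simp
  qed (use assms wa in \<open>auto simp: Hom_iff\<close>)
qed (use assms in auto)

text \<open>The counterpart of \<open>name_of\<close> for the internal hom of algebras: a transpose
  with trivial parameter \<open>One C\<close>.\<close>

definition code :: "('o, 'a) alg \<Rightarrow> ('o, 'a) alg \<Rightarrow> 'a \<Rightarrow> 'a" where
  "code A B f = transpose A B (One C) (f \<cdot> Fst C (fst A) (One C))"

lemma code_props: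
  assumes "lin A B f"
  shows "arr (code A B f)" "Dom C (code A B f) = One C" "Cod C (code A B f) = fst (ihom A B)"
    "hom_incl A B \<cdot> code A B f = name_of C f"
    "arr a \<Longrightarrow> Dom C a = One C \<Longrightarrow> Cod C a = fst A \<Longrightarrow>
      ap A B a (code A B f) = f \<cdot> a"
proof -
  note fa = linD(1-5)[OF assms]
  have q: "f \<cdot> Fst C (fst A) (One C) \<in> phom A (One C) B"
    by (rule phomI) (use fa assms in \<open>auto simp: Hom_iff\<close>)
  note tp = transpose_props[OF fa(1,2) one_ob q]
  show c: "arr (code A B f)" "Dom C (code A B f) = One C" "Cod C (code A B f) = fst (ihom A B)"
    unfolding code_def by (fact tp(1-3))+
  show ev: "ap A B a (code A B f) = f \<cdot> a"
    if "arr a" "Dom C a = One C" "Cod C a = fst A" for a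
    using tp(4)[of "Id C (One C)" a] tp(1-3) that fa by (simp add: code_def)
  show "hom_incl A B \<cdot> code A B f = name_of C f"
    by (rule exp_element_eqI[of _ "fst A" "fst B"]) (use c ev fa in auto)
qed

definition uncurry :: "('o, 'a) alg \<Rightarrow> ('o, 'a) alg \<Rightarrow> 'a \<Rightarrow> 'a" where
  "uncurry A B v = ap A B (Fst C (fst A) (Dom C v)) (v \<cdot> Snd C (fst A) (Dom C v))"

lemma uncurry_apply:
  assumes "A \<in> Ob L" "B \<in> Ob L" "v \<in> Hom C Z (fst (ihom A B))"
    "arr a" "Cod C a = fst A" "arr z" "Cod C z = Z" "Dom C a = Dom C z"
  shows "uncurry A B v \<cdot> \<langle>a, z\<rangle> = ap A B a (v \<cdot> z)"
  using assms(1,2,4-8) HomD(1-4)[OF assms(3)] by (simp add: uncurry_def)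

lemma uncurry_phom:
  assumes A: "A \<in> Ob L" and B: "B \<in> Ob L" and v: "v \<in> Hom C Z (fst (ihom A B))"
  shows "uncurry A B v \<in> phom A Z B"
proof (rule phomI)
  note va = HomD(1-3)[OF v]
  fix z assume z: "z \<in> el Z"
  have l: "lin A B (ev (fst A) (fst B) (Id C (fst A)) ((hom_incl A B \<cdot> (v \<cdot> z)) \<cdot> bang (fst A)))"
    by (rule element_lin) (use A B va z in auto)
  show "\<exists>f. lin A B f \<and> (\<forall>a \<in> el (fst A). uncurry A B v \<cdot> \<langle>a, z\<rangle> = f \<cdot> a)"
    by (rule exI, rule conjI, rule l) (use A B v va z in \<open>auto simp: uncurry_apply[OF A B v]\<close>)
qed (use A B HomD(1-4)[OF v] in \<open>auto simp: uncurry_def Hom_def\<close>)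

section \<open>Contravariant action of the internal hom\<close>

definition imap :: "('o, 'a) alg \<Rightarrow> 'a \<Rightarrow> ('o, 'a) alg \<Rightarrow> ('o, 'a) alg \<Rightarrow> 'a" where
  "imap A h B M = GA (ihom_map (A, h, B) M)"

lemma imap_props:
  assumes h: "lin A B h" and M: "M \<in> Ob L"
  shows "ihom_map (A, h, B) M = (ihom B M, imap A h B M, ihom A M)"
    "lin (ihom B M) (ihom A M) (imap A h B M)"
    "a \<in> el (fst A) \<Longrightarrow> p \<in> el (fst (ihom B M)) \<Longrightarrow>
      ap A M a (imap A h B M \<cdot> p) =
      ap B M (h \<cdot> a) p"
proof -
  note ha = linD(1-5)[OF h]
  note pre = exp_pre_props[OF ha(3,4,5) alg_arr(1)[OF M]]
  let ?Z = "fst (ihom B M)" and ?g = "imap A h B M"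
  let ?P = "\<lambda>g. g \<in> Hom C ?Z (fst (ihom A M)) \<and>
                 hom_incl A M \<cdot> g = exp_pre C h (fst M) \<cdot> hom_incl B M"
  \<comment> \<open>The evaluation of \<open>p\<close> at \<open>h \<cdot> a\<close>. Its transpose
    shows that the arrow selected by \<open>THE\<close> in \<open>ihom_map\<close> exists.\<close>
  let ?q = "ap B M (h \<cdot> Fst C (fst A) ?Z) (Snd C (fst A) ?Z)"
  have q: "?q \<in> phom A ?Z M"
  proof (rule phomI)
    fix z assume z: "z \<in> el ?Z"
    show "\<exists>f. lin A M f \<and> (\<forall>a \<in> el (fst A). ?q \<cdot> \<langle>a, z\<rangle> = f \<cdot> a)"
      by (rule exI, rule conjI, rule lin_comp[OF h element_lin[OF ha(2) M z]])
        (use z ha M in auto)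
  qed (use ha M in \<open>auto simp: Hom_iff\<close>)
  have cq: "curry_map C (fst A) ?Z ?q = exp_pre C h (fst M) \<cdot> hom_incl B M"
    by (rule exp_eqI[of _ ?Z "fst A" "fst M"]) (use ha M pre in \<open>auto simp: Hom_iff\<close>)
  have e: "ihom_map (A, h, B) M = (ihom B M, THE g. ?P g, ihom A M)"
    by (simp add: ihom_map_def Let_def)
  have P: "?P ?g"
    unfolding imap_def e L_simps(5)
    by (rule theI', rule transpose_ex1[OF ha(1) M _ q, unfolded cq]) (use ha M in simp)
  show "ihom_map (A, h, B) M = (ihom B M, ?g, ihom A M)" by (simp add: imap_def e)
  note ga = HomD(1-3)[OF conjunct1[OF P]]
  show ev: "ap A M a (?g \<cdot> p) =
      ap B M (h \<cdot> a) p"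
    if "a \<in> el (fst A)" "p \<in> el ?Z" for a p
  proof -
    have "hom_incl A M \<cdot> (?g \<cdot> p) = (hom_incl A M \<cdot> ?g) \<cdot> p" using ga ha M that by simp
    also have "\<dots> = exp_pre C h (fst M) \<cdot> (hom_incl B M \<cdot> p)"
      unfolding conjunct2[OF P] using pre ha M that by simp
    finally show ?thesis using pre(4)[of a "hom_incl B M \<cdot> p"] ha M that by simp
  qed
  show "lin (ihom B M) (ihom A M) ?g"
  proof (rule lin_into_ihom)
    fix a assume a: "a \<in> el (fst A)"
    show "\<exists>f. lin (ihom B M) M f \<and> (\<forall>d \<in> el ?Z.
        ap A M a (?g \<cdot> d) = f \<cdot> d)"
      by (rule exI, rule conjI, rule ev_hom_incl_lin[OF ha(2) M, of "h \<cdot> a"])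
        (use a ha M ev in auto)
  qed (use ha M P in auto)
qed

section \<open>Functional completeness\<close>

text \<open>\<open>orth A h B M\<close> is the enriched orthogonality of \<open>h : A \<rightarrow> B\<close> to \<open>M\<close>, tested on all parameter
  objects \<open>Z\<close>.\<close>

definition orth :: "('o, 'a) alg \<Rightarrow> 'a \<Rightarrow> ('o, 'a) alg \<Rightarrow> ('o, 'a) alg \<Rightarrow> bool" where
  "orth A h B M \<longleftrightarrow> (\<forall>Z \<in> Ob C. \<forall>g \<in> phom A Z M.
     \<exists>!q. q \<in> phom B Z M \<and> q \<cdot> (h \<boxtimes> Id C Z) = g)"

text \<open>Passes between the equation of arrows by which \<open>orth\<close> is stated and the
  equation of values by which it is used.\<close>

lemma prod_map_phom_eq_iff:
  assumes h: "lin A B h" and Z: "Z \<in> Ob C" and q: "q \<in> Hom C (fst B \<^bold>\<times> Z) Y" and g: "g \<in> Hom C (fst A \<^bold>\<times> Z) Y"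
  shows "q \<cdot> (h \<boxtimes> Id C Z) = g \<longleftrightarrow> (\<forall>a \<in> el (fst A). \<forall>z \<in> el Z. q \<cdot> \<langle>h \<cdot> a, z\<rangle> = g \<cdot> \<langle>a, z\<rangle>)"
proof
  note ha = linD(1-5)[OF h]
  assume "q \<cdot> (h \<boxtimes> Id C Z) = g"
  then show "\<forall>a \<in> el (fst A). \<forall>z \<in> el Z. q \<cdot> \<langle>h \<cdot> a, z\<rangle> = g \<cdot> \<langle>a, z\<rangle>"
    using ha Z HomD(1-3)[OF q] by auto
next
  note ha = linD(1-5)[OF h]
  assume "\<forall>a \<in> el (fst A). \<forall>z \<in> el Z. q \<cdot> \<langle>h \<cdot> a, z\<rangle> = g \<cdot> \<langle>a, z\<rangle>"
  then have *: "q \<cdot> \<langle>h \<cdot> a, z\<rangle> = g \<cdot> \<langle>a, z\<rangle>"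
    if "a \<in> el (fst A)" "z \<in> el Z" for a z using that by blast
  show "q \<cdot> (h \<boxtimes> Id C Z) = g"
  proof (rule map2_eqI[of _ "fst A" Z Y])
    fix a z assume az: "a \<in> el (fst A)" "z \<in> el Z"
    show "(q \<cdot> (h \<boxtimes> Id C Z)) \<cdot> \<langle>a, z\<rangle> = g \<cdot> \<langle>a, z\<rangle>"
      using *[OF az] az ha Z HomD(1-3)[OF q] by simp
  qed (use ha Z HomD(1-3)[OF q] g in \<open>auto simp: Hom_iff\<close>)
qed

text \<open>Yoneda: morphisms from \<open>Z\<close> into an internal hom correspond to members of
  \<open>phom\<close>, and composition with \<open>imap\<close> corresponds to restriction along
  \<open>h\<close>. So \<open>imap\<close> is invertible iff restriction is bijective for all
  \<open>Z\<close>.\<close>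

lemma iso_ihom_map_iff:
  assumes h: "lin A B h" and M: "M \<in> Ob L"
  shows "iso L (ihom_map (A, h, B) M) \<longleftrightarrow> orth A h B M"
proof -
  note ha = linD(1-5)[OF h]
  note im = imap_props[OF h M]
  let ?g = "imap A h B M"
  note ga = linD(1-5)[OF im(2)]
  have "iso L (ihom_map (A, h, B) M) \<longleftrightarrow> iso C ?g"
    unfolding im(1) by (rule iso_L_iff[OF im(2)])
  also have "\<dots> \<longleftrightarrow> orth A h B M"
  proof
    assume "iso C ?g"
    then obtain v where v: "arr v" "Dom C v = fst (ihom A M)" "Cod C v = fst (ihom B M)"
      "v \<cdot> ?g = Id C (fst (ihom B M))" "?g \<cdot> v = Id C (fst (ihom A M))"
      using ga by (auto elim!: iso_inverse)
    have gv: "?g \<cdot> (v \<cdot> u) = u" if "arr u" "Cod C u = fst (ihom A M)" for u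
      using arg_cong[OF v(5), of "\<lambda>f. f \<cdot> u"] v(1-3) ga that by simp
    have vg: "v \<cdot> (?g \<cdot> u) = u" if "arr u" "Cod C u = fst (ihom B M)" for u
      using arg_cong[OF v(4), of "\<lambda>f. f \<cdot> u"] v(1-3) ga that by simp
    show "orth A h B M"
      unfolding orth_def
    proof (intro ballI ex1I conjI; (elim conjE)?)
      fix Z g0 assume Z: "Z \<in> Ob C" and g0: "g0 \<in> phom A Z M"
      note tp = transpose_props[OF ha(1) M Z g0]
      note g0a = phomD(1-3)[OF g0]
      let ?w = "v \<cdot> transpose A M Z g0"
      have w: "?w \<in> Hom C Z (fst (ihom B M))" using v tp(1-3) by (simp add: Hom_iff)
      let ?q = "uncurry B M ?w"
      show q: "?q \<in> phom B Z M" by (rule uncurry_phom[OF ha(2) M w])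
      have ap: "?q \<cdot> \<langle>h \<cdot> a, z\<rangle> = g0 \<cdot> \<langle>a, z\<rangle>"
        if "a \<in> el (fst A)" "z \<in> el Z" for a z
      proof -
        have "?q \<cdot> \<langle>h \<cdot> a, z\<rangle> = ap B M (h \<cdot> a) (?w \<cdot> z)"
          by (rule uncurry_apply[OF ha(2) M w]) (use ha that in auto)
        also have "\<dots> = ap A M a (?g \<cdot> (?w \<cdot> z))"
          by (rule im(3)[symmetric]) (use that v tp(1-3) in auto)
        also have "\<dots> = g0 \<cdot> \<langle>a, z\<rangle>"
          using gv[of "transpose A M Z g0 \<cdot> z"] tp that v(1-3) by simp
        finally show ?thesis .
      qed
      have qa: "?q \<in> Hom C (fst B \<^bold>\<times> Z) (fst M)" "g0 \<in> Hom C (fst A \<^bold>\<times> Z) (fst M)"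
        using q g0 by (auto simp: phom_def)
      show "?q \<cdot> (h \<boxtimes> Id C Z) = g0"
        unfolding prod_map_phom_eq_iff[OF h Z qa] using ap by blast
      fix r assume r: "r \<in> phom B Z M" "r \<cdot> (h \<boxtimes> Id C Z) = g0"
      have ra: "r \<in> Hom C (fst B \<^bold>\<times> Z) (fst M)" using r by (auto simp: phom_def)
      note tr = transpose_props[OF ha(2) M Z r(1)]
      have r': "r \<cdot> \<langle>h \<cdot> a, z\<rangle> = g0 \<cdot> \<langle>a, z\<rangle>"
        if "a \<in> el (fst A)" "z \<in> el Z" for a z
        using r(2) that unfolding prod_map_phom_eq_iff[OF h Z ra qa(2)] by blast
      have "?g \<cdot> transpose B M Z r = transpose A M Z g0"
      proof (rule ihom_ext[of _ Z A M])
        fix a z assume az: "a \<in> el (fst A)" "z \<in> el Z"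
        have "ap A M a ((?g \<cdot> transpose B M Z r) \<cdot> z) =
            ap B M (h \<cdot> a) (transpose B M Z r \<cdot> z)"
          using im(3)[of a "transpose B M Z r \<cdot> z"] az ga tr(1-3) by simp
        also have "\<dots> = ap A M a (transpose A M Z g0 \<cdot> z)"
          using az ha r'[OF az] tr(4)[of z "h \<cdot> a"] tp(4)[of z a] by simp
        finally show "ap A M a ((?g \<cdot> transpose B M Z r) \<cdot> z) =
          ap A M a (transpose A M Z g0 \<cdot> z)" .
      qed (use ga ha M tr tp in \<open>auto simp: Hom_iff\<close>)
      then have "transpose B M Z r = ?w" using vg[of "transpose B M Z r"] tr by simp
      then show "r = ?q"
        by (intro phom_ext[OF r(1) q ha(2) Z])
          (use tr(4) ha M w in \<open>simp add: uncurry_apply\<close>)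
    qed
  next
    assume o: "orth A h B M"
    let ?HA = "fst (ihom A M)" and ?HB = "fst (ihom B M)"
    have HA: "?HA \<in> Ob C" "?HB \<in> Ob C" using ha M by simp_all
    have ida: "Id C ?HA \<in> Hom C ?HA ?HA" and idb: "Id C ?HB \<in> Hom C ?HB ?HB"
      using HA by (auto simp: Hom_iff)
    \<comment> \<open>The universal family: evaluation, with the internal hom itself as parameter
      object. Transposing its extension along \<open>h\<close> gives the candidate for the
      inverse.\<close>
    have ea: "uncurry A M (Id C ?HA) \<in> phom A ?HA M" by (rule uncurry_phom[OF ha(1) M ida])
    obtain q where q: "q \<in> phom B ?HA M" "q \<cdot> (h \<boxtimes> Id C ?HA) = uncurry A M (Id C ?HA)"
      using o HA ea unfolding orth_def by blast
    have qa: "q \<in> Hom C (fst B \<^bold>\<times> ?HA) (fst M)" "uncurry A M (Id C ?HA) \<in> Hom C (fst A \<^bold>\<times> ?HA) (fst M)"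
      using q ea by (auto simp: phom_def)
    let ?v = "transpose B M ?HA q"
    note tr = transpose_props[OF ha(2) M HA(1) q(1)]
    have qh: "q \<cdot> \<langle>h \<cdot> a, p\<rangle> = ap A M a p"
      if "a \<in> el (fst A)" "p \<in> el ?HA" for a p
    proof -
      have "q \<cdot> \<langle>h \<cdot> a, p\<rangle> = uncurry A M (Id C ?HA) \<cdot> \<langle>a, p\<rangle>"
        using q(2) that unfolding prod_map_phom_eq_iff[OF h HA(1) qa] by blast
      also have "\<dots> = ap A M a (Id C ?HA \<cdot> p)"
        by (rule uncurry_apply[OF ha(1) M ida]) (use that in auto)
      finally show ?thesis using that HA by simp
    qed
    have gv: "?g \<cdot> ?v = Id C ?HA"
    proof (rule ihom_ext[of _ ?HA A M])
      fix a p assume ap: "a \<in> el (fst A)" "p \<in> el ?HA"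
      show "ap A M a ((?g \<cdot> ?v) \<cdot> p) =
          ap A M a (Id C ?HA \<cdot> p)"
        using im(3)[of a "?v \<cdot> p"] ap ga tr ha qh[OF ap] HA by simp
    qed (use ga ha M tr ida in \<open>auto simp: Hom_iff\<close>)
    have gg: "?g \<cdot> (?v \<cdot> (?g \<cdot> u)) = ?g \<cdot> u" if "arr u" "Cod C u = ?HB" for u
      using arg_cong[OF gv, of "\<lambda>f. f \<cdot> (?g \<cdot> u)"] that ga tr(1-3) HA by simp
    have w: "?v \<cdot> ?g \<in> Hom C ?HB ?HB" using ga tr(1-3) by (simp add: Hom_iff)
    have g0: "uncurry A M ?g \<in> phom A ?HB M"
      by (rule uncurry_phom[OF ha(1) M]) (use ga in \<open>simp add: Hom_iff\<close>)
    have g': "?g \<in> Hom C ?HB ?HA" using ga by (simp add: Hom_iff)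
    \<comment> \<open>For the other composite: \<open>?v \<cdot> ?g\<close> and the identity both
      correspond to extensions of the same map along \<open>h\<close>, and such an extension is
      unique.\<close>
    have *: "uncurry B M u \<in> phom B ?HB M \<and> uncurry B M u \<cdot> (h \<boxtimes> Id C ?HB) = uncurry A M ?g"
      if u: "u \<in> Hom C ?HB ?HB" "?g \<cdot> u = ?g" for u
    proof
      show p: "uncurry B M u \<in> phom B ?HB M" by (rule uncurry_phom[OF ha(2) M u(1)])
      have qa: "uncurry B M u \<in> Hom C (fst B \<^bold>\<times> ?HB) (fst M)" "uncurry A M ?g \<in> Hom C (fst A \<^bold>\<times> ?HB) (fst M)"
        using p g0 by (auto simp: phom_def)
      show "uncurry B M u \<cdot> (h \<boxtimes> Id C ?HB) = uncurry A M ?g"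
        unfolding prod_map_phom_eq_iff[OF h HA(2) qa]
      proof (intro ballI)
        fix a p assume ap: "a \<in> el (fst A)" "p \<in> el ?HB"
        have "uncurry B M u \<cdot> \<langle>h \<cdot> a, p\<rangle> = ap B M (h \<cdot> a) (u \<cdot> p)"
          by (rule uncurry_apply[OF ha(2) M u(1)]) (use ap ha in auto)
        also have "\<dots> = ap A M a (?g \<cdot> (u \<cdot> p))"
          by (rule im(3)[symmetric]) (use ap HomD(1-3)[OF u(1)] in auto)
        also have "?g \<cdot> (u \<cdot> p) = ?g \<cdot> p"
          using arg_cong[OF u(2), of "\<lambda>f. f \<cdot> p"] HomD(1-3)[OF u(1)] ga ap by simp
        also have "ap A M a (?g \<cdot> p) = uncurry A M ?g \<cdot> \<langle>a, p\<rangle>"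
          by (rule uncurry_apply[OF ha(1) M g', symmetric]) (use ap in auto)
        finally show "uncurry B M u \<cdot> \<langle>h \<cdot> a, p\<rangle> = uncurry A M ?g \<cdot> \<langle>a, p\<rangle>" .
      qed
    qed
    have "uncurry B M (?v \<cdot> ?g) = uncurry B M (Id C ?HB)"
      using o[unfolded orth_def, rule_format, OF HA(2) g0] *[OF w] *[OF idb] gg[of "Id C ?HB"] ga HA
        tr(1-3) by auto
    then have eq: "uncurry B M (?v \<cdot> ?g) \<cdot> \<langle>b, p\<rangle> = uncurry B M (Id C ?HB) \<cdot> \<langle>b, p\<rangle>" for b p by simp
    have vg: "?v \<cdot> ?g = Id C ?HB"
    proof (rule ihom_ext[OF w idb ha(2) M])
      fix b p assume "b \<in> el (fst B)" "p \<in> el ?HB"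
      then show "ap B M b ((?v \<cdot> ?g) \<cdot> p) =
          ap B M b (Id C ?HB \<cdot> p)"
        using eq[of b p] uncurry_apply[OF ha(2) M w, of b p] uncurry_apply[OF ha(2) M idb, of b p]
        unfolding elements_iff by (simp only:)
    qed
    show "iso C ?g"
      unfolding iso_def using ga tr(1-3) gv vg by (auto simp: Hom_iff intro!: bexI[of _ ?v])
  qed
  finally show ?thesis .
qed

lemma phom_comp:
  assumes g: "g \<in> phom A Z M" and m: "lin M N m" and A: "A \<in> Ob L" "Z \<in> Ob C"
  shows "m \<cdot> g \<in> phom A Z N"
proof (rule phomI[OF _ A])
  note ar = phomD(1-3)[OF g] linD(3-5)[OF m]
  show "m \<cdot> g \<in> Hom C (fst A \<^bold>\<times> Z) (fst N)" using ar by (simp add: Hom_iff)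
  fix z assume z: "z \<in> el Z"
  show "\<exists>f. lin A N f \<and> (\<forall>a \<in> el (fst A). (m \<cdot> g) \<cdot> \<langle>a, z\<rangle> = f \<cdot> a)"
    by (rule exI, rule conjI, rule lin_comp[OF phomD(4)[OF g z] m]) (use ar A z in auto)
qed

lemma phom_slice:
  assumes "g \<in> phom A Z M" "A \<in> Ob L" "Z \<in> Ob C" "z \<in> el Z" "arr a" "Cod C a = fst A" "Dom C a = One C"
  shows "(g \<cdot> \<langle>Id C (fst A), z \<cdot> bang (fst A)\<rangle>) \<cdot> a = g \<cdot> \<langle>a, z\<rangle>"
  using phomD(1-3)[OF assms(1)] assms(2-) by simp

lemma phom_factor:
  assumes q: "q \<in> Hom C (fst A \<^bold>\<times> Z) (fst M)" and m: "lin M N m" "monic C m"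
    and mq: "m \<cdot> q \<in> phom A Z N" and A: "A \<in> Ob L" "Z \<in> Ob C"
  shows "q \<in> phom A Z M"
  unfolding phom_def
proof (intro CollectI conjI ballI q)
  note ar = HomD(1-3)[OF q] linD(3-5)[OF m(1)]
  fix z assume z: "z \<in> el Z"
  show "lin A M (q \<cdot> \<langle>Id C (fst A), z \<cdot> bang (fst A)\<rangle>)"
    by (rule lin_factor[OF m phomD(4)[OF mq z]]) (use ar A z in \<open>auto simp: Hom_iff\<close>)
qed

lemma phom_lin:
  assumes f: "lin A M f" and Z: "Z \<in> Ob C"
  shows "f \<cdot> Fst C (fst A) Z \<in> phom A Z M"
proof (rule phomI)
  fix z assume z: "z \<in> el Z"
  show "\<exists>f'. lin A M f' \<and> (\<forall>a \<in> el (fst A). (f \<cdot> Fst C (fst A) Z) \<cdot> \<langle>a, z\<rangle> = f' \<cdot> a)"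
    by (rule exI, rule conjI, rule f) (use linD(1,3-5)[OF f] Z z in auto)
qed (use linD(1,3-5)[OF f] Z in \<open>auto simp: Hom_iff\<close>)

text \<open>A map with a parameter is determined by its slices, so uniqueness may be checked without
  parameter. For existence the extended slices would still have to form a morphism.\<close>

lemma orthI:
  assumes h: "lin A B h"
    and ex: "\<And>Z g. Z \<in> Ob C \<Longrightarrow> g \<in> phom A Z M \<Longrightarrow> \<exists>q \<in> phom B Z M.
      \<forall>a \<in> el (fst A). \<forall>z \<in> el Z. q \<cdot> \<langle>h \<cdot> a, z\<rangle> = g \<cdot> \<langle>a, z\<rangle>"
    and uniq: "\<And>f f'. lin B M f \<Longrightarrow> lin B M f' \<Longrightarrow>
      (\<And>a. a \<in> el (fst A) \<Longrightarrow> f \<cdot> (h \<cdot> a) = f' \<cdot> (h \<cdot> a)) \<Longrightarrow> f = f'"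
  shows "orth A h B M"
  unfolding orth_def
proof (intro ballI ex_ex1I; (elim conjE)?)
  note ha = linD(1-5)[OF h]
  fix Z g assume Z: "Z \<in> Ob C" and g: "g \<in> phom A Z M"
  have ga: "g \<in> Hom C (fst A \<^bold>\<times> Z) (fst M)" using g by (simp add: phom_def)
  have qa: "q \<in> Hom C (fst B \<^bold>\<times> Z) (fst M)" if "q \<in> phom B Z M" for q using that by (simp add: phom_def)
  show "\<exists>q. q \<in> phom B Z M \<and> q \<cdot> (h \<boxtimes> Id C Z) = g"
    using ex[OF Z g] prod_map_phom_eq_iff[OF h Z qa ga] by blast
  fix q r assume q: "q \<in> phom B Z M" "q \<cdot> (h \<boxtimes> Id C Z) = g" and r: "r \<in> phom B Z M" "r \<cdot> (h \<boxtimes> Id C Z) = g"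
  have e: "q \<cdot> \<langle>h \<cdot> a, z\<rangle> = r \<cdot> \<langle>h \<cdot> a, z\<rangle>" if "a \<in> el (fst A)" "z \<in> el Z" for a z
    using q(2) r(2) that
    unfolding prod_map_phom_eq_iff[OF h Z qa[OF q(1)] ga] prod_map_phom_eq_iff[OF h Z qa[OF r(1)] ga]
    by metis
  show "q = r"
  proof (rule phom_ext[OF q(1) r(1) ha(2) Z])
    fix b z assume b: "b \<in> el (fst B)" and z: "z \<in> el Z"
    have s: "q \<cdot> \<langle>Id C (fst B), z \<cdot> bang (fst B)\<rangle> = r \<cdot> \<langle>Id C (fst B), z \<cdot> bang (fst B)\<rangle>"
    proof (rule uniq[OF phomD(4)[OF q(1) z] phomD(4)[OF r(1) z]])
      fix a assume a: "a \<in> el (fst A)"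
      show "(q \<cdot> \<langle>Id C (fst B), z \<cdot> bang (fst B)\<rangle>) \<cdot> (h \<cdot> a) =
          (r \<cdot> \<langle>Id C (fst B), z \<cdot> bang (fst B)\<rangle>) \<cdot> (h \<cdot> a)"
        using e[OF a z] phom_slice[OF q(1) ha(2) Z z, of "h \<cdot> a"]
          phom_slice[OF r(1) ha(2) Z z, of "h \<cdot> a"] a ha(3-5) by (simp del: comp_assoc)
    qed
    show "q \<cdot> \<langle>b, z\<rangle> = r \<cdot> \<langle>b, z\<rangle>"
      using arg_cong[OF s, of "\<lambda>f. f \<cdot> b"] phom_slice[OF q(1) ha(2) Z z, of b]
          phom_slice[OF r(1) ha(2) Z z, of b] b by (simp del: comp_assoc)
  qed
qed

lemma orth_extend:
  assumes o: "orth A h B M" and h: "lin A B h" and Z: "Z \<in> Ob C" and g: "g \<in> phom A Z M"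
  obtains q where "q \<in> phom B Z M"
    "\<And>a z. a \<in> el (fst A) \<Longrightarrow> z \<in> el Z \<Longrightarrow> q \<cdot> \<langle>h \<cdot> a, z\<rangle> = g \<cdot> \<langle>a, z\<rangle>"
proof -
  obtain q where q: "q \<in> phom B Z M" "q \<cdot> (h \<boxtimes> Id C Z) = g"
    using o Z g unfolding orth_def by blast
  have qg: "q \<in> Hom C (fst B \<^bold>\<times> Z) (fst M)" "g \<in> Hom C (fst A \<^bold>\<times> Z) (fst M)"
    using q(1) g by (simp_all add: phom_def)
  from that[OF q(1)] q(2) show ?thesis
    unfolding prod_map_phom_eq_iff[OF h Z qg] by blast
qed

lemma orth_unique:
  assumes o: "orth A h B M" and h: "lin A B h" and Z: "Z \<in> Ob C"
    and q: "q \<in> phom B Z M" and r: "r \<in> phom B Z M"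
    and e: "\<And>a z. a \<in> el (fst A) \<Longrightarrow> z \<in> el Z \<Longrightarrow> q \<cdot> \<langle>h \<cdot> a, z\<rangle> = r \<cdot> \<langle>h \<cdot> a, z\<rangle>"
  shows "q = r"
proof -
  note ha = linD(1-5)[OF h]
  note qa = phomD(1-3)[OF q] and ra = phomD(1-3)[OF r]
  have rh: "r \<in> Hom C (fst B \<^bold>\<times> Z) (fst M)" "q \<in> Hom C (fst B \<^bold>\<times> Z) (fst M)"
    "q \<cdot> (h \<boxtimes> Id C Z) \<in> Hom C (fst A \<^bold>\<times> Z) (fst M)"
    using qa ra ha Z by (auto simp: Hom_iff)
  have g: "q \<cdot> (h \<boxtimes> Id C Z) \<in> phom A Z M"
  proof (rule phomI[OF rh(3) ha(1) Z])
    fix z assume z: "z \<in> el Z"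
    show "\<exists>f. lin A M f \<and> (\<forall>a \<in> el (fst A). (q \<cdot> (h \<boxtimes> Id C Z)) \<cdot> \<langle>a, z\<rangle> = f \<cdot> a)"
      by (rule exI, rule conjI, rule lin_comp[OF h phomD(4)[OF q z]]) (use qa ha Z z in auto)
  qed
  have "r \<cdot> (h \<boxtimes> Id C Z) = q \<cdot> (h \<boxtimes> Id C Z)"
    unfolding prod_map_phom_eq_iff[OF h Z rh(1,3)]
  proof (intro ballI)
    fix a z assume az: "a \<in> el (fst A)" "z \<in> el Z"
    have "(q \<cdot> (h \<boxtimes> Id C Z)) \<cdot> \<langle>a, z\<rangle> = q \<cdot> \<langle>h \<cdot> a, z\<rangle>" using az qa ha Z by simp
    then show "r \<cdot> \<langle>h \<cdot> a, z\<rangle> = (q \<cdot> (h \<boxtimes> Id C Z)) \<cdot> \<langle>a, z\<rangle>" using e[OF az] by simp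
  qed
  then show ?thesis using o[unfolded orth_def, rule_format, OF Z g] q r by blast
qed

lemma orth_lin_unique:
  assumes o: "orth A h B M" and h: "lin A B h" and f: "lin B M f" "lin B M f'"
    and e: "\<And>a. a \<in> el (fst A) \<Longrightarrow> f \<cdot> (h \<cdot> a) = f' \<cdot> (h \<cdot> a)"
  shows "f = f'"
proof -
  note ar = linD(1,3-5)[OF f(1)] linD(3-5)[OF f(2)]
  have "f \<cdot> Fst C (fst B) (One C) = f' \<cdot> Fst C (fst B) (One C)"
    by (rule orth_unique[OF o h one_ob phom_lin[OF f(1) one_ob] phom_lin[OF f(2) one_ob]])
      (use e ar linD(3-5)[OF h] in auto)
  then have "(f \<cdot> Fst C (fst B) (One C)) \<cdot> \<langle>Id C (fst B), bang (fst B)\<rangle> =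
      (f' \<cdot> Fst C (fst B) (One C)) \<cdot> \<langle>Id C (fst B), bang (fst B)\<rangle>" by simp
  then show ?thesis using ar by simp
qed

section \<open>Duals and the canonical map into the bidual\<close>

lemma dual_alg [simp]: "E \<in> Ob L \<Longrightarrow> dual E \<in> Ob L"
  by (simp add: dual_def)

definition bidual_map :: "('o, 'a) alg \<Rightarrow> 'a" where
  "bidual_map E = GA (bidual_unit E)"

lemma bidual_map_props:
  assumes E: "E \<in> Ob L"
  shows "bidual_unit E = (E, bidual_map E, dual (dual E))" "lin E (dual (dual E)) (bidual_map E)"
    "e \<in> el (fst E) \<Longrightarrow> p \<in> el (fst (dual E)) \<Longrightarrow>
      ap (dual E) R p (bidual_map E \<cdot> e) = ap E R e p"
proof -
  let ?q = "Ev C (fst E) (fst R) \<cdot> (Id C (fst E) \<boxtimes> hom_incl E R) \<cdot> swap C (fst (dual E)) (fst E)"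
  let ?d = "bidual_map E"
  let ?P = "\<lambda>d. d \<in> Hom C (fst E) (fst (dual (dual E))) \<and>
    hom_incl (dual E) R \<cdot> d = curry_map C (fst (dual E)) (fst E) ?q"
  have hi: "arr (hom_incl E R)" "Dom C (hom_incl E R) = fst (dual E)"
    "Cod C (hom_incl E R) = Exp C (fst E) (fst R)"
    using E by (simp_all add: dual_def)
  have hi2: "fst (ihom (dual E) R) = fst (dual (dual E))" by (simp add: dual_def)
  have q: "?q \<in> phom (dual E) (fst E) R"
  proof (rule phomI)
    fix e assume e: "e \<in> el (fst E)"
    show "\<exists>f. lin (dual E) R f \<and> (\<forall>p \<in> el (fst (dual E)). ?q \<cdot> \<langle>p, e\<rangle> = f \<cdot> p)"
      by (rule exI, rule conjI, rule ev_hom_incl_lin[OF E R_alg e, folded dual_def]) (use E e hi in auto)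
  qed (use E hi in \<open>auto simp: Hom_iff\<close>)
  have eq: "bidual_unit E = (E, THE d. ?P d, dual (dual E))"
    by (simp add: bidual_unit_def)
  have P: "?P ?d"
    unfolding bidual_map_def eq L_simps(5)
    by (rule theI', rule transpose_ex1[OF _ R_alg _ q, unfolded hi2]) (use E in simp_all)
  show "bidual_unit E = (E, ?d, dual (dual E))" by (simp add: bidual_map_def eq)
  note da = HomD(1-3)[OF conjunct1[OF P]]
  have hd: "arr (hom_incl (dual E) R)" "Dom C (hom_incl (dual E) R) = fst (dual (dual E))"
    "Cod C (hom_incl (dual E) R) = Exp C (fst (dual E)) (fst R)"
    using E hi2 by simp_all
  show ev: "ap (dual E) R p (?d \<cdot> e) = ap E R e p"
    if "e \<in> el (fst E)" "p \<in> el (fst (dual E))" for e p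
  proof -
    have "hom_incl (dual E) R \<cdot> (?d \<cdot> e) = (hom_incl (dual E) R \<cdot> ?d) \<cdot> e"
      using da hd that by simp
    also have "\<dots> = curry_map C (fst (dual E)) (fst E) ?q \<cdot> e" using P by simp
    finally have "ap (dual E) R p (?d \<cdot> e) = ?q \<cdot> \<langle>p, e\<rangle>" using that E hi by simp
    then show ?thesis using that E hi by simp
  qed
  show "lin E (dual (dual E)) ?d"
    unfolding dual_def[of "dual E"]
  proof (rule lin_into_ihom)
    fix p assume p: "p \<in> el (fst (dual E))"
    show "\<exists>f. lin E R f \<and> (\<forall>e \<in> el (fst E). ap (dual E) R p (?d \<cdot> e) = f \<cdot> e)"
      by (rule exI, rule conjI, rule element_lin[OF E R_alg, folded dual_def, OF p])
        (use p E hi ev in auto)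
  qed (use E P hi2 in auto)
qed

text \<open>The extension sends \<open>b\<close> to the evaluation of functionals by its image in \<open>A**\<close>.\<close>

lemma functional_extension:
  assumes h: "lin A B h" and w: "lin B (dual (dual A)) w" and wh: "w \<cdot> h = bidual_map A"
    and Z: "Z \<in> Ob C" and g: "g \<in> phom A Z R"
  shows "\<exists>q \<in> phom B Z R. \<forall>a \<in> el (fst A). \<forall>z \<in> el Z. q \<cdot> \<langle>h \<cdot> a, z\<rangle> = g \<cdot> \<langle>a, z\<rangle>"
proof -
  note ha = linD(1-5)[OF h] and wa = linD(3-5)[OF w]
  note tp = transpose_props[OF ha(1) R_alg Z g, folded dual_def]
  let ?v = "transpose A R Z g" and ?k = "hom_incl (dual A) R"
  have dA: "dual A \<in> Ob L" using ha by simp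
  have ka: "arr ?k" "Dom C ?k = fst (dual (dual A))" "Cod C ?k = Exp C (fst (dual A)) (fst R)"
    using dA by (simp_all add: dual_def[of "dual A"])
  let ?q = "ev (fst (dual A)) (fst R) (?v \<cdot> Snd C (fst B) Z) (?k \<cdot> (w \<cdot> Fst C (fst B) Z))"
  have qb: "?q \<cdot> \<langle>b, z\<rangle> = ap (dual A) R (?v \<cdot> z) (w \<cdot> b)"
    if "b \<in> el (fst B)" "z \<in> el Z" for b z
    using that tp(1-3) wa ka ha(2) Z dA by simp
  have q: "?q \<in> phom B Z R"
  proof (rule phomI)
    fix z assume z: "z \<in> el Z"
    then have vz: "?v \<cdot> z \<in> el (fst (dual A))" using tp(1-3) by simp
    show "\<exists>f. lin B R f \<and> (\<forall>b \<in> el (fst B). ?q \<cdot> \<langle>b, z\<rangle> = f \<cdot> b)"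
      by (rule exI, rule conjI,
          rule lin_comp[OF w ev_hom_incl_lin[OF dA R_alg vz, folded dual_def]])
        (use z vz qb wa ka dA in auto)
  qed (use tp(1-3) wa ka ha(2) Z dA in \<open>auto simp: Hom_iff\<close>)
  have "?q \<cdot> \<langle>h \<cdot> a, z\<rangle> = g \<cdot> \<langle>a, z\<rangle>" if az: "a \<in> el (fst A)" "z \<in> el Z" for a z
  proof -
    have "w \<cdot> (h \<cdot> a) = bidual_map A \<cdot> a"
      using arg_cong[OF wh, of "\<lambda>f. f \<cdot> a"] az ha(3-5) wa by simp
    then have "?q \<cdot> \<langle>h \<cdot> a, z\<rangle> = ap (dual A) R (?v \<cdot> z) (bidual_map A \<cdot> a)"
      using qb[of "h \<cdot> a" z] az ha(3-5) by simp
    also have "\<dots> = ap A R a (?v \<cdot> z)"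
      by (rule bidual_map_props(3)[OF ha(1)]) (use az tp(1-3) in auto)
    also have "\<dots> = g \<cdot> \<langle>a, z\<rangle>" using tp(4)[of z a] az by simp
    finally show ?thesis .
  qed
  then show ?thesis using q by blast
qed

abbreviation dmap :: "('o, 'a) alg \<Rightarrow> 'a \<Rightarrow> ('o, 'a) alg \<Rightarrow> 'a" where
  "dmap A h B \<equiv> imap A h B R"

lemma dual_map_eq: "lin A B h \<Longrightarrow> dual_map (A, h, B) = (dual B, dmap A h B, dual A)"
  by (simp add: dual_map_def imap_props dual_def)

lemma dmap_lin: "lin A B h \<Longrightarrow> lin (dual B) (dual A) (dmap A h B)"
  by (simp add: imap_props dual_def)

lemma ap_dmap: "lin A B h \<Longrightarrow> a \<in> el (fst A) \<Longrightarrow> p \<in> el (fst (dual B)) \<Longrightarrow>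
    ap A R a (dmap A h B \<cdot> p) = ap B R (h \<cdot> a) p"
  using imap_props(3)[of A B h R a p] by (simp add: dual_def)

lemma dual_ext:
  assumes "u \<in> el (fst (dual A))" "v \<in> el (fst (dual A))" "A \<in> Ob L"
    and "\<And>a. a \<in> el (fst A) \<Longrightarrow> ap A R a u = ap A R a v"
  shows "u = v"
  by (rule ihom_element_ext[of _ A R]) (use assms in \<open>auto simp: dual_def\<close>)

text \<open>At a functional \<open>p\<close> on \<open>B\<close> both sides give the value of
  \<open>p\<close> at \<open>h \<cdot> a\<close>; this is naturality of the canonical map.\<close>

lemma ddmap_bidual:
  assumes h: "lin A B h" and a: "a \<in> el (fst A)"
  shows "dmap (dual B) (dmap A h B) (dual A) \<cdot> (bidual_map A \<cdot> a) = bidual_map B \<cdot> (h \<cdot> a)"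
proof (rule dual_ext[of _ "dual B"])
  note ha = linD(1-5)[OF h]
  note hs = dmap_lin[OF h]
  note hss = dmap_lin[OF hs]
  note bA = bidual_map_props(2,3)[OF ha(1)] and bB = bidual_map_props(2,3)[OF ha(2)]
  fix p assume p: "p \<in> el (fst (dual B))"
  have "ap (dual B) R p (dmap (dual B) (dmap A h B) (dual A) \<cdot> (bidual_map A \<cdot> a)) =
      ap (dual A) R (dmap A h B \<cdot> p) (bidual_map A \<cdot> a)"
    by (rule ap_dmap[OF hs p]) (use a linD(3-5)[OF bA(1)] in simp)
  also have "\<dots> = ap A R a (dmap A h B \<cdot> p)"
    by (rule bA(2)[OF a]) (use p linD(3-5)[OF hs] in simp)
  also have "\<dots> = ap B R (h \<cdot> a) p"
    by (rule ap_dmap[OF h a p])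
  also have "\<dots> = ap (dual B) R p (bidual_map B \<cdot> (h \<cdot> a))"
    by (rule bB(2)[symmetric]) (use a p ha in auto)
  finally show "ap (dual B) R p (dmap (dual B) (dmap A h B) (dual A) \<cdot> (bidual_map A \<cdot> a)) =
      ap (dual B) R p (bidual_map B \<cdot> (h \<cdot> a))" .
qed (use linD(3-5)[OF bidual_map_props(2)[OF linD(1)[OF h]]] linD(2-5)[OF h] a
      linD(3-5)[OF bidual_map_props(2)[OF linD(2)[OF h]]] linD(3-5)[OF dmap_lin[OF dmap_lin[OF h]]] in auto)

section \<open>Functionally complete objects and their closure properties\<close>

definition sigma :: "('o, 'a) alg \<Rightarrow> 'a \<Rightarrow> ('o, 'a) alg \<Rightarrow> bool" where
  "sigma A h B \<longleftrightarrow> lin A B h \<and> iso L (dual_map (dual_map (A, h, B)))"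

lemma functionally_complete_iff:
  "functionally_complete M \<longleftrightarrow> M \<in> Ob L \<and> (\<forall>A h B. sigma A h B \<longrightarrow> orth A h B M)"
proof
  assume fc: "functionally_complete M"
  then have M: "M \<in> Ob L" by (simp add: functionally_complete_def)
  moreover have "orth A h B M" if s: "sigma A h B" for A h B
  proof -
    have h: "lin A B h" and i: "iso L (dual_map (dual_map (A, h, B)))" using s by (auto simp: sigma_def)
    then have "iso L (ihom_map (A, h, B) M)"
      using fc Arr_L_iff unfolding functionally_complete_def by blast
    then show ?thesis using iso_ihom_map_iff[OF h M] by simp
  qed
  ultimately show "M \<in> Ob L \<and> (\<forall>A h B. sigma A h B \<longrightarrow> orth A h B M)" by blast
next
  assume r: "M \<in> Ob L \<and> (\<forall>A h B. sigma A h B \<longrightarrow> orth A h B M)"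
  show "functionally_complete M"
    unfolding functionally_complete_def
  proof (intro conjI ballI impI)
    fix h assume "h \<in> Arr L" and i: "iso L (dual_map (dual_map h))"
    then obtain A f B where h: "h = (A, f, B)" "lin A B f" by (elim L_arrE)
    then have "sigma A f B" using i by (simp add: sigma_def)
    then have "orth A f B M" using r by blast
    then show "iso L (ihom_map h M)" using iso_ihom_map_iff[OF h(2)] r h(1) by simp
  qed (use r in simp)
qed

lemma fcD: "functionally_complete M \<Longrightarrow> M \<in> Ob L"
  "functionally_complete M \<Longrightarrow> sigma A h B \<Longrightarrow> orth A h B M"
  unfolding functionally_complete_iff by blast+

text \<open>The inverse of \<open>h**\<close>, after the canonical map of \<open>B\<close>, is a
  homomorphism from \<open>B\<close> to \<open>A**\<close> that extends the canonical map of
  \<open>A\<close>; functionals with parameter extend along \<open>h\<close> by means of it.\<close>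

lemma fc_R: "functionally_complete R"
  unfolding functionally_complete_iff
proof (intro conjI allI impI R_alg)
  fix A h B assume s: "sigma A h B"
  then have h: "lin A B h" and i: "iso L (dual_map (dual_map (A, h, B)))" by (auto simp: sigma_def)
  note ha = linD(1-5)[OF h]
  note hs = dmap_lin[OF h]
  note hss = dmap_lin[OF hs]
  let ?hs = "dmap A h B"
  let ?hss = "dmap (dual B) ?hs (dual A)"
  note bA = bidual_map_props(2,3)[OF ha(1)] and bB = bidual_map_props(2,3)[OF ha(2)]
  have "iso C ?hss" using i iso_L_iff[OF hss] by (simp add: dual_map_eq[OF h] dual_map_eq[OF hs])
  then obtain j where j: "arr j" "Dom C j = fst (dual (dual B))" "Cod C j = fst (dual (dual A))"
    "j \<cdot> ?hss = Id C (fst (dual (dual A)))" "?hss \<cdot> j = Id C (fst (dual (dual B)))"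
    using linD(3-5)[OF hss] by (auto elim!: iso_inverse)
  have jl: "lin (dual (dual B)) (dual (dual A)) j" by (rule lin_inverse[OF hss j])
  have w: "lin B (dual (dual A)) (j \<cdot> bidual_map B)" by (rule lin_comp[OF bB(1) jl])
  have wh: "(j \<cdot> bidual_map B) \<cdot> h = bidual_map A"
  proof (rule map_eqI[of _ "fst A" "fst (dual (dual A))"])
    fix a assume a: "a \<in> el (fst A)"
    have "j \<cdot> (bidual_map B \<cdot> (h \<cdot> a)) = (j \<cdot> ?hss) \<cdot> (bidual_map A \<cdot> a)"
      unfolding ddmap_bidual[OF h a, symmetric] using a j(1-3) linD(3-5)[OF hss] linD(3-5)[OF bA(1)] by simp
    then show "((j \<cdot> bidual_map B) \<cdot> h) \<cdot> a = bidual_map A \<cdot> a"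
      unfolding j(4) using a j(1-3) linD(3-5)[OF bA(1)] linD(3-5)[OF bB(1)] ha by simp
  qed (use j(1-3) linD(3-5)[OF bA(1)] linD(3-5)[OF bB(1)] ha in \<open>auto simp: Hom_iff\<close>)
  show "orth A h B R"
  proof (rule orthI[OF h functional_extension[OF h w wh]])
    fix f f' assume f: "lin B R f" "lin B R f'"
      and e: "\<And>a. a \<in> el (fst A) \<Longrightarrow> f \<cdot> (h \<cdot> a) = f' \<cdot> (h \<cdot> a)"
    note c = code_props[OF f(1), folded dual_def] and c' = code_props[OF f(2), folded dual_def]
    note hsa = linD(3-5)[OF hs]
    have hp: "?hs \<cdot> code B R f = ?hs \<cdot> code B R f'"
    proof (rule dual_ext[of _ A])
      fix a assume a: "a \<in> el (fst A)"
      show "ap A R a (?hs \<cdot> code B R f) = ap A R a (?hs \<cdot> code B R f')"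
        using ap_dmap[OF h a, of "code B R f"] ap_dmap[OF h a, of "code B R f'"] c(1-3) c'(1-3)
          c(5)[of "h \<cdot> a"] c'(5)[of "h \<cdot> a"] e[OF a] a ha(3-5) by simp
    qed (use c(1-3) c'(1-3) hsa ha(1) in auto)
    \<comment> \<open>A functional \<open>g\<close> on \<open>B\<close> is recovered from its
      restriction to \<open>A\<close>: evaluate that restriction at the preimage of \<open>b\<close>
      under \<open>h**\<close>. This gives uniqueness of extensions.\<close>
    have F: "g \<cdot> b = ap (dual A) R (?hs \<cdot> code B R g) (j \<cdot> (bidual_map B \<cdot> b))"
      if g: "lin B R g" and b: "b \<in> el (fst B)" for g b
    proof -
      note cg = code_props[OF g, folded dual_def]
      let ?y = "j \<cdot> (bidual_map B \<cdot> b)"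
      have y: "?y \<in> el (fst (dual (dual A)))" "code B R g \<in> el (fst (dual B))"
        using b j(1-3) linD(3-5)[OF bB(1)] cg(1-3) by auto
      have "?hss \<cdot> ?y = (?hss \<cdot> j) \<cdot> (bidual_map B \<cdot> b)"
        using b j(1-3) linD(3-5)[OF bB(1)] linD(3-5)[OF hss] by simp
      then have hy: "?hss \<cdot> ?y = bidual_map B \<cdot> b"
        unfolding j(5) using b linD(3-5)[OF bB(1)] ha(2) by simp
      have "g \<cdot> b = ap B R b (code B R g)" using cg(5)[of b] b by simp
      also have "\<dots> = ap (dual B) R (code B R g) (?hss \<cdot> ?y)"
        unfolding hy by (rule bB(2)[symmetric, OF b y(2)])
      also have "\<dots> = ap (dual A) R (?hs \<cdot> code B R g) ?y"
        by (rule ap_dmap[OF hs y(2,1)])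
      finally show ?thesis .
    qed
    show "f = f'"
      by (rule map_eqI[of _ "fst B" "fst R"])
        (use F[OF f(1)] F[OF f(2)] hp linD(3-5)[OF f(1)] linD(3-5)[OF f(2)] in \<open>simp_all add: Hom_iff\<close>)
  qed
qed

text \<open>The variable of the cotensor moves into the parameter: a map into
  \<open>cotensor X M\<close> with parameter in \<open>Z\<close> is a map into \<open>M\<close> with
  parameter in \<open>X \<times> Z\<close>. This is possible because \<open>orth\<close> ranges over
  all parameter objects.\<close>

lemma orth_cotensor:
  assumes h: "lin A B h" and M: "M \<in> Ob L" and o: "orth A h B M" and X: "X \<in> Ob C"
  shows "orth A h B (cotensor X M)"
proof (rule orthI[OF h])
  note ha = linD(1-5)[OF h]
  fix Z g assume Z: "Z \<in> Ob C" and g: "g \<in> phom A Z (cotensor X M)"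
  have ga: "arr g" "Dom C g = fst A \<^bold>\<times> Z" "Cod C g = Exp C X (fst M)"
    using phomD(1-3)[OF g] by simp_all
  let ?W = "X \<^bold>\<times> Z"
  let ?pa = "Fst C (fst A) ?W" and ?px = "Fst C X Z \<cdot> Snd C (fst A) ?W" and ?pz = "Snd C X Z \<cdot> Snd C (fst A) ?W"
  let ?g1 = "ev X (fst M) ?px (g \<cdot> \<langle>?pa, ?pz\<rangle>)"
  have g1: "?g1 \<in> phom A ?W M"
  proof (rule phomI)
    fix w assume w: "w \<in> el ?W"
    have x: "Fst C X Z \<cdot> w \<in> el X" and z: "Snd C X Z \<cdot> w \<in> el Z"
      using w X Z by auto
    show "\<exists>f. lin A M f \<and> (\<forall>a \<in> el (fst A). ?g1 \<cdot> \<langle>a, w\<rangle> = f \<cdot> a)"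
    proof (rule exI, rule conjI, rule lin_comp[OF phomD(4)[OF g z] evx_lin[OF X M x]], rule ballI)
      fix a assume a: "a \<in> el (fst A)"
      show "?g1 \<cdot> \<langle>a, w\<rangle> =
        (evx X (fst M) (Fst C X Z \<cdot> w) \<cdot> (g \<cdot> \<langle>Id C (fst A), (Snd C X Z \<cdot> w) \<cdot> bang (fst A)\<rangle>)) \<cdot> a"
        using a w ga X Z M ha(1) by simp
    qed
  qed (use ga X Z M ha(1) in \<open>auto simp: Hom_iff\<close>)
  obtain q1 where q1: "q1 \<in> phom B ?W M"
    "\<And>a w. a \<in> el (fst A) \<Longrightarrow> w \<in> el ?W \<Longrightarrow> q1 \<cdot> \<langle>h \<cdot> a, w\<rangle> = ?g1 \<cdot> \<langle>a, w\<rangle>"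
    using orth_extend[OF o h _ g1] X Z by auto
  note q1a = phomD(1-3)[OF q1(1)]
  let ?V = "fst B \<^bold>\<times> Z"
  let ?r = "q1 \<cdot> \<langle>Fst C (fst B) Z \<cdot> Snd C X ?V, \<langle>Fst C X ?V, Snd C (fst B) Z \<cdot> Snd C X ?V\<rangle>\<rangle>"
  define qc where "qc = curry_map C X ?V ?r"
  have ra: "arr ?r" "Dom C ?r = X \<^bold>\<times> ?V" "Cod C ?r = fst M"
    using q1a X Z ha(2) by simp_all
  have qa: "arr qc" "Dom C qc = ?V" "Cod C qc = Exp C X (fst M)"
    unfolding qc_def using ra X Z ha(2) by simp_all
  have ev: "ev X (fst M) x (qc \<cdot> \<langle>b, z\<rangle>) = q1 \<cdot> \<langle>b, \<langle>x, z\<rangle>\<rangle>"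
    if "x \<in> el X" "b \<in> el (fst B)" "z \<in> el Z" for x b z
    unfolding qc_def using that q1a X Z ha(2) by simp
  have q: "qc \<in> phom B Z (cotensor X M)"
    unfolding phom_def
  proof (intro CollectI conjI ballI)
    fix z assume z: "z \<in> el Z"
    let ?s = "qc \<cdot> \<langle>Id C (fst B), z \<cdot> bang (fst B)\<rangle>"
    show "lin B (cotensor X M) ?s"
    proof (rule lin_into_cotensor)
      fix x assume x: "x \<in> el X"
      have xz: "\<langle>x, z\<rangle> \<in> el ?W" using x z by simp
      have "evx X (fst M) x \<cdot> ?s = q1 \<cdot> \<langle>Id C (fst B), \<langle>x, z\<rangle> \<cdot> bang (fst B)\<rangle>"
      proof (rule map_eqI[of _ "fst B" "fst M"])
        fix b assume b: "b \<in> el (fst B)"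
        have "(evx X (fst M) x \<cdot> ?s) \<cdot> b = ev X (fst M) x (qc \<cdot> \<langle>b, z\<rangle>)"
          using x b z qa X Z M ha(2) by simp
        also have "\<dots> = (q1 \<cdot> \<langle>Id C (fst B), \<langle>x, z\<rangle> \<cdot> bang (fst B)\<rangle>) \<cdot> b"
          unfolding ev[OF x b z] using x b z q1a X Z ha(2) by simp
        finally show "(evx X (fst M) x \<cdot> ?s) \<cdot> b = (q1 \<cdot> \<langle>Id C (fst B), \<langle>x, z\<rangle> \<cdot> bang (fst B)\<rangle>) \<cdot> b" .
      qed (use x z qa q1a X Z M ha(2) in \<open>auto simp: Hom_iff\<close>)
      then show "lin B M (evx X (fst M) x \<cdot> ?s)" using phomD(4)[OF q1(1) xz] by simp
    qed (use z qa X Z M ha(2) in \<open>auto simp: Hom_iff\<close>)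
  qed (use qa in \<open>auto simp: Hom_iff\<close>)
  have "qc \<cdot> \<langle>h \<cdot> a, z\<rangle> = g \<cdot> \<langle>a, z\<rangle>" if az: "a \<in> el (fst A)" "z \<in> el Z" for a z
  proof (rule exp_element_eqI[of _ X "fst M"])
    fix x assume x: "x \<in> el X"
    have "ev X (fst M) x (qc \<cdot> \<langle>h \<cdot> a, z\<rangle>) = q1 \<cdot> \<langle>h \<cdot> a, \<langle>x, z\<rangle>\<rangle>"
      by (rule ev[OF x]) (use az ha in auto)
    also have "\<dots> = ?g1 \<cdot> \<langle>a, \<langle>x, z\<rangle>\<rangle>" by (rule q1(2)) (use az x in auto)
    also have "\<dots> = ev X (fst M) x (g \<cdot> \<langle>a, z\<rangle>)" using az x ga X Z M ha(1) by simp
    finally show "ev X (fst M) x (qc \<cdot> \<langle>h \<cdot> a, z\<rangle>) = ev X (fst M) x (g \<cdot> \<langle>a, z\<rangle>)" .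
  qed (use az qa ga ha X M in auto)
  then show "\<exists>q \<in> phom B Z (cotensor X M).
      \<forall>a \<in> el (fst A). \<forall>z \<in> el Z. q \<cdot> \<langle>h \<cdot> a, z\<rangle> = g \<cdot> \<langle>a, z\<rangle>"
    using q by blast
next
  note ha = linD(1-5)[OF h]
  fix f f' assume f: "lin B (cotensor X M) f" "lin B (cotensor X M) f'"
    and e: "\<And>a. a \<in> el (fst A) \<Longrightarrow> f \<cdot> (h \<cdot> a) = f' \<cdot> (h \<cdot> a)"
  have fa: "arr f" "Dom C f = fst B" "Cod C f = Exp C X (fst M)" "arr f'" "Dom C f' = fst B"
    "Cod C f' = Exp C X (fst M)"
    using linD(3-5)[OF f(1)] linD(3-5)[OF f(2)] by simp_all
  show "f = f'"
  proof (rule evx_eqI[of _ "fst B" X "fst M"])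
    fix x assume x: "x \<in> el X"
    note l = lin_comp[OF f(1) evx_lin[OF X M x]] and l' = lin_comp[OF f(2) evx_lin[OF X M x]]
    show "evx X (fst M) x \<cdot> f = evx X (fst M) x \<cdot> f'"
    proof (rule orth_lin_unique[OF o h l l'])
      fix a assume a: "a \<in> el (fst A)"
      show "(evx X (fst M) x \<cdot> f) \<cdot> (h \<cdot> a) = (evx X (fst M) x \<cdot> f') \<cdot> (h \<cdot> a)"
        using arg_cong[OF e[OF a], of "\<lambda>u. evx X (fst M) x \<cdot> u"] a x fa ha(3-5) X M by simp
    qed
  qed (use fa X M in \<open>auto simp: Hom_iff\<close>)
qed

lemma fc_cotensor:
  assumes M: "functionally_complete M" and X: "X \<in> Ob C"
  shows "functionally_complete (cotensor X M)"
  unfolding functionally_complete_iff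
proof (intro conjI allI impI cotensor_alg[OF X fcD(1)[OF M]])
  fix A h B assume s: "sigma A h B"
  then have "lin A B h" by (simp add: sigma_def)
  then show "orth A h B (cotensor X M)" by (rule orth_cotensor[OF _ fcD(1)[OF M] fcD(2)[OF M s] X])
qed

text \<open>Completeness of \<open>E\<close> provides the extension with values in \<open>E\<close>
  and its uniqueness. The premise \<open>fac\<close> isolates the rest, namely that the extension
  lands in the subobject; equalizers and intersections each supply it in their own way.\<close>

lemma fc_sub:
  assumes E: "functionally_complete E" and p: "lin P E p" "monic C p"
    and fac: "\<And>A h B Z q r. sigma A h B \<Longrightarrow> Z \<in> Ob C \<Longrightarrow> q \<in> phom B Z E \<Longrightarrow> r \<in> phom A Z P \<Longrightarrow>
      (\<And>a z. a \<in> el (fst A) \<Longrightarrow> z \<in> el Z \<Longrightarrow> q \<cdot> \<langle>h \<cdot> a, z\<rangle> = p \<cdot> (r \<cdot> \<langle>a, z\<rangle>)) \<Longrightarrow>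
      \<exists>q' \<in> Hom C (fst B \<^bold>\<times> Z) (fst P). p \<cdot> q' = q"
  shows "functionally_complete P"
  unfolding functionally_complete_iff
proof (intro conjI allI impI)
  note pa = linD(3-5)[OF p(1)]
  show "P \<in> Ob L" using linD(1)[OF p(1)] .
  fix A h B assume s: "sigma A h B"
  then have h: "lin A B h" by (simp add: sigma_def)
  note ha = linD(1-5)[OF h]
  note o = fcD(2)[OF E s]
  show "orth A h B P"
  proof (rule orthI[OF h])
    fix Z g assume Z: "Z \<in> Ob C" and g: "g \<in> phom A Z P"
    note ga = phomD(1-3)[OF g]
    obtain q where q: "q \<in> phom B Z E"
      "\<And>a z. a \<in> el (fst A) \<Longrightarrow> z \<in> el Z \<Longrightarrow> q \<cdot> \<langle>h \<cdot> a, z\<rangle> = (p \<cdot> g) \<cdot> \<langle>a, z\<rangle>"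
      using orth_extend[OF o h Z phom_comp[OF g p(1) ha(1) Z]] by blast
    have qg: "q \<cdot> \<langle>h \<cdot> a, z\<rangle> = p \<cdot> (g \<cdot> \<langle>a, z\<rangle>)" if "a \<in> el (fst A)" "z \<in> el Z" for a z
      using q(2)[OF that] that pa ga by simp
    obtain q' where q': "q' \<in> Hom C (fst B \<^bold>\<times> Z) (fst P)" "p \<cdot> q' = q"
      using fac[OF s Z q(1) g qg] by blast
    note q'a = HomD(1-3)[OF q'(1)]
    have "q' \<cdot> \<langle>h \<cdot> a, z\<rangle> = g \<cdot> \<langle>a, z\<rangle>" if az: "a \<in> el (fst A)" "z \<in> el Z" for a z
    proof (rule monicD[OF p(2)])
      show "p \<cdot> (q' \<cdot> \<langle>h \<cdot> a, z\<rangle>) = p \<cdot> (g \<cdot> \<langle>a, z\<rangle>)"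
        unfolding qg[OF az, symmetric] q'(2)[symmetric] using az pa q'a ha(3-5) by simp
    qed (use az pa q'a ga ha(3-5) in auto)
    moreover have "q' \<in> phom B Z P"
      by (rule phom_factor[OF q'(1) p _ ha(2) Z]) (use q' q in simp)
    ultimately show "\<exists>q \<in> phom B Z P.
        \<forall>a \<in> el (fst A). \<forall>z \<in> el Z. q \<cdot> \<langle>h \<cdot> a, z\<rangle> = g \<cdot> \<langle>a, z\<rangle>" by blast
  next
    fix f f' assume f: "lin B P f" "lin B P f'"
      and e: "\<And>a. a \<in> el (fst A) \<Longrightarrow> f \<cdot> (h \<cdot> a) = f' \<cdot> (h \<cdot> a)"
    note fa = linD(3-5)[OF f(1)] linD(3-5)[OF f(2)]
    have "p \<cdot> f = p \<cdot> f'"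
    proof (rule orth_lin_unique[OF o h lin_comp[OF f(1) p(1)] lin_comp[OF f(2) p(1)]])
      fix a assume a: "a \<in> el (fst A)"
      show "(p \<cdot> f) \<cdot> (h \<cdot> a) = (p \<cdot> f') \<cdot> (h \<cdot> a)"
        using arg_cong[OF e[OF a], of "\<lambda>u. p \<cdot> u"] a fa ha(3-5) pa by simp
    qed
    then show "f = f'" using monicD[OF p(2), of f f'] fa pa by simp
  qed
qed

text \<open>The composites of the extension with \<open>u\<close> and \<open>v\<close> agree along
  \<open>h\<close>, hence agree by uniqueness of extensions into the complete object
  \<open>B\<close>.\<close>

lemma fc_equalizer:
  assumes u: "lin A B u" and v: "lin A B v" and A: "functionally_complete A" and B: "functionally_complete B"
    and k: "is_equalizer C u v k" and P: "lin P A k"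
  shows "functionally_complete P"
proof -
  note ua = linD(3-5)[OF u] and va = linD(3-5)[OF v] and ka = linD(3-5)[OF P]
  have uk: "u \<cdot> k = v \<cdot> k" using k by (simp add: is_equalizer_def)
  have mk: "monic C k" using equalizer_monic[OF k] ua va by simp
  show ?thesis
  proof (rule fc_sub[OF A P mk])
    fix A' h B' Z q r assume s: "sigma A' h B'" and Z: "Z \<in> Ob C" and q: "q \<in> phom B' Z A"
      and r: "r \<in> phom A' Z P"
      and e: "\<And>a z. a \<in> el (fst A') \<Longrightarrow> z \<in> el Z \<Longrightarrow> q \<cdot> \<langle>h \<cdot> a, z\<rangle> = k \<cdot> (r \<cdot> \<langle>a, z\<rangle>)"
    have h: "lin A' B' h" using s by (simp add: sigma_def)
    note ha = linD(1-5)[OF h] and qa = phomD(1-3)[OF q] and ra = phomD(1-3)[OF r]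
    have "u \<cdot> q = v \<cdot> q"
    proof (rule orth_unique[OF fcD(2)[OF B s] h Z phom_comp[OF q u ha(2) Z] phom_comp[OF q v ha(2) Z]])
      fix a z assume az: "a \<in> el (fst A')" "z \<in> el Z"
      have "u \<cdot> (q \<cdot> \<langle>h \<cdot> a, z\<rangle>) = (u \<cdot> k) \<cdot> (r \<cdot> \<langle>a, z\<rangle>)"
        unfolding e[OF az] using ua ka ra az by simp
      also have "\<dots> = v \<cdot> (q \<cdot> \<langle>h \<cdot> a, z\<rangle>)"
        unfolding e[OF az] uk using va ka ra az by simp
      finally show "(u \<cdot> q) \<cdot> \<langle>h \<cdot> a, z\<rangle> = (v \<cdot> q) \<cdot> \<langle>h \<cdot> a, z\<rangle>"
        using ua va qa az ha(3-5) by simp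
    qed
    then show "\<exists>q' \<in> Hom C (fst B' \<^bold>\<times> Z) (fst P). k \<cdot> q' = q"
      using ex1_implies_ex[OF equalizer_universal[OF k, of q "fst B' \<^bold>\<times> Z"]] qa ua ka by (auto simp: Hom_iff)
  qed
qed

text \<open>A dual is an equalizer of homomorphisms between cotensors of \<open>R\<close>, and these
  are complete.\<close>

lemma fc_dual:
  assumes D: "D \<in> Ob L"
  shows "functionally_complete (dual D)"
proof -
  have pl: "lin (cotensor (fst D) R) (cotensor (TO T (fst D)) R) (exp_pre C (snd D) (fst R))"
    by (rule exp_pre_lin) (use D in \<open>auto simp: Hom_iff\<close>)
  show ?thesis
    unfolding dual_def
    by (rule fc_equalizer[OF extend_lin[OF D R_alg] pl _ _ hom_incl_equalizer[OF D R_alg] hom_incl_props(4)[OF D R_alg]])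
      (use D fc_cotensor[OF fc_R] in auto)
qed

section \<open>The reflection onto functionally complete objects\<close>

lemma is_fc_reflection_iff:
  "is_fc_reflection E h \<longleftrightarrow> (\<exists>P d. h = (E, d, P) \<and> lin E P d \<and> functionally_complete P \<and>
    (\<forall>B. functionally_complete B \<longrightarrow> orth E d P B))" (is "?l \<longleftrightarrow> ?r")
proof
  assume l: ?l
  then have "h \<in> Hom L E (Cod L h)" by (simp add: is_fc_reflection_def)
  then obtain d where d: "h = (E, d, Cod L h)" "lin E (Cod L h) d" unfolding Hom_L_iff by blast
  have "orth E d (Cod L h) B" if B: "functionally_complete B" for B
  proof -
    have "iso L (ihom_map (E, d, Cod L h) B)" using l B d(1) unfolding is_fc_reflection_def by metis
    then show ?thesis using iso_ihom_map_iff[OF d(2) fcD(1)[OF B]] by simp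
  qed
  then show ?r using d l unfolding is_fc_reflection_def by blast
next
  assume ?r
  then obtain P d where h: "h = (E, d, P)" and d: "lin E P d" and P: "functionally_complete P"
    and o: "\<And>B. functionally_complete B \<Longrightarrow> orth E d P B" by blast
  show ?l unfolding is_fc_reflection_def h
    using d P o iso_ihom_map_iff[OF d] fcD(1) by (auto simp: Hom_L_iff)
qed

text \<open>Orthogonality to \<open>R\<close> says that \<open>h*\<close> is invertible, and then so
  is restriction along \<open>h*\<close>, which is \<open>h**\<close>. Together with
  \<open>fcD\<close> this propagates orthogonality from \<open>R\<close> to every functionally
  complete object.\<close>

lemma sigmaI:
  assumes h: "lin A B h" and o: "orth A h B R"
  shows "sigma A h B"
proof -
  note hs = dmap_lin[OF h]
  have "iso L (dual_map (A, h, B))"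
    unfolding dual_map_def using iso_ihom_map_iff[OF h R_alg] o by simp
  then have "iso C (dmap A h B)" unfolding dual_map_eq[OF h] using iso_L_iff[OF hs] by simp
  then obtain j where j: "arr j" "Dom C j = fst (dual A)" "Cod C j = fst (dual B)"
    "j \<cdot> dmap A h B = Id C (fst (dual B))" "dmap A h B \<cdot> j = Id C (fst (dual A))"
    using linD(3-5)[OF hs] by (auto elim!: iso_inverse)
  note hsa = linD(1-5)[OF hs]
  have jl: "lin (dual A) (dual B) j" by (rule lin_inverse[OF hs j])
  have hj: "dmap A h B \<cdot> (j \<cdot> a) = a" if "a \<in> el (fst (dual A))" for a
    using arg_cong[OF j(5), of "\<lambda>u. u \<cdot> a"] that j(1-3) hsa by simp
  have jh: "j \<cdot> (dmap A h B \<cdot> a) = a" if "a \<in> el (fst (dual B))" for a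
    using arg_cong[OF j(4), of "\<lambda>u. u \<cdot> a"] that j(1-3) hsa by simp
  have "orth (dual B) (dmap A h B) (dual A) R"
  proof (rule orthI[OF hs])
    fix Z g assume Z: "Z \<in> Ob C" and g: "g \<in> phom (dual B) Z R"
    note ga = phomD(1-3)[OF g]
    let ?q = "g \<cdot> \<langle>j \<cdot> Fst C (fst (dual A)) Z, Snd C (fst (dual A)) Z\<rangle>"
    have q: "?q \<in> phom (dual A) Z R"
    proof (rule phomI)
      fix z assume z: "z \<in> el Z"
      show "\<exists>f. lin (dual A) R f \<and> (\<forall>a \<in> el (fst (dual A)). ?q \<cdot> \<langle>a, z\<rangle> = f \<cdot> a)"
        by (rule exI, rule conjI, rule lin_comp[OF jl phomD(4)[OF g z]]) (use z Z j(1-3) hsa(1,2) ga in auto)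
    qed (use Z j(1-3) hsa(2) ga in \<open>auto simp: Hom_iff\<close>)
    have "?q \<cdot> \<langle>dmap A h B \<cdot> a, z\<rangle> = g \<cdot> \<langle>a, z\<rangle>"
      if "a \<in> el (fst (dual B))" "z \<in> el Z" for a z
      using jh[OF that(1)] that Z j(1-3) hsa(2-5) ga by simp
    then show "\<exists>q \<in> phom (dual A) Z R. \<forall>a \<in> el (fst (dual B)). \<forall>z \<in> el Z.
        q \<cdot> \<langle>dmap A h B \<cdot> a, z\<rangle> = g \<cdot> \<langle>a, z\<rangle>" using q by blast
  next
    fix f f' assume f: "lin (dual A) R f" "lin (dual A) R f'"
      and e: "\<And>a. a \<in> el (fst (dual B)) \<Longrightarrow> f \<cdot> (dmap A h B \<cdot> a) = f' \<cdot> (dmap A h B \<cdot> a)"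
    show "f = f'"
    proof (rule map_eqI[of _ "fst (dual A)" "fst R"])
      fix a assume a: "a \<in> el (fst (dual A))"
      show "f \<cdot> a = f' \<cdot> a" using e[of "j \<cdot> a"] hj[OF a] a j(1-3) by simp
    qed (use linD(3-5)[OF f(1)] linD(3-5)[OF f(2)] in \<open>auto simp: Hom_iff\<close>)
  qed
  then have "iso L (dual_map (dual_map (A, h, B)))"
    unfolding dual_map_eq[OF h] unfolding dual_map_def using iso_ihom_map_iff[OF hs R_alg] by simp
  then show ?thesis using h by (simp add: sigma_def)
qed

text \<open>The reflection is the smallest functionally complete strong subalgebra of \<open>E**\<close> that contains
  the image of \<open>E\<close>. Two functionals on it that agree on \<open>E\<close> are equal, because their equalizer
  is again such a subalgebra.\<close>

lemma fc_reflection_exists: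
  assumes E: "E \<in> Ob L"
  shows "\<exists>P d i. is_fc_reflection E (E, d, P) \<and> lin P (dual (dual E)) i \<and> i \<cdot> d = bidual_map E"
proof -
  let ?D = "dual (dual E)" and ?b = "bidual_map E"
  have D: "?D \<in> Ob L" and fD: "functionally_complete ?D" using E fc_dual by simp_all
  note bl = bidual_map_props(2)[OF E]
  note ba = linD(3-5)[OF bl]
  define S where "S = {m. strong_monic C m \<and> (\<exists>M w. functionally_complete M \<and> lin M ?D m \<and>
    lin E M w \<and> m \<cdot> w = ?b)}"
  have Sb: "\<forall>m \<in> S. strong_monic C m \<and> Cod C m = fst ?D"
    using linD(5) unfolding S_def by blast
  then have S: "strong_monic C m \<and> Cod C m = fst ?D" if "m \<in> S" for m using that by blast
  have int: "has_strong_intersections C"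
    using finitely_well_complete by (simp add: finitely_well_complete_def)
  from strong_intersection[OF int alg_arr(1)[OF D] Sb] obtain P p where
    p': "p \<in> Hom C P (fst ?D)" "\<forall>m \<in> S. \<exists>l \<in> Hom C P (Dom C m). m \<cdot> l = p" "strong_monic C p"
    "\<forall>Q q. q \<in> Hom C Q (fst ?D) \<longrightarrow> (\<forall>m \<in> S. \<exists>k \<in> Hom C Q (Dom C m). m \<cdot> k = q) \<longrightarrow>
      (\<exists>u \<in> Hom C Q P. p \<cdot> u = q)"
    by (elim exE conjE)
  note p = p'(1) p'(2)[rule_format] p'(3) p'(4)[rule_format]
  have mp: "monic C p" using p(3) by (simp add: strong_monic_def)
  note pa = HomD(1-3)[OF p(1)]
  have Po: "P \<in> Ob C" using HomD(4)[OF p(1)] .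
  \<comment> \<open>The operations of the bidual, restricted along \<open>p\<close>, land in every
    member of \<open>S\<close> and therefore in \<open>P\<close>.\<close>
  have "snd ?D \<cdot> TA T p \<in> Hom C (TO T P) (fst ?D)" using pa D by (simp add: Hom_iff)
  moreover have "\<exists>k \<in> Hom C (TO T P) (Dom C m). m \<cdot> k = snd ?D \<cdot> TA T p" if m: "m \<in> S" for m
  proof -
    obtain M where M: "lin M ?D m" using m unfolding S_def by blast
    note Ma = linD(1-5)[OF M]
    obtain l where l: "l \<in> Hom C P (Dom C m)" "m \<cdot> l = p" using p(2)[OF m] by blast
    note la = HomD(1-3)[OF l(1)]
    have "m \<cdot> (snd M \<cdot> TA T l) = snd ?D \<cdot> (TA T m \<cdot> TA T l)"
      using lin_apply[OF M, of "TA T l"] la Ma by simp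
    also have "\<dots> = snd ?D \<cdot> TA T p" unfolding l(2)[symmetric] using la Ma by simp
    finally show ?thesis using la Ma by (intro bexI[of _ "snd M \<cdot> TA T l"]) (simp_all add: Hom_iff)
  qed
  ultimately obtain e where e: "e \<in> Hom C (TO T P) P" "p \<cdot> e = snd ?D \<cdot> TA T p"
    using p(4) by meson
  let ?P = "(P, e)"
  have Pl: "?P \<in> Ob L" "lin ?P ?D p" using sub_alg[OF mp pa(2,3) D e] by blast+
  have fP: "functionally_complete ?P"
  proof (rule fc_sub[OF fD Pl(2) mp])
    fix A h B Z q r assume s: "sigma A h B" and Z: "Z \<in> Ob C" and q: "q \<in> phom B Z ?D"
      and r: "r \<in> phom A Z ?P"
      and qr: "\<And>a z. a \<in> el (fst A) \<Longrightarrow> z \<in> el Z \<Longrightarrow> q \<cdot> \<langle>h \<cdot> a, z\<rangle> = p \<cdot> (r \<cdot> \<langle>a, z\<rangle>)"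
    have h: "lin A B h" using s by (simp add: sigma_def)
    note ha = linD(1-5)[OF h] and qa = phomD(1-3)[OF q]
    have ra: "arr r" "Dom C r = fst A \<^bold>\<times> Z" "Cod C r = P" using phomD(1-3)[OF r] by simp_all
    \<comment> \<open>The extension exists inside each member \<open>M\<close>. By uniqueness in the
      bidual it is \<open>q\<close> after inclusion, so \<open>q\<close> factors through all members
      and hence through their intersection.\<close>
    have "\<exists>k \<in> Hom C (fst B \<^bold>\<times> Z) (Dom C m). m \<cdot> k = q" if m: "m \<in> S" for m
    proof -
      obtain M where M: "functionally_complete M" "lin M ?D m" using m unfolding S_def by blast
      note Ma = linD(1,3-5)[OF M(2)]
      obtain l where l: "l \<in> Hom C P (Dom C m)" "m \<cdot> l = p" using p(2)[OF m] by blast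
      note la = HomD(1-3)[OF l(1)]
      have mm: "monic C m" using S[OF m] by (simp add: strong_monic_def)
      have ll: "lin ?P M l"
        by (rule lin_factor[OF M(2) mm Pl(2) _ l(2)]) (use l Ma in simp)
      note o = orth_extend[OF fcD(2)[OF M(1) s] h Z phom_comp[OF r ll ha(1) Z]]
      obtain k where k: "k \<in> phom B Z M"
        "\<And>a z. a \<in> el (fst A) \<Longrightarrow> z \<in> el Z \<Longrightarrow> k \<cdot> \<langle>h \<cdot> a, z\<rangle> = (l \<cdot> r) \<cdot> \<langle>a, z\<rangle>"
        using o by blast
      note ka = phomD(1-3)[OF k(1)]
      have "m \<cdot> k = q"
      proof (rule orth_unique[OF fcD(2)[OF fD s] h Z phom_comp[OF k(1) M(2) ha(2) Z] q])
        fix a z assume az: "a \<in> el (fst A)" "z \<in> el Z"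
        have "(m \<cdot> k) \<cdot> \<langle>h \<cdot> a, z\<rangle> = m \<cdot> (k \<cdot> \<langle>h \<cdot> a, z\<rangle>)" using az ka Ma(2-4) ha(3-5) by simp
        also have "\<dots> = (m \<cdot> l) \<cdot> (r \<cdot> \<langle>a, z\<rangle>)"
          unfolding k(2)[OF az] using az ra la Ma(2-4) by simp
        also have "\<dots> = q \<cdot> \<langle>h \<cdot> a, z\<rangle>" unfolding l(2) qr[OF az] ..
        finally show "(m \<cdot> k) \<cdot> \<langle>h \<cdot> a, z\<rangle> = q \<cdot> \<langle>h \<cdot> a, z\<rangle>" .
      qed
      then show ?thesis using ka Ma by (intro bexI[of _ k]) (simp_all add: Hom_iff)
    qed
    then show "\<exists>q' \<in> Hom C (fst B \<^bold>\<times> Z) (fst ?P). p \<cdot> q' = q"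
      using p(4)[of q "fst B \<^bold>\<times> Z"] qa by (simp add: Hom_iff)
  qed
  have "\<exists>k \<in> Hom C (fst E) (Dom C m). m \<cdot> k = ?b" if m: "m \<in> S" for m
  proof -
    obtain M w where M: "lin M ?D m" "lin E M w" "m \<cdot> w = ?b" using m unfolding S_def by blast
    then show ?thesis using linD(3-5)[OF M(1)] linD(3-5)[OF M(2)]
      by (intro bexI[of _ w]) (simp_all add: Hom_iff)
  qed
  then obtain d where d: "d \<in> Hom C (fst E) P" "p \<cdot> d = ?b"
    using p(4)[of ?b "fst E"] ba by (auto simp: Hom_iff)
  have dl: "lin E ?P d" by (rule lin_factor[OF Pl(2) mp bl _ d(2)]) (use d in simp)
  note da = HomD(1-3)[OF d(1)]
  have "orth E d ?P R"
  proof (rule orthI[OF dl functional_extension[OF dl Pl(2) d(2)]])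
    fix u v assume u: "lin ?P R u" and v: "lin ?P R v"
      and uv: "\<And>a. a \<in> el (fst E) \<Longrightarrow> u \<cdot> (d \<cdot> a) = v \<cdot> (d \<cdot> a)"
    have ua: "arr u" "Dom C u = P" "Cod C u = fst R" and va: "arr v" "Dom C v = P" "Cod C v = fst R"
      using linD(3-5)[OF u] linD(3-5)[OF v] by simp_all
    have "has_finite_limits C" using finitely_well_complete by (simp add: finitely_well_complete_def)
    then obtain k where k: "is_equalizer C u v k"
      using equalizer_exists[of u P "fst R" v] ua va by (auto simp: Hom_iff)
    have uk: "u \<cdot> k = v \<cdot> k" and ka: "arr k" "Cod C k = P"
      using k ua by (auto simp: is_equalizer_def Hom_iff)
    have sk: "strong_monic C k" using equalizer_strong_monic[OF k] ua va by simp
    then have mk: "monic C k" by (simp add: strong_monic_def)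
    obtain c where c: "c \<in> Hom C (TO T (Dom C k)) (Dom C k)" "k \<cdot> c = snd ?P \<cdot> TA T k"
      using equalizer_alg[OF u v k] by blast
    let ?K = "(Dom C k, c)"
    have Kl: "lin ?K ?P k" by (rule sub_alg(2)[OF mk refl _ Pl(1) c]) (use ka in simp)
    have fK: "functionally_complete ?K" by (rule fc_equalizer[OF u v fP fc_R k Kl])
    have "u \<cdot> d = v \<cdot> d"
      by (rule map_eqI[of _ "fst E" "fst R"]) (use uv ua va da in \<open>auto simp: Hom_iff\<close>)
    then obtain w where w: "w \<in> Hom C (fst E) (Dom C k)" "k \<cdot> w = d"
      using ex1_implies_ex[OF equalizer_universal[OF k, of d "fst E"]] ua da by (auto simp: Hom_iff)
    have wl: "lin E ?K w" by (rule lin_factor[OF Kl mk dl _ w(2)]) (use w in simp)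
    note wa = HomD(1-3)[OF w(1)]
    have "(p \<cdot> k) \<cdot> w = ?b" unfolding d(2)[symmetric] w(2)[symmetric] using wa ka pa by simp
    \<comment> \<open>As \<open>p\<close> factors through every member of \<open>S\<close>,
      membership of \<open>p \<cdot> k\<close> gives a right inverse of \<open>k\<close>, and then
      \<open>u = v\<close>.\<close>
    then have "p \<cdot> k \<in> S"
      unfolding S_def using strong_monic_comp[OF p(3) sk] lin_comp[OF Kl Pl(2)] fK wl pa(2) ka by auto
    then obtain l where l: "l \<in> Hom C P (Dom C k)" "(p \<cdot> k) \<cdot> l = p"
      using p(2)[of "p \<cdot> k"] ka pa by auto
    note la = HomD(1-3)[OF l(1)]
    have "p \<cdot> (k \<cdot> l) = p \<cdot> Id C P" using l(2) la ka pa by simp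
    then have kl: "k \<cdot> l = Id C P"
      using monicD[OF mp, of "k \<cdot> l" "Id C P"] la ka pa Po by simp
    have "u \<cdot> (k \<cdot> l) = v \<cdot> (k \<cdot> l)"
      using arg_cong[OF uk, of "\<lambda>x. x \<cdot> l"] la ka ua va by simp
    then show "u = v" unfolding kl using ua va by simp
  qed
  \<comment> \<open>Orthogonality to \<open>R\<close> has placed \<open>d\<close> in the class of
    morphisms along which all complete objects have unique extensions.\<close>
  then have "sigma E d ?P" by (rule sigmaI[OF dl])
  then have "is_fc_reflection E (E, d, ?P)"
    unfolding is_fc_reflection_iff using dl fP fcD(2) by blast
  then show ?thesis using Pl(2) d(2) by blast
qed

section \<open>Distributions\<close>

text \<open>Points of a free algebra are written \<open>unit T X \<cdot> x\<close> in what follows;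
  naturality would rewrite them to \<open>TA T x \<cdot> unit T (One C)\<close>.\<close>

declare unit_comp [simp del]

section \<open>Freeness with parameters\<close>

text \<open>By the unit law of the monad, a homomorphism on a free algebra is the extension of its
  own restriction along the unit.\<close>

lemma free_lin_eqI:
  assumes X: "X \<in> Ob C" and f: "lin (free X) B f" "lin (free X) B f'"
    and e: "\<And>x. x \<in> el X \<Longrightarrow> f \<cdot> (unit T X \<cdot> x) = f' \<cdot> (unit T X \<cdot> x)"
  shows "f = f'"
proof -
  have fa: "arr f" "Dom C f = TO T X" "Cod C f = fst B" "arr f'" "Dom C f' = TO T X" "Cod C f' = fst B"
    using linD(3-5)[OF f(1)] linD(3-5)[OF f(2)] by simp_all
  have B: "B \<in> Ob L" using linD(2)[OF f(1)] .
  have *: "g = snd B \<cdot> TA T (g \<cdot> unit T X)" if g: "lin (free X) B g" for g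
  proof -
    have ga: "arr g" "Dom C g = TO T X" "Cod C g = fst B" using linD(3-5)[OF g] by simp_all
    have "g = g \<cdot> (mult T X \<cdot> TA T (unit T X))" using ga unit_right[OF X] by simp
    also have "\<dots> = snd B \<cdot> (TA T g \<cdot> TA T (unit T X))"
      using lin_apply[OF g, of "TA T (unit T X)"] X by simp
    finally show ?thesis using ga X by simp
  qed
  have "f \<cdot> unit T X = f' \<cdot> unit T X"
    by (rule map_eqI[of _ X "fst B"]) (use e fa X in \<open>auto simp: Hom_iff\<close>)
  then show ?thesis using *[OF f(1)] *[OF f(2)] by simp
qed

lemma alg_extend_unit:
  assumes "B \<in> Ob L" "X \<in> Ob C" "arr f" "Dom C f = X" "Cod C f = fst B" "x \<in> el X"
  shows "snd B \<cdot> (TA T f \<cdot> (unit T X \<cdot> x)) = f \<cdot> x"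
  using arg_cong[OF alg_unit_comp[OF assms(1,3,5)], of "\<lambda>h. h \<cdot> x"] assms by simp

lemma free_extend_lin:
  assumes B: "B \<in> Ob L" and f: "f \<in> Hom C X (fst B)"
  shows "lin (free X) B (snd B \<cdot> TA T f)"
proof (rule linI)
  note fa = HomD(1-3)[OF f] and X = HomD(4)[OF f]
  fix t assume t: "t \<in> el (TO T (fst (free X)))"
  have "(snd B \<cdot> TA T f) \<cdot> (mult T X \<cdot> t) = snd B \<cdot> ((TA T f \<cdot> mult T X) \<cdot> t)"
    using B fa X t by simp
  also have "\<dots> = (snd B \<cdot> mult T (fst B)) \<cdot> (TA T (TA T f) \<cdot> t)"
    unfolding mult_comp[OF fa, symmetric] using B fa X t by simp
  also have "\<dots> = snd B \<cdot> (TA T (snd B \<cdot> TA T f) \<cdot> t)"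
    unfolding alg_mult[OF B] using B fa X t by simp
  finally show "(snd B \<cdot> TA T f) \<cdot> (snd (free X) \<cdot> t) = snd B \<cdot> (TA T (snd B \<cdot> TA T f) \<cdot> t)" by simp
qed (use B HomD(1-4)[OF f] in \<open>auto simp: Hom_iff\<close>)

text \<open>The existence half of freeness in the presence of a parameter; \<open>lift1_unit\<close>
  is the accompanying triangle.\<close>

lemma lift1_phom:
  assumes B: "B \<in> Ob L" and X: "X \<in> Ob C" and Z: "Z \<in> Ob C" and f: "f \<in> Hom C (X \<^bold>\<times> Z) (fst B)"
  shows "lift1 B X Z f \<in> phom (free X) Z B"
proof (rule phomI)
  note fa = HomD(1-3)[OF f]
  fix z assume z: "z \<in> el Z"
  have g: "f \<cdot> \<langle>Id C X, z \<cdot> bang X\<rangle> \<in> Hom C X (fst B)" using fa X z by (simp add: Hom_iff)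
  show "\<exists>g. lin (free X) B g \<and> (\<forall>t \<in> el (fst (free X)). lift1 B X Z f \<cdot> \<langle>t, z\<rangle> = g \<cdot> t)"
    by (rule exI, rule conjI, rule free_extend_lin[OF B g])
      (use fa z X Z B lift1_slice[OF B X Z fa z] in auto)
qed (use HomD(1-3)[OF f] X Z B in \<open>auto simp: Hom_iff\<close>)

lemma lift1_unit:
  assumes B: "B \<in> Ob L" and X: "X \<in> Ob C" and Z: "Z \<in> Ob C" and f: "f \<in> Hom C (X \<^bold>\<times> Z) (fst B)"
    and x: "x \<in> el X" and z: "z \<in> el Z"
  shows "lift1 B X Z f \<cdot> \<langle>unit T X \<cdot> x, z\<rangle> = f \<cdot> \<langle>x, z\<rangle>"
proof -
  note fa = HomD(1-3)[OF f]
  let ?g = "f \<cdot> \<langle>Id C X, z \<cdot> bang X\<rangle>"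
  have ga: "arr ?g" "Dom C ?g = X" "Cod C ?g = fst B" using fa X z by simp_all
  have "lift1 B X Z f \<cdot> \<langle>unit T X \<cdot> x, z\<rangle> = snd B \<cdot> (TA T ?g \<cdot> (unit T X \<cdot> x))"
    by (rule lift1_slice[OF B X Z fa z]) (use x X in simp)
  also have "\<dots> = ?g \<cdot> x" by (rule alg_extend_unit[OF B X ga x])
  also have "\<dots> = f \<cdot> \<langle>x, z\<rangle>" using x z fa X by simp
  finally show ?thesis .
qed

lemma orth_extend_lin:
  assumes o: "orth A h B M" and h: "lin A B h" and g: "lin A M g"
  obtains f where "lin B M f" "\<And>a. a \<in> el (fst A) \<Longrightarrow> f \<cdot> (h \<cdot> a) = g \<cdot> a"
proof -
  note ha = linD(1-5)[OF h] and ga = linD(3-5)[OF g]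
  have i: "Id C (One C) \<in> el (One C)" by simp
  obtain q where q: "q \<in> phom B (One C) M"
    "\<And>a z. a \<in> el (fst A) \<Longrightarrow> z \<in> el (One C) \<Longrightarrow>
      q \<cdot> \<langle>h \<cdot> a, z\<rangle> = (g \<cdot> Fst C (fst A) (One C)) \<cdot> \<langle>a, z\<rangle>"
    using orth_extend[OF o h one_ob phom_lin[OF g one_ob]] by blast
  show ?thesis
  proof (rule that[OF phomD(4)[OF q(1) i]])
    fix a assume a: "a \<in> el (fst A)"
    have "(q \<cdot> \<langle>Id C (fst B), Id C (One C) \<cdot> bang (fst B)\<rangle>) \<cdot> (h \<cdot> a) = q \<cdot> \<langle>h \<cdot> a, Id C (One C)\<rangle>"
      by (rule phom_slice[OF q(1) ha(2) one_ob i]) (use a ha in auto)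
    also have "\<dots> = g \<cdot> a"
      unfolding q(2)[OF a i] using a ha(1) ga by simp
    finally show "(q \<cdot> \<langle>Id C (fst B), Id C (One C) \<cdot> bang (fst B)\<rangle>) \<cdot> (h \<cdot> a) = g \<cdot> a" .
  qed
qed

section \<open>Iterated integrals\<close>

lemma name_apply:
  assumes "u \<in> el (Exp C X Y)" "X \<in> Ob C" "Y \<in> Ob C"
  shows "name_of C (ev X Y (Id C X) (u \<cdot> bang X)) = u"
  by (rule exp_element_eqI[of _ X Y]) (use assms in auto)

lemma map_of_fun_eq:
  assumes "g \<in> Hom C X Y" "\<And>x. x \<in> el X \<Longrightarrow> g \<cdot> x = \<phi> x"
  shows "map_of_fun C X Y \<phi> = g"
  unfolding map_of_fun_def
proof (rule the_equality)
  show "g \<in> Hom C X Y \<and> (\<forall>x \<in> el X. g \<cdot> x = \<phi> x)" using assms by blast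
  fix h assume "h \<in> Hom C X Y \<and> (\<forall>x \<in> el X. h \<cdot> x = \<phi> x)"
  then have h: "h \<in> Hom C X Y" "\<And>x. x \<in> el X \<Longrightarrow> h \<cdot> x = \<phi> x" by blast+
  show "h = g" by (rule map_eqI[OF h(1) assms(1)]) (simp only: h(2) assms(2))
qed

abbreviation RR :: "'o" where
  "RR \<equiv> fst R"

abbreviation cot :: "'o \<Rightarrow> ('o, 'a) alg" where
  "cot X \<equiv> cotensor X R"

text \<open>The inner integral \<open>y \<mapsto> m (f (-, y))\<close>, and in \<open>inner2\<close>
  its mirror image \<open>x \<mapsto> n (f (x, -))\<close>. Built by currying, it is an arrow from
  the outset and so witnesses the \<open>THE\<close> in \<open>map_of_fun\<close>.\<close>

definition inner1 :: "'o \<Rightarrow> 'o \<Rightarrow> 'a \<Rightarrow> 'a \<Rightarrow> 'a" where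
  "inner1 X Y m f = m \<cdot> curry_map C X Y f"

definition inner2 :: "'o \<Rightarrow> 'o \<Rightarrow> 'a \<Rightarrow> 'a \<Rightarrow> 'a" where
  "inner2 X Y n f = n \<cdot> curry_map C Y X (f \<cdot> swap C Y X)"

lemma RR_ob: "RR \<in> Ob C"
  by (rule alg_arr(1)[OF R_alg])

lemma inner_hom:
  assumes "X \<in> Ob C" "Y \<in> Ob C" "f \<in> Hom C (X \<^bold>\<times> Y) RR"
  shows "m \<in> Hom C (Exp C X RR) RR \<Longrightarrow> inner1 X Y m f \<in> Hom C Y RR"
    "n \<in> Hom C (Exp C Y RR) RR \<Longrightarrow> inner2 X Y n f \<in> Hom C X RR"
  using assms(1,2) HomD(1-3)[OF assms(3)] unfolding inner1_def inner2_def by (auto simp: Hom_iff)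

lemma inner1_apply:
  assumes "X \<in> Ob C" "Y \<in> Ob C" "f \<in> Hom C (X \<^bold>\<times> Y) RR" "m \<in> Hom C (Exp C X RR) RR" "y \<in> el Y"
  shows "inner1 X Y m f \<cdot> y = m \<cdot> name_of C (f \<cdot> \<langle>Id C X, y \<cdot> bang X\<rangle>)"
proof -
  note ar = HomD(1-3)[OF assms(3)] HomD(1-3)[OF assms(4)]
  have "curry_map C X Y f \<cdot> y = name_of C (f \<cdot> \<langle>Id C X, y \<cdot> bang X\<rangle>)"
    by (rule exp_element_eqI[of _ X RR]) (use assms(1,2,5) ar RR_ob in auto)
  then show ?thesis unfolding inner1_def using assms(1,2,5) ar by simp
qed

lemma inner2_apply:
  assumes "X \<in> Ob C" "Y \<in> Ob C" "f \<in> Hom C (X \<^bold>\<times> Y) RR" "n \<in> Hom C (Exp C Y RR) RR" "x \<in> el X"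
  shows "inner2 X Y n f \<cdot> x = n \<cdot> name_of C (f \<cdot> \<langle>x \<cdot> bang Y, Id C Y\<rangle>)"
proof -
  note ar = HomD(1-3)[OF assms(3)] HomD(1-3)[OF assms(4)]
  have "curry_map C Y X (f \<cdot> swap C Y X) \<cdot> x = name_of C (f \<cdot> \<langle>x \<cdot> bang Y, Id C Y\<rangle>)"
    by (rule exp_element_eqI[of _ Y RR]) (use assms(1,2,5) ar RR_ob in auto)
  then show ?thesis unfolding inner2_def using assms(1,2,5) ar by simp
qed

text \<open>The functions on elements in \<open>fubini\<close> are induced by the arrows
  \<open>inner1\<close> and \<open>inner2\<close>, and by no others since the category is
  well-pointed. This removes \<open>map_of_fun\<close> from the argument.\<close>

lemma fubini_iff:
  assumes X: "X \<in> Ob C" and Y: "Y \<in> Ob C" and m: "lin (cot X) R m" and n: "lin (cot Y) R n"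
  shows "fubini X Y (cot X, m, R) (cot Y, n, R) (cot (X \<^bold>\<times> Y), r, R) \<longleftrightarrow>
    (\<forall>f \<in> Hom C (X \<^bold>\<times> Y) RR. n \<cdot> name_of C (inner1 X Y m f) = r \<cdot> name_of C f \<and>
      r \<cdot> name_of C f = m \<cdot> name_of C (inner2 X Y n f))"
proof -
  have mh: "m \<in> Hom C (Exp C X RR) RR" and nh: "n \<in> Hom C (Exp C Y RR) RR"
    using linD(3-5)[OF m] linD(3-5)[OF n] by (simp_all add: Hom_iff)
  have "integral_over Y (cot Y, n, R) (\<lambda>y. integral_over X (cot X, m, R) (\<lambda>x. f \<cdot> \<langle>x, y\<rangle>)) =
      n \<cdot> name_of C (inner1 X Y m f)"
    "integral_over X (cot X, m, R) (\<lambda>x. integral_over Y (cot Y, n, R) (\<lambda>y. f \<cdot> \<langle>x, y\<rangle>)) =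
      m \<cdot> name_of C (inner2 X Y n f)"
    if f: "f \<in> Hom C (X \<^bold>\<times> Y) RR" for f
  proof -
    note fa = HomD(1-3)[OF f]
    have 1: "map_of_fun C X RR (\<lambda>x. f \<cdot> \<langle>x, y\<rangle>) = f \<cdot> \<langle>Id C X, y \<cdot> bang X\<rangle>" if "y \<in> el Y" for y
      by (rule map_of_fun_eq) (use that fa X in \<open>auto simp: Hom_iff\<close>)
    have 2: "map_of_fun C Y RR (\<lambda>y. f \<cdot> \<langle>x, y\<rangle>) = f \<cdot> \<langle>x \<cdot> bang Y, Id C Y\<rangle>" if "x \<in> el X" for x
      by (rule map_of_fun_eq) (use that fa Y in \<open>auto simp: Hom_iff\<close>)
    have "map_of_fun C Y RR (\<lambda>y. integral_over X (cot X, m, R) (\<lambda>x. f \<cdot> \<langle>x, y\<rangle>)) = inner1 X Y m f"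
      by (rule map_of_fun_eq[OF inner_hom(1)[OF X Y f mh]])
        (unfold integral_over_def integral_def L_simps, simp only: 1 inner1_apply[OF X Y f mh])
    then show "integral_over Y (cot Y, n, R) (\<lambda>y. integral_over X (cot X, m, R) (\<lambda>x. f \<cdot> \<langle>x, y\<rangle>)) =
      n \<cdot> name_of C (inner1 X Y m f)"
      by (simp add: integral_over_def[of Y] integral_def)
    have "map_of_fun C X RR (\<lambda>x. integral_over Y (cot Y, n, R) (\<lambda>y. f \<cdot> \<langle>x, y\<rangle>)) = inner2 X Y n f"
      by (rule map_of_fun_eq[OF inner_hom(2)[OF X Y f nh]])
        (unfold integral_over_def integral_def L_simps, simp only: 2 inner2_apply[OF X Y f nh])
    then show "integral_over X (cot X, m, R) (\<lambda>x. integral_over Y (cot Y, n, R) (\<lambda>y. f \<cdot> \<langle>x, y\<rangle>)) =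
      m \<cdot> name_of C (inner2 X Y n f)"
      by (simp add: integral_over_def[of X] integral_def)
  qed
  then show ?thesis unfolding fubini_def by (simp add: integral_def)
qed

text \<open>\<open>tensor_dist X Y m n\<close> sends \<open>f\<close> to \<open>m (\<lambda>x. n (f (x, -)))\<close>.\<close>

definition slice_map :: "'o \<Rightarrow> 'o \<Rightarrow> 'a" where
  "slice_map X Y = (let E = Exp C (X \<^bold>\<times> Y) RR; V = X \<^bold>\<times> E in
     curry_map C Y V (ev (X \<^bold>\<times> Y) RR (\<langle>Fst C X E \<cdot> Snd C Y V, Fst C Y V\<rangle>) (Snd C X E \<cdot> Snd C Y V)))"

definition tensor_dist :: "'o \<Rightarrow> 'o \<Rightarrow> 'a \<Rightarrow> 'a \<Rightarrow> 'a" where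
  "tensor_dist X Y m n = m \<cdot> curry_map C X (Exp C (X \<^bold>\<times> Y) RR) (n \<cdot> slice_map X Y)"

lemma slice_map_props:
  assumes "X \<in> Ob C" "Y \<in> Ob C"
  shows "arr (slice_map X Y)" "Dom C (slice_map X Y) = X \<^bold>\<times> Exp C (X \<^bold>\<times> Y) RR"
    "Cod C (slice_map X Y) = Exp C Y RR"
    "x \<in> el X \<Longrightarrow> y \<in> el Y \<Longrightarrow> u \<in> el (Exp C (X \<^bold>\<times> Y) RR) \<Longrightarrow>
      ev Y RR y (slice_map X Y \<cdot> \<langle>x, u\<rangle>) = ev (X \<^bold>\<times> Y) RR (\<langle>x, y\<rangle>) u"
  unfolding slice_map_def Let_def using assms RR_ob by simp_all

text \<open>Linearity is tested pointwise in two nested cotensors; at \<open>x\<close> and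
  \<open>y\<close> what remains is evaluation at \<open>\<langle>x, y\<rangle>\<close>, a
  homomorphism. The second claim is one of the two equalities of Fubini's identity, obtained by
  construction.\<close>

lemma tensor_dist_props:
  assumes X: "X \<in> Ob C" and Y: "Y \<in> Ob C" and m: "lin (cot X) R m" and n: "lin (cot Y) R n"
  shows "lin (cot (X \<^bold>\<times> Y)) R (tensor_dist X Y m n)"
    "f \<in> Hom C (X \<^bold>\<times> Y) RR \<Longrightarrow> tensor_dist X Y m n \<cdot> name_of C f = m \<cdot> name_of C (inner2 X Y n f)"
proof -
  let ?E = "Exp C (X \<^bold>\<times> Y) RR"
  have ma: "arr m" "Dom C m = Exp C X RR" "Cod C m = RR" and na: "arr n" "Dom C n = Exp C Y RR" "Cod C n = RR"
    using linD(3-5)[OF m] linD(3-5)[OF n] by simp_all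
  have nh: "n \<in> Hom C (Exp C Y RR) RR" using na by (simp add: Hom_iff)
  note sm = slice_map_props[OF X Y]
  define J where "J = curry_map C X ?E (n \<cdot> slice_map X Y)"
  have Ja: "arr J" "Dom C J = ?E" "Cod C J = Exp C X RR"
    unfolding J_def using sm(1-3) na X Y RR_ob by simp_all
  have J: "ev X RR x (J \<cdot> u) = n \<cdot> (slice_map X Y \<cdot> \<langle>x, u\<rangle>)"
    if "x \<in> el X" "u \<in> el ?E" for x u
    unfolding J_def using that sm(1-3) na X Y RR_ob by simp
  have "lin (cot (X \<^bold>\<times> Y)) (cot X) J"
  proof (rule lin_into_cotensor)
    fix x assume x: "x \<in> el X"
    let ?s = "slice_map X Y \<cdot> \<langle>x \<cdot> bang ?E, Id C ?E\<rangle>"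
    have sa: "arr ?s" "Dom C ?s = ?E" "Cod C ?s = Exp C Y RR" using x sm(1-3) X Y RR_ob by simp_all
    have "lin (cot (X \<^bold>\<times> Y)) (cot Y) ?s"
    proof (rule lin_into_cotensor)
      fix y assume y: "y \<in> el Y"
      have xy: "\<langle>x, y\<rangle> \<in> el (X \<^bold>\<times> Y)" using x y by simp
      have "evx Y RR y \<cdot> ?s = evx (X \<^bold>\<times> Y) RR \<langle>x, y\<rangle>"
      proof (rule map_eqI[of _ ?E RR])
        fix u assume u: "u \<in> el ?E"
        have "(evx Y RR y \<cdot> ?s) \<cdot> u = ev Y RR y (slice_map X Y \<cdot> \<langle>x, u\<rangle>)"
          using x y u sm(1-3) X Y RR_ob by simp
        then show "(evx Y RR y \<cdot> ?s) \<cdot> u = evx (X \<^bold>\<times> Y) RR \<langle>x, y\<rangle> \<cdot> u"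
          unfolding sm(4)[OF x y u] using x y u X Y RR_ob by simp
      qed (use x y sm(1-3) X Y RR_ob in \<open>auto simp: Hom_iff\<close>)
      then show "lin (cot (X \<^bold>\<times> Y)) R (evx Y RR y \<cdot> ?s)"
        using evx_lin[OF _ R_alg xy] X Y by simp
    qed (use X Y sa in \<open>auto simp: Hom_iff\<close>)
    note l = lin_comp[OF this n]
    have "evx X RR x \<cdot> J = n \<cdot> ?s"
    proof (rule map_eqI[of _ ?E RR])
      fix u assume u: "u \<in> el ?E"
      have "(evx X RR x \<cdot> J) \<cdot> u = ev X RR x (J \<cdot> u)" using x u Ja X RR_ob by simp
      then show "(evx X RR x \<cdot> J) \<cdot> u = (n \<cdot> ?s) \<cdot> u"
        unfolding J[OF x u] using x u sm(1-3) na X Y RR_ob by simp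
    qed (use x Ja sm(1-3) na X Y RR_ob in \<open>auto simp: Hom_iff\<close>)
    then show "lin (cot (X \<^bold>\<times> Y)) R (evx X RR x \<cdot> J)" using l by simp
  qed (use X Y Ja in \<open>auto simp: Hom_iff\<close>)
  from lin_comp[OF this m] show "lin (cot (X \<^bold>\<times> Y)) R (tensor_dist X Y m n)"
    by (simp add: tensor_dist_def J_def)
  assume f: "f \<in> Hom C (X \<^bold>\<times> Y) RR"
  note fa = HomD(1-3)[OF f]
  have i2: "arr (inner2 X Y n f)" "Dom C (inner2 X Y n f) = X" "Cod C (inner2 X Y n f) = RR"
    using HomD(1-3)[OF inner_hom(2)[OF X Y f nh]] by simp_all
  have "J \<cdot> name_of C f = name_of C (inner2 X Y n f)"
  proof (rule exp_element_eqI[of _ X RR])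
    fix x assume x: "x \<in> el X"
    have "slice_map X Y \<cdot> \<langle>x, name_of C f\<rangle> = name_of C (f \<cdot> \<langle>x \<cdot> bang Y, Id C Y\<rangle>)"
    proof (rule exp_element_eqI[of _ Y RR])
      fix y assume y: "y \<in> el Y"
      show "ev Y RR y (slice_map X Y \<cdot> \<langle>x, name_of C f\<rangle>) =
          ev Y RR y (name_of C (f \<cdot> \<langle>x \<cdot> bang Y, Id C Y\<rangle>))"
        using sm(4)[OF x y, of "name_of C f"] x y fa X Y by simp
    qed (use x sm(1-3) fa X Y RR_ob in auto)
    then have "n \<cdot> (slice_map X Y \<cdot> \<langle>x, name_of C f\<rangle>) = inner2 X Y n f \<cdot> x"
      using inner2_apply[OF X Y f nh x] by simp
    then show "ev X RR x (J \<cdot> name_of C f) = ev X RR x (name_of C (inner2 X Y n f))"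
      using J[OF x, of "name_of C f"] x fa i2 by simp
  qed (use Ja fa i2 X RR_ob in auto)
  then show "tensor_dist X Y m n \<cdot> name_of C f = m \<cdot> name_of C (inner2 X Y n f)"
    using ma Ja fa unfolding tensor_dist_def J_def[symmetric] by simp
qed

text \<open>Every element of the exponential is the name of a map, so a distribution is determined
  by its integrals.\<close>

lemma fubini_unique:
  assumes X: "X \<in> Ob C" and Y: "Y \<in> Ob C" and m: "lin (cot X) R m" and n: "lin (cot Y) R n"
    and r: "lin (cot (X \<^bold>\<times> Y)) R r" "lin (cot (X \<^bold>\<times> Y)) R r'"
    and f: "fubini X Y (cot X, m, R) (cot Y, n, R) (cot (X \<^bold>\<times> Y), r, R)"
      "fubini X Y (cot X, m, R) (cot Y, n, R) (cot (X \<^bold>\<times> Y), r', R)"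
  shows "r = r'"
proof (rule map_eqI[of _ "Exp C (X \<^bold>\<times> Y) RR" RR])
  have XY: "X \<^bold>\<times> Y \<in> Ob C" using X Y by simp
  fix u assume u: "u \<in> el (Exp C (X \<^bold>\<times> Y) RR)"
  let ?f = "ev (X \<^bold>\<times> Y) RR (Id C (X \<^bold>\<times> Y)) (u \<cdot> bang (X \<^bold>\<times> Y))"
  have fh: "?f \<in> Hom C (X \<^bold>\<times> Y) RR" using u X Y RR_ob by (simp add: Hom_iff)
  have "r \<cdot> name_of C ?f = r' \<cdot> name_of C ?f"
    using f fh unfolding fubini_iff[OF X Y m n] by metis
  then show "r \<cdot> u = r' \<cdot> u" unfolding name_apply[OF u XY RR_ob] .
qed (use linD(3-5)[OF r(1)] linD(3-5)[OF r(2)] in \<open>auto simp: Hom_iff\<close>)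

text \<open>What Fubini's theorem needs of \<open>m\<close>: a functional on \<open>[X, R]*\<close> whose values at the points are given
  by \<open>u\<close> takes the value \<open>m u\<close> at \<open>m\<close>.\<close>

definition determined :: "'o \<Rightarrow> 'a \<Rightarrow> bool" where
  "determined X m \<longleftrightarrow> (\<forall>a u. lin (dual (cot X)) R a \<longrightarrow> u \<in> el (Exp C X RR) \<longrightarrow>
     (\<forall>x \<in> el X. a \<cdot> code (cot X) R (evx X RR x) = ev X RR x u) \<longrightarrow>
     a \<cdot> code (cot X) R m = m \<cdot> u)"

section \<open>Fubini's identity for determined distributions\<close>

text \<open>Through \<open>f\<close>, each \<open>p\<close> in \<open>[X, R]*\<close> yields the
  function \<open>y \<mapsto> p (f (-, y))\<close>; this is the homomorphism \<open>W\<close> into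
  \<open>[Y, R]\<close>, and \<open>n \<cdot> W\<close> is a functional on \<open>[X, R]*\<close>.
  At \<open>m\<close> it gives one iterated integral, at the point \<open>x\<close> the value of
  \<open>inner2\<close> at \<open>x\<close>, and \<open>determined\<close> identifies the former
  with the other iterated integral.\<close>

lemma fubini_of_determined:
  assumes X: "X \<in> Ob C" and Y: "Y \<in> Ob C" and m: "lin (cot X) R m" and n: "lin (cot Y) R n"
    and det: "determined X m" and f: "f \<in> Hom C (X \<^bold>\<times> Y) RR"
  shows "n \<cdot> name_of C (inner1 X Y m f) = m \<cdot> name_of C (inner2 X Y n f)"
proof -
  have E: "cot X \<in> Ob L" using X by simp
  let ?E = "Exp C X RR" and ?k = "hom_incl (cot X) R" and ?D = "fst (dual (cot X))"
  have ma: "arr m" "Dom C m = ?E" "Cod C m = RR" and na: "arr n" "Dom C n = Exp C Y RR" "Cod C n = RR"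
    using linD(3-5)[OF m] linD(3-5)[OF n] by simp_all
  have mh: "m \<in> Hom C ?E RR" and nh: "n \<in> Hom C (Exp C Y RR) RR" using ma na by (simp_all add: Hom_iff)
  note fa = HomD(1-3)[OF f]
  have ka: "arr ?k" "Dom C ?k = ?D" "Cod C ?k = Exp C ?E RR" using X by (simp_all add: dual_def)
  have Eo: "?E \<in> Ob C" and Do: "?D \<in> Ob C" using X RR_ob by simp_all
  define w where "w = curry_map C X Y f"
  have wa: "arr w" "Dom C w = Y" "Cod C w = ?E" unfolding w_def using fa X Y by simp_all
  have w: "ev X RR x (w \<cdot> y) = f \<cdot> \<langle>x, y\<rangle>" if "x \<in> el X" "y \<in> el Y" for x y
    unfolding w_def using that fa X Y by simp
  define W where "W = curry_map C Y ?D (ev ?E RR (w \<cdot> Fst C Y ?D) (?k \<cdot> Snd C Y ?D))"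
  have Wa: "arr W" "Dom C W = ?D" "Cod C W = Exp C Y RR"
    unfolding W_def using wa ka Eo Do Y RR_ob by simp_all
  have W: "ev Y RR y (W \<cdot> p) = ev ?E RR (w \<cdot> y) (?k \<cdot> p)"
    if "y \<in> el Y" "p \<in> el ?D" for y p
    unfolding W_def using that wa ka Eo Do Y RR_ob by simp
  have Wl: "lin (dual (cot X)) (cot Y) W"
  proof (rule lin_into_cotensor)
    fix y assume y: "y \<in> el Y"
    then have wy: "w \<cdot> y \<in> el (fst (cot X))" using wa by simp
    have "evx Y RR y \<cdot> W = evx ?E RR (w \<cdot> y) \<cdot> ?k"
    proof (rule map_eqI[of _ ?D RR])
      fix p assume p: "p \<in> el ?D"
      have "(evx Y RR y \<cdot> W) \<cdot> p = ev Y RR y (W \<cdot> p)" using y p Wa Y RR_ob by simp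
      then show "(evx Y RR y \<cdot> W) \<cdot> p = (evx ?E RR (w \<cdot> y) \<cdot> ?k) \<cdot> p"
        unfolding W[OF y p] using y p wa ka Eo RR_ob by simp
    qed (use y Wa wa ka Eo Y RR_ob in \<open>auto simp: Hom_iff\<close>)
    then show "lin (dual (cot X)) R (evx Y RR y \<cdot> W)"
      using ev_hom_incl_lin[OF E R_alg wy] by (simp add: dual_def)
  qed (use Y X Wa in \<open>auto simp: Hom_iff\<close>)
  note al = lin_comp[OF Wl n]
  have i1: "inner1 X Y m f \<in> Hom C Y RR" and i2: "inner2 X Y n f \<in> Hom C X RR"
    using inner_hom[OF X Y f] mh nh by blast+
  note i1a = HomD(1-3)[OF i1] and i2a = HomD(1-3)[OF i2]
  have "W \<cdot> code (cot X) R m = name_of C (inner1 X Y m f)"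
  proof (rule exp_element_eqI[of _ Y RR])
    note c = code_props[OF m, folded dual_def]
    fix y assume y: "y \<in> el Y"
    have "ev Y RR y (W \<cdot> code (cot X) R m) = m \<cdot> (w \<cdot> y)"
      using W[OF y, of "code (cot X) R m"] c(1-3) c(5)[of "w \<cdot> y"] y wa by simp
    also have "\<dots> = inner1 X Y m f \<cdot> y"
      unfolding inner1_def w_def[symmetric] using ma wa y by simp
    finally show "ev Y RR y (W \<cdot> code (cot X) R m) = ev Y RR y (name_of C (inner1 X Y m f))"
      using y i1a by simp
  qed (use code_props(1-3)[OF m, folded dual_def] Wa i1a Y RR_ob in auto)
  then have *: "(n \<cdot> W) \<cdot> code (cot X) R m = n \<cdot> name_of C (inner1 X Y m f)"
    using na Wa code_props(1-3)[OF m, folded dual_def] by simp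
  have "(n \<cdot> W) \<cdot> code (cot X) R (evx X RR x) = ev X RR x (name_of C (inner2 X Y n f))"
    if x: "x \<in> el X" for x
  proof -
    note c = code_props[OF evx_lin[OF X R_alg x], folded dual_def]
    let ?g = "f \<cdot> \<langle>x \<cdot> bang Y, Id C Y\<rangle>"
    have ga: "arr ?g" "Dom C ?g = Y" "Cod C ?g = RR" using fa x Y by simp_all
    have "W \<cdot> code (cot X) R (evx X RR x) = name_of C ?g"
    proof (rule exp_element_eqI[of _ Y RR])
      fix y assume y: "y \<in> el Y"
      have "ev Y RR y (W \<cdot> code (cot X) R (evx X RR x)) = evx X RR x \<cdot> (w \<cdot> y)"
        using W[OF y, of "code (cot X) R (evx X RR x)"] c(1-3) c(5)[of "w \<cdot> y"] y wa by simp
      also have "\<dots> = f \<cdot> \<langle>x, y\<rangle>" using w[OF x y] x y wa X RR_ob by simp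
      finally show "ev Y RR y (W \<cdot> code (cot X) R (evx X RR x)) = ev Y RR y (name_of C ?g)"
        using x y fa Y by simp
    qed (use c(1-3) Wa ga Y RR_ob in auto)
    then have "(n \<cdot> W) \<cdot> code (cot X) R (evx X RR x) = inner2 X Y n f \<cdot> x"
      unfolding inner2_apply[OF X Y f nh x] using na Wa c(1-3) by simp
    then show ?thesis using x i2a by simp
  qed
  moreover have "name_of C (inner2 X Y n f) \<in> el (Exp C X RR)" using i2a by simp
  ultimately have "(n \<cdot> W) \<cdot> code (cot X) R m = m \<cdot> name_of C (inner2 X Y n f)"
    using det al unfolding determined_def by blast
  then show ?thesis using * by simp
qed

lemma fubini_tensor_dist:
  assumes X: "X \<in> Ob C" and Y: "Y \<in> Ob C" and m: "lin (cot X) R m" and n: "lin (cot Y) R n"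
    and det: "determined X m"
  shows "fubini X Y (cot X, m, R) (cot Y, n, R) (cot (X \<^bold>\<times> Y), tensor_dist X Y m n, R)"
  unfolding fubini_iff[OF X Y m n]
  using tensor_dist_props(2)[OF X Y m n] fubini_of_determined[OF X Y m n det] by simp

lemma reflexive_determined:
  assumes X: "X \<in> Ob C" and refl: "reflexive (cot X)" and m: "lin (cot X) R m"
  shows "determined X m"
  unfolding determined_def
proof (intro allI impI)
  let ?E = "Exp C X RR" and ?D = "dual (cot X)"
  have E: "cot X \<in> Ob L" using X by simp
  have D: "?D \<in> Ob L" using E by simp
  note b = bidual_map_props[OF E]
  have ba: "arr (bidual_map (cot X))" "Dom C (bidual_map (cot X)) = ?E"
    "Cod C (bidual_map (cot X)) = fst (dual ?D)"
    using linD(3-5)[OF b(2)] by simp_all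
  have "iso C (bidual_map (cot X))"
    using refl iso_L_iff[OF b(2)] by (simp add: reflexive_def b(1))
  then obtain j where j: "arr j" "Dom C j = fst (dual ?D)" "Cod C j = ?E"
    "bidual_map (cot X) \<cdot> j = Id C (fst (dual ?D))"
    using ba by (auto elim!: iso_inverse)
  fix a u assume a: "lin ?D R a" and u: "u \<in> el ?E"
    and ev: "\<forall>x \<in> el X. a \<cdot> code (cot X) R (evx X RR x) = ev X RR x u"
  note ca = code_props[OF a, folded dual_def]
  define v where "v = j \<cdot> code ?D R a"
  have va: "arr v" "Dom C v = One C" "Cod C v = ?E" unfolding v_def using j ca(1-3) by simp_all
  have bv: "bidual_map (cot X) \<cdot> v = code ?D R a"
    unfolding v_def using arg_cong[OF j(4), of "\<lambda>h. h \<cdot> code ?D R a"] j(1-3) ca(1-3) ba D by simp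
  have ap: "a \<cdot> code (cot X) R g = g \<cdot> v" if g: "lin (cot X) R g" for g
  proof -
    note c = code_props[OF g, folded dual_def]
    have "a \<cdot> code (cot X) R g = ap ?D R (code (cot X) R g) (bidual_map (cot X) \<cdot> v)"
      unfolding bv using ca(5)[of "code (cot X) R g"] c(1-3) by simp
    also have "\<dots> = ap (cot X) R v (code (cot X) R g)"
      by (rule b(3)) (use va c(1-3) in auto)
    also have "\<dots> = g \<cdot> v" using c(5)[of v] va by simp
    finally show ?thesis .
  qed
  have "v = u"
  proof (rule exp_element_eqI[of _ X RR])
    fix x assume x: "x \<in> el X"
    show "ev X RR x v = ev X RR x u"
      using ap[OF evx_lin[OF X R_alg x]] ev[rule_format, OF x] x va X RR_ob by simp
  qed (use va u X RR_ob in auto)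
  then show "a \<cdot> code (cot X) R m = m \<cdot> u" using ap[OF m] by simp
qed

section \<open>The dual of a free algebra as a cotensor\<close>

lemma restrict_free_props:
  assumes X: "X \<in> Ob C"
  shows "lin (dual (free X)) (cot X) (restrict_free X)"
    "x \<in> el X \<Longrightarrow> p \<in> el (fst (dual (free X))) \<Longrightarrow>
      ev X RR x (restrict_free X \<cdot> p) = ap (free X) R (unit T X \<cdot> x) p"
proof -
  have F: "free X \<in> Ob L" using X by simp
  have pl: "lin (cot (TO T X)) (cot X) (exp_pre C (unit T X) RR)"
    by (rule exp_pre_lin) (use X in \<open>auto simp: Hom_iff\<close>)
  have kl: "lin (dual (free X)) (cot (TO T X)) (hom_incl (free X) R)"
    using hom_incl_props(4)[OF F R_alg] by (simp add: dual_def)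
  show "lin (dual (free X)) (cot X) (restrict_free X)"
    unfolding restrict_free_def by (rule lin_comp[OF kl pl])
  have ka: "arr (hom_incl (free X) R)" "Dom C (hom_incl (free X) R) = fst (dual (free X))"
    "Cod C (hom_incl (free X) R) = Exp C (TO T X) RR"
    using linD(3-5)[OF kl] by simp_all
  note pre = exp_pre_props[of "unit T X" X "TO T X" RR]
  show "ev X RR x (restrict_free X \<cdot> p) = ap (free X) R (unit T X \<cdot> x) p"
    if "x \<in> el X" "p \<in> el (fst (dual (free X)))"
    unfolding restrict_free_def using that pre ka X RR_ob by simp
qed

text \<open>The inverse of \<open>restrict_free\<close>: a map on \<open>X\<close> is extended to
  the free algebra. Keeping the exponential as the parameter of \<open>lift1\<close> does this for
  all maps at once.\<close>

definition extend_free :: "'o \<Rightarrow> 'a" where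
  "extend_free X = transpose (free X) R (Exp C X RR) (lift1 R X (Exp C X RR) (Ev C X RR))"

text \<open>Linearity comes from being a two-sided inverse of the homomorphism
  \<open>restrict_free\<close>: one composite is computed by the unit law, the other by
  \<open>free_lin_eqI\<close>.\<close>

lemma extend_free_props:
  assumes X: "X \<in> Ob C"
  shows "lin (cot X) (dual (free X)) (extend_free X)"
    "x \<in> el X \<Longrightarrow> u \<in> el (Exp C X RR) \<Longrightarrow>
      ap (free X) R (unit T X \<cdot> x) (extend_free X \<cdot> u) = ev X RR x u"
    "u \<in> el (Exp C X RR) \<Longrightarrow> restrict_free X \<cdot> (extend_free X \<cdot> u) = u"
proof -
  let ?E = "Exp C X RR" and ?s = "extend_free X" and ?r = "restrict_free X" and ?D = "fst (dual (free X))"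
  have F: "free X \<in> Ob L" using X by simp
  have E: "?E \<in> Ob C" using X RR_ob by simp
  have Do: "?D \<in> Ob C" using F by simp
  have evh: "Ev C X RR \<in> Hom C (X \<^bold>\<times> ?E) RR" using X RR_ob by (simp add: Hom_iff)
  note tp = transpose_props[OF F R_alg E lift1_phom[OF R_alg X E evh], folded extend_free_def dual_def]
  show eu: "ap (free X) R (unit T X \<cdot> x) (?s \<cdot> u) = ev X RR x u"
    if xu: "x \<in> el X" "u \<in> el ?E" for x u
  proof -
    have "ap (free X) R (unit T X \<cdot> x) (?s \<cdot> u) = lift1 R X ?E (Ev C X RR) \<cdot> \<langle>unit T X \<cdot> x, u\<rangle>"
      by (rule tp(4)) (use xu X in auto)
    then show ?thesis using lift1_unit[OF R_alg X E evh xu] by simp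
  qed
  note rl = restrict_free_props(1)[OF X]
  have ra: "arr ?r" "Dom C ?r = ?D" "Cod C ?r = ?E" using linD(3-5)[OF rl] by simp_all
  show rs: "?r \<cdot> (?s \<cdot> u) = u" if u: "u \<in> el ?E" for u
  proof (rule exp_element_eqI[of _ X RR])
    fix x assume x: "x \<in> el X"
    show "ev X RR x (?r \<cdot> (?s \<cdot> u)) = ev X RR x u"
      using restrict_free_props(2)[OF X x, of "?s \<cdot> u"] eu[OF x u] tp(1-3) u by simp
  qed (use u tp(1-3) ra X RR_ob in auto)
  have rs': "?r \<cdot> ?s = Id C ?E"
    by (rule map_eqI[of _ ?E ?E]) (use rs tp(1-3) ra E in \<open>auto simp: Hom_iff\<close>)
  have sr: "?s \<cdot> (?r \<cdot> p) = p" if p: "p \<in> el ?D" for p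
  proof -
    let ?fn = "\<lambda>q. ev (TO T X) RR (Id C (TO T X)) ((hom_incl (free X) R \<cdot> q) \<cdot> bang (TO T X))"
    have sp: "?s \<cdot> (?r \<cdot> p) \<in> el ?D" using p tp(1-3) ra by simp
    have el: "lin (free X) R (?fn q)" if q: "q \<in> el ?D" for q
      using element_lin[OF F R_alg, folded dual_def, OF q] by simp
    have ka: "arr (hom_incl (free X) R)" "Dom C (hom_incl (free X) R) = ?D"
      "Cod C (hom_incl (free X) R) = Exp C (TO T X) RR"
      using hom_incl_arr[OF F R_alg] by (simp_all add: dual_def)
    have fe: "?fn q \<cdot> t = ap (free X) R t q" if "q \<in> el ?D" "t \<in> el (TO T X)" for q t
      using that ka X RR_ob by simp
    have "?fn (?s \<cdot> (?r \<cdot> p)) = ?fn p"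
    proof (rule free_lin_eqI[OF X el[OF sp] el[OF p]])
      fix x assume x: "x \<in> el X"
      have ux: "unit T X \<cdot> x \<in> el (TO T X)" using x X by simp
      have rp: "?r \<cdot> p \<in> el ?E" using p ra by simp
      show "?fn (?s \<cdot> (?r \<cdot> p)) \<cdot> (unit T X \<cdot> x) = ?fn p \<cdot> (unit T X \<cdot> x)"
        unfolding fe[OF sp ux] fe[OF p ux] eu[OF x rp] restrict_free_props(2)[OF X x p] ..
    qed
    then have "ap (free X) R t (?s \<cdot> (?r \<cdot> p)) = ap (free X) R t p" if "t \<in> el (TO T X)" for t
      using fe[OF sp that] fe[OF p that] by simp
    then show ?thesis by (intro dual_ext[OF sp p F]) simp
  qed
  have sr': "?s \<cdot> ?r = Id C ?D"
    by (rule map_eqI[of _ ?D ?D]) (use sr tp(1-3) ra Do in \<open>auto simp: Hom_iff\<close>)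
  show "lin (cot X) (dual (free X)) ?s"
    by (rule lin_inverse[OF rl]) (use tp(1-3) rs' sr' in auto)
qed

text \<open>The element in question is the \<open>code\<close> of
  \<open>m \<cdot> restrict_free X\<close>; it is the only candidate because \<open>hom_incl\<close>
  is monic.\<close>

lemma dist_element_props:
  assumes X: "X \<in> Ob C" and m: "lin (cot X) R m"
  shows "dist_element X (cot X, m, R) \<in> el (fst (dual (dual (free X))))"
    "p \<in> el (fst (dual (free X))) \<Longrightarrow>
      ap (dual (free X)) R p (dist_element X (cot X, m, R)) = m \<cdot> (restrict_free X \<cdot> p)"
proof -
  let ?h = "m \<cdot> restrict_free X" and ?D = "dual (free X)"
  have D: "?D \<in> Ob L" using X by simp
  note rl = restrict_free_props(1)[OF X]
  note hl = lin_comp[OF rl m]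
  note c = code_props[OF hl, folded dual_def]
  have mk: "monic C (hom_incl ?D R)" by (rule hom_incl_props(3)[OF D R_alg])
  have ka: "Dom C (hom_incl ?D R) = fst (dual ?D)" using D by (simp add: dual_def)
  have e: "dist_element X (cot X, m, R) = code ?D R ?h"
    unfolding dist_element_def L_simps
  proof (rule the_equality)
    fix q assume "q \<in> el (fst (dual ?D)) \<and> hom_incl ?D R \<cdot> q = name_of C ?h"
    then show "q = code ?D R ?h" using monicD[OF mk, of q "code ?D R ?h"] c(1-4) ka by simp
  qed (use c(1-4) in simp)
  show "dist_element X (cot X, m, R) \<in> el (fst (dual ?D))" unfolding e using c(1-3) by simp
  show "ap ?D R p (dist_element X (cot X, m, R)) = m \<cdot> (restrict_free X \<cdot> p)"
    if p: "p \<in> el (fst ?D)"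
    unfolding e using c(5)[of p] p linD(3-5)[OF rl] linD(3-5)[OF m] by simp
qed

text \<open>On the reflection \<open>P\<close> of \<open>F X\<close>, a functional is determined by its values at the points of
  \<open>X\<close>; an accessible distribution, being an element of \<open>P\<close>, is therefore integrated by it.\<close>

lemma accessible_apply:
  assumes X: "X \<in> Ob C" and m: "lin (cot X) R m"
    and d: "lin (free X) P d" and o: "orth (free X) d P R"
    and i: "lin P (dual (dual (free X))) i" and id: "i \<cdot> d = bidual_map (free X)"
    and p: "p \<in> el (fst P)" "i \<cdot> p = dist_element X (cot X, m, R)"
    and a: "lin P R a" and u: "u \<in> el (Exp C X RR)"
    and au: "\<And>x. x \<in> el X \<Longrightarrow> a \<cdot> (d \<cdot> (unit T X \<cdot> x)) = ev X RR x u"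
  shows "a \<cdot> p = m \<cdot> u"
proof -
  let ?D = "dual (free X)"
  have F: "free X \<in> Ob L" using X by simp
  have D: "?D \<in> Ob L" using F by simp
  note s = extend_free_props[OF X]
  have su: "extend_free X \<cdot> u \<in> el (fst ?D)" using linD(3-5)[OF s(1)] u by simp
  \<comment> \<open>Evaluation of the bidual at the functional on \<open>F X\<close> that extends
    \<open>u\<close>. Along \<open>i\<close> it has the same values as \<open>a\<close> at the
    points of \<open>X\<close>, so it will coincide with \<open>a\<close> on all of
    \<open>P\<close>, in particular at \<open>p\<close>.\<close>
  let ?e = "evx (fst ?D) RR (extend_free X \<cdot> u) \<cdot> hom_incl ?D R"
  have el: "lin (dual ?D) R ?e" using ev_hom_incl_lin[OF D R_alg su] by (simp add: dual_def[of ?D])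
  have ea: "?e \<cdot> q = ap ?D R (extend_free X \<cdot> u) q" if "q \<in> el (fst (dual ?D))" for q
  proof -
    have "arr (hom_incl ?D R)" "Dom C (hom_incl ?D R) = fst (dual ?D)"
      "Cod C (hom_incl ?D R) = Exp C (fst ?D) RR"
      using D by (simp_all add: dual_def[of ?D])
    then show ?thesis using that su alg_arr(1)[OF D] RR_ob by simp
  qed
  note b = bidual_map_props(2,3)[OF F]
  have da: "arr d" "Dom C d = TO T X" "Cod C d = fst P" using linD(3-5)[OF d] by simp_all
  note ia = linD(3-5)[OF i] and aa = linD(3-5)[OF a] and eaa = linD(3-5)[OF el]
  have "a = ?e \<cdot> i"
  proof (rule orth_lin_unique[OF o d a lin_comp[OF i el]])
    have "a \<cdot> d = (?e \<cdot> i) \<cdot> d"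
    proof (rule free_lin_eqI[OF X lin_comp[OF d a] lin_comp[OF d lin_comp[OF i el]]])
      fix x assume x: "x \<in> el X"
      have ux: "unit T X \<cdot> x \<in> el (fst (free X))" using x X by simp
      have bx: "bidual_map (free X) \<cdot> (unit T X \<cdot> x) \<in> el (fst (dual ?D))"
        using ux linD(3-5)[OF b(1)] by simp
      have "((?e \<cdot> i) \<cdot> d) \<cdot> (unit T X \<cdot> x) = ?e \<cdot> ((i \<cdot> d) \<cdot> (unit T X \<cdot> x))"
        using x X da ia eaa by (simp del: evx_apply)
      also have "\<dots> = ap ?D R (extend_free X \<cdot> u) (bidual_map (free X) \<cdot> (unit T X \<cdot> x))"
        unfolding id by (rule ea[OF bx])
      also have "\<dots> = ap (free X) R (unit T X \<cdot> x) (extend_free X \<cdot> u)"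
        by (rule b(2)[OF ux su])
      also have "\<dots> = ev X RR x u" by (rule s(2)[OF x u])
      finally show "(a \<cdot> d) \<cdot> (unit T X \<cdot> x) = ((?e \<cdot> i) \<cdot> d) \<cdot> (unit T X \<cdot> x)"
        using au[OF x] x X da aa by simp
    qed
    then have eq: "(a \<cdot> d) \<cdot> t = ((?e \<cdot> i) \<cdot> d) \<cdot> t" for t by simp
    fix t assume "t \<in> el (fst (free X))"
    then show "a \<cdot> (d \<cdot> t) = (?e \<cdot> i) \<cdot> (d \<cdot> t)"
      using eq[of t] comp_assoc[of t d a] comp_assoc[of t d "?e \<cdot> i"] da aa
        linD(3-5)[OF lin_comp[OF i el]] by (simp del: comp_assoc comp_arr)
  qed
  then have "a \<cdot> p = (?e \<cdot> i) \<cdot> p" by simp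
  also have "\<dots> = ?e \<cdot> (i \<cdot> p)" by (rule comp_assoc) (use p ia eaa in auto)
  also have "\<dots> = ap ?D R (extend_free X \<cdot> u) (dist_element X (cot X, m, R))"
    unfolding p(2) by (rule ea[OF dist_element_props(1)[OF X m]])
  also have "\<dots> = m \<cdot> (restrict_free X \<cdot> (extend_free X \<cdot> u))"
    by (rule dist_element_props(2)[OF X m su])
  also have "\<dots> = m \<cdot> u" unfolding s(3)[OF u] ..
  finally show ?thesis .
qed

section \<open>Accessible distributions\<close>

lemma accessible_iff:
  "accessible X \<mu> \<longleftrightarrow> (\<exists>m. \<mu> = (cot X, m, R) \<and> lin (cot X) R m \<and> (\<exists>P d i p.
     is_fc_reflection (free X) (free X, d, P) \<and> lin P (dual (dual (free X))) i \<and>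
     i \<cdot> d = bidual_map (free X) \<and> p \<in> el (fst P) \<and> i \<cdot> p = dist_element X \<mu>))"
  if X: "X \<in> Ob C"
proof
  have F: "free X \<in> Ob L" using X by simp
  note b = bidual_map_props(1)[OF F]
  {
    assume acc: "accessible X \<mu>"
    then obtain m where m: "\<mu> = (cot X, m, R)" "lin (cot X) R m"
      unfolding accessible_def natural_distribution_def Hom_L_iff by blast
    from acc obtain d' i' p where h: "is_fc_reflection (free X) d'"
        "i' \<in> Hom L (Cod L d') (dual (dual (free X)))" "i' \<cdot>\<^bsub>L\<^esub> d' = bidual_unit (free X)"
        "p \<in> el (fst (Cod L d'))" "GA i' \<cdot> p = dist_element X \<mu>"
      unfolding accessible_def by blast
    from h(1) obtain P d where d: "d' = (free X, d, P)" unfolding is_fc_reflection_iff by blast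
    from h(2) obtain i where i: "i' = (P, i, dual (dual (free X)))" "lin P (dual (dual (free X))) i"
      unfolding Hom_L_iff d L_simps by blast
    have id: "i \<cdot> d = bidual_map (free X)" using h(3) unfolding d i(1) b by simp
    show "\<exists>m. \<mu> = (cot X, m, R) \<and> lin (cot X) R m \<and> (\<exists>P d i p.
     is_fc_reflection (free X) (free X, d, P) \<and> lin P (dual (dual (free X))) i \<and>
     i \<cdot> d = bidual_map (free X) \<and> p \<in> el (fst P) \<and> i \<cdot> p = dist_element X \<mu>)"
      using m h(1,4,5) i id unfolding d i(1) L_simps by blast
  }
  assume "\<exists>m. \<mu> = (cot X, m, R) \<and> lin (cot X) R m \<and> (\<exists>P d i p.
     is_fc_reflection (free X) (free X, d, P) \<and> lin P (dual (dual (free X))) i \<and>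
     i \<cdot> d = bidual_map (free X) \<and> p \<in> el (fst P) \<and> i \<cdot> p = dist_element X \<mu>)"
  then obtain m P d i p where m: "\<mu> = (cot X, m, R)" "lin (cot X) R m"
    and h: "is_fc_reflection (free X) (free X, d, P)" "lin P (dual (dual (free X))) i"
     "i \<cdot> d = bidual_map (free X)" "p \<in> el (fst P)" "i \<cdot> p = dist_element X \<mu>" by blast
  show "accessible X \<mu>"
    unfolding accessible_def natural_distribution_def
  proof (intro conjI exI bexI)
    show "\<mu> \<in> Hom L (cot X) R" using m by (simp add: Hom_L_iff)
    show "is_fc_reflection (free X) (free X, d, P)" by (rule h)
    show "(P, i, dual (dual (free X))) \<in> Hom L (Cod L (free X, d, P)) (dual (dual (free X)))"
      unfolding L_simps Hom_L_iff using h(2) by blast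
    show "(P, i, dual (dual (free X))) \<cdot>\<^bsub>L\<^esub> (free X, d, P) = bidual_unit (free X)"
      unfolding b L_simps h(3) ..
    show "GA (P, i, dual (dual (free X))) \<cdot> p = dist_element X \<mu>" unfolding L_simps by (rule h)
    show "p \<in> el (fst (Cod L (free X, d, P)))" unfolding L_simps by (rule h)
  qed
qed

text \<open>A functional on \<open>[X, R]*\<close> is pulled back to the reflection along
  \<open>i\<close> and the dual \<open>?t\<close> of \<open>extend_free X\<close>. Under
  \<open>?t\<close> the images of the units become the evaluations at the points, and the element of
  the bidual that belongs to \<open>m\<close> becomes \<open>m\<close>, so
  \<open>accessible_apply\<close> concludes.\<close>

lemma accessible_determined:
  assumes X: "X \<in> Ob C" and acc: "accessible X (cot X, m, R)"
  shows "determined X m"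
  unfolding determined_def
proof (intro allI impI)
  let ?F = "free X"
  have F: "?F \<in> Ob L" and E: "cot X \<in> Ob L" using X by simp_all
  obtain P d i p where m: "lin (cot X) R m" and refl: "is_fc_reflection ?F (?F, d, P)"
    and i: "lin P (dual (dual ?F)) i" and id: "i \<cdot> d = bidual_map ?F" and p: "p \<in> el (fst P)"
    and ip: "i \<cdot> p = dist_element X (cot X, m, R)"
    using acc unfolding accessible_iff[OF X] by blast
  have d: "lin ?F P d" and o: "orth ?F d P R"
    using refl fc_R unfolding is_fc_reflection_iff by blast+
  note s = extend_free_props[OF X]
  have sa: "arr (extend_free X)" "Dom C (extend_free X) = Exp C X RR"
    "Cod C (extend_free X) = fst (dual ?F)"
    using linD(3-5)[OF s(1)] by simp_all
  let ?t = "dmap (cot X) (extend_free X) (dual ?F)"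
  note tl = dmap_lin[OF s(1)]
  note ta = linD(3-5)[OF tl]
  have t: "ap (cot X) R u (?t \<cdot> q) = ap (dual ?F) R (extend_free X \<cdot> u) q"
    if "u \<in> el (Exp C X RR)" "q \<in> el (fst (dual (dual ?F)))" for u q
    by (rule ap_dmap[OF s(1)]) (use that in auto)
  note b = bidual_map_props(2,3)[OF F]
  have ba: "arr (bidual_map ?F)" "Dom C (bidual_map ?F) = TO T X"
    "Cod C (bidual_map ?F) = fst (dual (dual ?F))"
    using linD(3-5)[OF b(1)] by simp_all
  have tx: "?t \<cdot> (bidual_map ?F \<cdot> (unit T X \<cdot> x)) = code (cot X) R (evx X RR x)"
    if x: "x \<in> el X" for x
  proof (rule dual_ext[OF _ _ E])
    note c = code_props[OF evx_lin[OF X R_alg x], folded dual_def]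
    have ux: "unit T X \<cdot> x \<in> el (fst ?F)" using x X by simp
    have bx: "bidual_map ?F \<cdot> (unit T X \<cdot> x) \<in> el (fst (dual (dual ?F)))"
      using ux ba by simp
    show "?t \<cdot> (bidual_map ?F \<cdot> (unit T X \<cdot> x)) \<in> el (fst (dual (cot X)))"
      using bx ta by simp
    show "code (cot X) R (evx X RR x) \<in> el (fst (dual (cot X)))" using c(1-3) by simp
    fix u assume "u \<in> el (fst (cot X))"
    then have u: "u \<in> el (Exp C X RR)" by simp
    have su: "extend_free X \<cdot> u \<in> el (fst (dual ?F))" using u sa by simp
    show "ap (cot X) R u (?t \<cdot> (bidual_map ?F \<cdot> (unit T X \<cdot> x))) =
        ap (cot X) R u (code (cot X) R (evx X RR x))"
      unfolding t[OF u bx] b(2)[OF ux su] s(2)[OF x u] using c(5)[of u] u x X RR_ob by simp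
  qed
  have tm: "?t \<cdot> (i \<cdot> p) = code (cot X) R m"
  proof (rule dual_ext[OF _ _ E])
    note c = code_props[OF m, folded dual_def]
    note de = dist_element_props[OF X m]
    show "?t \<cdot> (i \<cdot> p) \<in> el (fst (dual (cot X)))" unfolding ip using de(1) ta by simp
    show "code (cot X) R m \<in> el (fst (dual (cot X)))" using c(1-3) by simp
    fix u assume "u \<in> el (fst (cot X))"
    then have u: "u \<in> el (Exp C X RR)" by simp
    have su: "extend_free X \<cdot> u \<in> el (fst (dual ?F))" using u sa by simp
    show "ap (cot X) R u (?t \<cdot> (i \<cdot> p)) = ap (cot X) R u (code (cot X) R m)"
      unfolding ip t[OF u de(1)] de(2)[OF su] s(3)[OF u] using c(5)[of u] u by simp
  qed
  fix a u assume a: "lin (dual (cot X)) R a" and u: "u \<in> el (Exp C X RR)"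
    and au: "\<forall>x \<in> el X. a \<cdot> code (cot X) R (evx X RR x) = ev X RR x u"
  note aa = linD(3-5)[OF a] and ia = linD(3-5)[OF i]
  have da: "arr d" "Dom C d = TO T X" "Cod C d = fst P" using linD(3-5)[OF d] by simp_all
  have "(a \<cdot> (?t \<cdot> i)) \<cdot> p = m \<cdot> u"
  proof (rule accessible_apply[OF X m d o i id p ip lin_comp[OF lin_comp[OF i tl] a] u])
    fix x assume x: "x \<in> el X"
    have "(a \<cdot> (?t \<cdot> i)) \<cdot> (d \<cdot> (unit T X \<cdot> x)) = a \<cdot> (?t \<cdot> ((i \<cdot> d) \<cdot> (unit T X \<cdot> x)))"
      using x X da ia ta aa by simp
    then show "(a \<cdot> (?t \<cdot> i)) \<cdot> (d \<cdot> (unit T X \<cdot> x)) = ev X RR x u"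
      unfolding id tx[OF x] using au x by simp
  qed
  moreover have "(a \<cdot> (?t \<cdot> i)) \<cdot> p = a \<cdot> (?t \<cdot> (i \<cdot> p))" using p ia ta aa by simp
  ultimately show "a \<cdot> code (cot X) R m = m \<cdot> u" unfolding tm by simp
qed

text \<open>With \<open>P\<close> the reflection of \<open>F (X \<times> Y)\<close>, the map sending \<open>(y, x)\<close> to the point \<open>(x, y)\<close> of \<open>P\<close>
  extends to the reflection of \<open>F Y\<close> in its first variable. Evaluating there at \<open>\<nu>\<close> gives a map
  \<open>X \<rightarrow> P\<close>, which extends to the reflection of \<open>F X\<close>; its value at \<open>\<mu>\<close> is the product distribution.\<close>

lemma tensor_dist_accessible:
  assumes X: "X \<in> Ob C" and Y: "Y \<in> Ob C"
    and accm: "accessible X (cot X, m, R)" and accn: "accessible Y (cot Y, n, R)"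
  shows "accessible (X \<^bold>\<times> Y) (cot (X \<^bold>\<times> Y), tensor_dist X Y m n, R)"
proof -
  let ?F = "free (X \<^bold>\<times> Y)"
  have XY: "X \<^bold>\<times> Y \<in> Ob C" using X Y by simp
  have F: "?F \<in> Ob L" and FX: "free X \<in> Ob L" and FY: "free Y \<in> Ob L" using X Y XY by (blast intro: free_alg)+
  obtain PX dX iX pX where m: "lin (cot X) R m" and reflX: "is_fc_reflection (free X) (free X, dX, PX)"
    and iX: "lin PX (dual (dual (free X))) iX" and idX: "iX \<cdot> dX = bidual_map (free X)"
    and pX: "pX \<in> el (fst PX)" and ipX: "iX \<cdot> pX = dist_element X (cot X, m, R)"
    using accm unfolding accessible_iff[OF X] by blast
  obtain PY dY iY pY where n: "lin (cot Y) R n" and reflY: "is_fc_reflection (free Y) (free Y, dY, PY)"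
    and iY: "lin PY (dual (dual (free Y))) iY" and idY: "iY \<cdot> dY = bidual_map (free Y)"
    and pY: "pY \<in> el (fst PY)" and ipY: "iY \<cdot> pY = dist_element Y (cot Y, n, R)"
    using accn unfolding accessible_iff[OF Y] by blast
  obtain P d i where refl: "is_fc_reflection ?F (?F, d, P)" and i: "lin P (dual (dual ?F)) i"
    and id: "i \<cdot> d = bidual_map ?F"
    using fc_reflection_exists[OF F] by blast
  have d: "lin ?F P d" and fP: "functionally_complete P"
    using refl unfolding is_fc_reflection_iff by blast+
  have dX: "lin (free X) PX dX" and oX: "\<And>B. functionally_complete B \<Longrightarrow> orth (free X) dX PX B"
    using reflX unfolding is_fc_reflection_iff by blast+
  have dY: "lin (free Y) PY dY" and oY: "\<And>B. functionally_complete B \<Longrightarrow> orth (free Y) dY PY B"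
    using reflY unfolding is_fc_reflection_iff by blast+
  have da: "arr d" "Dom C d = TO T (X \<^bold>\<times> Y)" "Cod C d = fst P" using linD(3-5)[OF d] by simp_all
  have dXa: "arr dX" "Dom C dX = TO T X" "Cod C dX = fst PX" using linD(3-5)[OF dX] by simp_all
  have dYa: "arr dY" "Dom C dY = TO T Y" "Cod C dY = fst PY" using linD(3-5)[OF dY] by simp_all
  have PA: "P \<in> Ob L" "PX \<in> Ob L" "PY \<in> Ob L" using linD(2) d dX dY by blast+
  \<comment> \<open>The variable from \<open>Y\<close> is put first because \<open>lift1\<close> and
    \<open>orth\<close> extend in the first variable; the one from \<open>X\<close> stays a
    parameter for now.\<close>
  let ?\<phi> = "d \<cdot> (unit T (X \<^bold>\<times> Y) \<cdot> swap C Y X)"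
  have \<phi>: "?\<phi> \<in> Hom C (Y \<^bold>\<times> X) (fst P)" using da X Y by (simp add: Hom_iff)
  obtain \<theta> where \<theta>: "\<theta> \<in> phom PY X P"
    "\<And>t x. t \<in> el (fst (free Y)) \<Longrightarrow> x \<in> el X \<Longrightarrow>
      \<theta> \<cdot> \<langle>dY \<cdot> t, x\<rangle> = lift1 P Y X ?\<phi> \<cdot> \<langle>t, x\<rangle>"
    using orth_extend[OF oY[OF fP] dY X lift1_phom[OF PA(1) Y X \<phi>]] by blast
  note \<theta>a = phomD(1-3)[OF \<theta>(1)]
  have \<theta>u: "\<theta> \<cdot> \<langle>dY \<cdot> (unit T Y \<cdot> y), x\<rangle> = d \<cdot> (unit T (X \<^bold>\<times> Y) \<cdot> \<langle>x, y\<rangle>)"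
    if "x \<in> el X" "y \<in> el Y" for x y
  proof -
    have "unit T Y \<cdot> y \<in> el (fst (free Y))" using that Y by simp
    from \<theta>(2)[OF this that(1)] have "\<theta> \<cdot> \<langle>dY \<cdot> (unit T Y \<cdot> y), x\<rangle> = ?\<phi> \<cdot> \<langle>y, x\<rangle>"
      using lift1_unit[OF PA(1) Y X \<phi> that(2,1)] by simp
    then show ?thesis using that da X Y by simp
  qed
  \<comment> \<open>Inserting \<open>pY\<close>, the element that represents the distribution on
    \<open>Y\<close>, leaves a map on \<open>X\<close> alone.\<close>
  let ?\<psi> = "\<theta> \<cdot> \<langle>pY \<cdot> bang X, Id C X\<rangle>"
  have \<psi>: "?\<psi> \<in> Hom C X (fst P)" using \<theta>a pY X by (simp add: Hom_iff)
  have \<psi>a: "?\<psi> \<cdot> x = \<theta> \<cdot> \<langle>pY, x\<rangle>" if "x \<in> el X" for x using that \<theta>a pY X by simp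
  obtain l where l: "lin PX P l"
    "\<And>t. t \<in> el (fst (free X)) \<Longrightarrow> l \<cdot> (dX \<cdot> t) = (snd P \<cdot> TA T ?\<psi>) \<cdot> t"
    using orth_extend_lin[OF oX[OF fP] dX free_extend_lin[OF PA(1) \<psi>]] by blast
  note la = linD(3-5)[OF l(1)] and ia = linD(3-5)[OF i]
  have lu: "l \<cdot> (dX \<cdot> (unit T X \<cdot> x)) = \<theta> \<cdot> \<langle>pY, x\<rangle>" if x: "x \<in> el X" for x
  proof -
    have ux: "unit T X \<cdot> x \<in> el (fst (free X))" using x X by simp
    have "l \<cdot> (dX \<cdot> (unit T X \<cdot> x)) = snd P \<cdot> (TA T ?\<psi> \<cdot> (unit T X \<cdot> x))"
      unfolding l(2)[OF ux] by (rule comp_assoc) (use PA(1) HomD(1-3)[OF \<psi>] x X in auto)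
    also have "\<dots> = ?\<psi> \<cdot> x" by (rule alg_extend_unit[OF PA(1) X HomD(1-3)[OF \<psi>] x])
    finally show ?thesis unfolding \<psi>a[OF x] .
  qed
  let ?r = "tensor_dist X Y m n"
  note td = tensor_dist_props[OF X Y m n]
  have na: "n \<in> Hom C (Exp C Y RR) RR" using linD(3-5)[OF n] by (simp add: Hom_iff)
  have ip: "i \<cdot> (l \<cdot> pX) = dist_element (X \<^bold>\<times> Y) (cot (X \<^bold>\<times> Y), ?r, R)"
  proof (rule dual_ext)
    note de = dist_element_props[OF XY td(1)]
    have D: "dual ?F \<in> Ob L" using F by (rule dual_alg)
    show "dual ?F \<in> Ob L" by (rule D)
    show "i \<cdot> (l \<cdot> pX) \<in> el (fst (dual (dual ?F)))" using ia la pX by simp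
    show "dist_element (X \<^bold>\<times> Y) (cot (X \<^bold>\<times> Y), ?r, R) \<in> el (fst (dual (dual ?F)))" by (rule de(1))
    fix p assume p: "p \<in> el (fst (dual ?F))"
    let ?e = "evx (fst (dual ?F)) RR p \<cdot> hom_incl (dual ?F) R"
    have el: "lin (dual (dual ?F)) R ?e" using ev_hom_incl_lin[OF D R_alg p] by (simp add: dual_def[of "dual ?F"])
    have ea: "?e \<cdot> q = ap (dual ?F) R p q" if "q \<in> el (fst (dual (dual ?F)))" for q
    proof -
      have "arr (hom_incl (dual ?F) R)" "Dom C (hom_incl (dual ?F) R) = fst (dual (dual ?F))"
        "Cod C (hom_incl (dual ?F) R) = Exp C (fst (dual ?F)) RR"
        using D by (simp_all add: dual_def[of "dual ?F"])
      then show ?thesis using that p alg_arr(1)[OF D] RR_ob by simp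
    qed
    \<comment> \<open>The functional \<open>p\<close> seen on \<open>P\<close>. Since
      \<open>p\<close> is arbitrary, comparing its values at the two elements of the bidual proves
      them equal.\<close>
    define c where "c = ?e \<cdot> i"
    have cl: "lin P R c" unfolding c_def by (rule lin_comp[OF i el])
    note ca = linD(3-5)[OF cl]
    have capp: "c \<cdot> q = ap (dual ?F) R p (i \<cdot> q)" if q: "q \<in> el (fst P)" for q
    proof -
      have "c \<cdot> q = ?e \<cdot> (i \<cdot> q)" unfolding c_def by (rule comp_assoc) (use q ia linD(3-5)[OF el] in auto)
      also have "\<dots> = ap (dual ?F) R p (i \<cdot> q)" by (rule ea) (use q ia in simp)
      finally show ?thesis .
    qed
    define u where "u = restrict_free (X \<^bold>\<times> Y) \<cdot> p"
    have u: "u \<in> el (Exp C (X \<^bold>\<times> Y) RR)"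
      unfolding u_def using linD(3-5)[OF restrict_free_props(1)[OF XY]] p by simp
    have cu: "c \<cdot> (d \<cdot> (unit T (X \<^bold>\<times> Y) \<cdot> z)) = ev (X \<^bold>\<times> Y) RR z u"
      if z: "z \<in> el (X \<^bold>\<times> Y)" for z
    proof -
      have uz: "unit T (X \<^bold>\<times> Y) \<cdot> z \<in> el (fst ?F)" using z XY by simp
      have "i \<cdot> (d \<cdot> (unit T (X \<^bold>\<times> Y) \<cdot> z)) = (i \<cdot> d) \<cdot> (unit T (X \<^bold>\<times> Y) \<cdot> z)"
        using uz da ia z XY by simp
      then have "c \<cdot> (d \<cdot> (unit T (X \<^bold>\<times> Y) \<cdot> z)) = ap (dual ?F) R p (bidual_map ?F \<cdot> (unit T (X \<^bold>\<times> Y) \<cdot> z))"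
        using capp[of "d \<cdot> (unit T (X \<^bold>\<times> Y) \<cdot> z)"] z XY da unfolding id by simp
      also have "\<dots> = ap ?F R (unit T (X \<^bold>\<times> Y) \<cdot> z) p"
        by (rule bidual_map_props(3)[OF F uz p])
      also have "\<dots> = ev (X \<^bold>\<times> Y) RR z u"
        unfolding u_def by (rule restrict_free_props(2)[OF XY z p, symmetric])
      finally show ?thesis .
    qed
    \<comment> \<open>The integrand: the map on \<open>X \<times> Y\<close> whose value at a point
      is that of \<open>p\<close> there. Its name is \<open>u\<close>.\<close>
    define f where "f = ev (X \<^bold>\<times> Y) RR (Id C (X \<^bold>\<times> Y)) (u \<cdot> bang (X \<^bold>\<times> Y))"
    have fh: "f \<in> Hom C (X \<^bold>\<times> Y) RR" unfolding f_def using u XY RR_ob by (simp add: Hom_iff)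
    note fa = HomD(1-3)[OF fh]
    have fz: "f \<cdot> z = ev (X \<^bold>\<times> Y) RR z u" if "z \<in> el (X \<^bold>\<times> Y)" for z
      unfolding f_def using that u XY RR_ob by simp
    let ?g = "inner2 X Y n f"
    have gh: "?g \<in> Hom C X RR" by (rule inner_hom(2)[OF X Y fh na])
    note ga = HomD(1-3)[OF gh]
    \<comment> \<open>The inner integral. With \<open>x\<close> fixed, \<open>c\<close> after
      \<open>\<theta>\<close> is a functional on the reflection of \<open>F Y\<close>, and its value
      at \<open>pY\<close> is the integral over \<open>Y\<close> by
      \<open>accessible_apply\<close>.\<close>
    have cg: "c \<cdot> (\<theta> \<cdot> \<langle>pY, x\<rangle>) = ?g \<cdot> x" if x: "x \<in> el X" for x
    proof -
      let ?fx = "f \<cdot> \<langle>x \<cdot> bang Y, Id C Y\<rangle>"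
      let ?s = "\<theta> \<cdot> \<langle>Id C (fst PY), x \<cdot> bang (fst PY)\<rangle>"
      have fxa: "arr ?fx" "Dom C ?fx = Y" "Cod C ?fx = RR" using fa x Y by simp_all
      have sl: "lin PY P ?s" by (rule phomD(4)[OF \<theta>(1) x])
      have sq: "(c \<cdot> ?s) \<cdot> q = c \<cdot> (\<theta> \<cdot> \<langle>q, x\<rangle>)" if "q \<in> el (fst PY)" for q
        using that ca \<theta>a x alg_arr(1)[OF PA(3)] by simp
      have "(c \<cdot> ?s) \<cdot> pY = n \<cdot> name_of C ?fx"
      proof (rule accessible_apply[OF Y n dY oY[OF fc_R] iY idY pY ipY lin_comp[OF sl cl]])
        show "name_of C ?fx \<in> el (Exp C Y RR)" using name_arr[OF fxa(1,2)] fxa(3) by simp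
        fix y assume y: "y \<in> el Y"
        have xy: "\<langle>x, y\<rangle> \<in> el (X \<^bold>\<times> Y)" using x y by simp
        have "(c \<cdot> ?s) \<cdot> (dY \<cdot> (unit T Y \<cdot> y)) = c \<cdot> (d \<cdot> (unit T (X \<^bold>\<times> Y) \<cdot> \<langle>x, y\<rangle>))"
          unfolding \<theta>u[OF x y, symmetric] by (rule sq) (use y Y dYa in simp)
        also have "\<dots> = f \<cdot> \<langle>x, y\<rangle>" unfolding cu[OF xy] fz[OF xy] ..
        finally show "(c \<cdot> ?s) \<cdot> (dY \<cdot> (unit T Y \<cdot> y)) = ev Y RR y (name_of C ?fx)"
          using x y fa Y by simp
      qed
      then show ?thesis unfolding sq[OF pY] inner2_apply[OF X Y fh na x] .
    qed
    \<comment> \<open>The outer integral: \<open>c \<cdot> l\<close> is a functional on the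
      reflection of \<open>F X\<close> whose values at the points are the inner integrals.\<close>
    have "(c \<cdot> l) \<cdot> pX = m \<cdot> name_of C ?g"
    proof (rule accessible_apply[OF X m dX oX[OF fc_R] iX idX pX ipX lin_comp[OF l(1) cl]])
      show "name_of C ?g \<in> el (Exp C X RR)" using ga by simp
      fix x assume x: "x \<in> el X"
      have "(c \<cdot> l) \<cdot> (dX \<cdot> (unit T X \<cdot> x)) = c \<cdot> (\<theta> \<cdot> \<langle>pY, x\<rangle>)"
        unfolding lu[OF x, symmetric] by (rule comp_assoc) (use ca la dXa x X in auto)
      then show "(c \<cdot> l) \<cdot> (dX \<cdot> (unit T X \<cdot> x)) = ev X RR x (name_of C ?g)"
        unfolding cg[OF x] using x ga by simp
    qed
    also have "\<dots> = ?r \<cdot> name_of C f" by (rule td(2)[OF fh, symmetric])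
    also have "name_of C f = u" unfolding f_def by (rule name_apply[OF u XY RR_ob])
    finally have clp: "(c \<cdot> l) \<cdot> pX = ?r \<cdot> u" .
    have "(c \<cdot> l) \<cdot> pX = c \<cdot> (l \<cdot> pX)" by (rule comp_assoc) (use ca la pX in auto)
    also have "\<dots> = ap (dual ?F) R p (i \<cdot> (l \<cdot> pX))" by (rule capp) (use la pX in simp)
    finally show "ap (dual ?F) R p (i \<cdot> (l \<cdot> pX)) =
        ap (dual ?F) R p (dist_element (X \<^bold>\<times> Y) (cot (X \<^bold>\<times> Y), ?r, R))"
      unfolding de(2)[OF p] clp u_def[symmetric] by simp
  qed
  have "l \<cdot> pX \<in> el (fst P)" using la pX by simp
  then show ?thesis
    unfolding accessible_iff[OF XY] using td(1) refl i id ip by blast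
qed

section \<open>Existence and uniqueness of product distributions\<close>

theorem product_distribution_accessible:
  assumes X: "X \<in> Ob C" and Y: "Y \<in> Ob C" and \<mu>: "accessible X \<mu>" and \<nu>: "accessible Y \<nu>"
  shows "\<exists>!\<rho>. accessible (X \<^bold>\<times> Y) \<rho> \<and> fubini X Y \<mu> \<nu> \<rho>"
proof -
  obtain m where m: "\<mu> = (cot X, m, R)" "lin (cot X) R m" using \<mu> unfolding accessible_iff[OF X] by blast
  obtain n where n: "\<nu> = (cot Y, n, R)" "lin (cot Y) R n" using \<nu> unfolding accessible_iff[OF Y] by blast
  have XY: "X \<^bold>\<times> Y \<in> Ob C" using X Y by simp
  note td = tensor_dist_props(1)[OF X Y m(2) n(2)]
  note fub = fubini_tensor_dist[OF X Y m(2) n(2) accessible_determined[OF X \<mu>[unfolded m(1)]]]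
  show ?thesis
  proof (rule ex1I[of _ "(cot (X \<^bold>\<times> Y), tensor_dist X Y m n, R)"])
    show "accessible (X \<^bold>\<times> Y) (cot (X \<^bold>\<times> Y), tensor_dist X Y m n, R) \<and>
        fubini X Y \<mu> \<nu> (cot (X \<^bold>\<times> Y), tensor_dist X Y m n, R)"
      using tensor_dist_accessible[OF X Y \<mu>[unfolded m(1)] \<nu>[unfolded n(1)]] fub unfolding m(1) n(1) by blast
    fix \<rho> assume \<rho>: "accessible (X \<^bold>\<times> Y) \<rho> \<and> fubini X Y \<mu> \<nu> \<rho>"
    then obtain r where r: "\<rho> = (cot (X \<^bold>\<times> Y), r, R)" "lin (cot (X \<^bold>\<times> Y)) R r"
      unfolding accessible_iff[OF XY] by blast
    have "r = tensor_dist X Y m n"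
      by (rule fubini_unique[OF X Y m(2) n(2) r(2) td _ fub]) (use \<rho> r(1) m(1) n(1) in simp)
    then show "\<rho> = (cot (X \<^bold>\<times> Y), tensor_dist X Y m n, R)" using r(1) by simp
  qed
qed

theorem product_distribution_reflexive:
  assumes refl: "reflexive (cot X)" and X: "X \<in> Ob C" and Y: "Y \<in> Ob C"
    and \<mu>: "\<mu> \<in> Hom L (cot X) R" and \<nu>: "\<nu> \<in> Hom L (cot Y) R"
  shows "\<exists>!\<rho>. \<rho> \<in> Hom L (cot (X \<^bold>\<times> Y)) R \<and> fubini X Y \<mu> \<nu> \<rho>"
proof -
  obtain m where m: "\<mu> = (cot X, m, R)" "lin (cot X) R m" using \<mu> unfolding Hom_L_iff by blast
  obtain n where n: "\<nu> = (cot Y, n, R)" "lin (cot Y) R n" using \<nu> unfolding Hom_L_iff by blast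
  note td = tensor_dist_props(1)[OF X Y m(2) n(2)]
  note fub = fubini_tensor_dist[OF X Y m(2) n(2) reflexive_determined[OF X refl m(2)]]
  show ?thesis
  proof (rule ex1I[of _ "(cot (X \<^bold>\<times> Y), tensor_dist X Y m n, R)"])
    show "(cot (X \<^bold>\<times> Y), tensor_dist X Y m n, R) \<in> Hom L (cot (X \<^bold>\<times> Y)) R \<and>
        fubini X Y \<mu> \<nu> (cot (X \<^bold>\<times> Y), tensor_dist X Y m n, R)"
      using td fub unfolding m(1) n(1) Hom_L_iff by blast
    fix \<rho> assume \<rho>: "\<rho> \<in> Hom L (cot (X \<^bold>\<times> Y)) R \<and> fubini X Y \<mu> \<nu> \<rho>"
    then obtain r where r: "\<rho> = (cot (X \<^bold>\<times> Y), r, R)" "lin (cot (X \<^bold>\<times> Y)) R r"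
      unfolding Hom_L_iff by blast
    have "r = tensor_dist X Y m n"
      by (rule fubini_unique[OF X Y m(2) n(2) r(2) td _ fub]) (use \<rho> r(1) m(1) n(1) in simp)
    then show "\<rho> = (cot (X \<^bold>\<times> Y), tensor_dist X Y m n, R)" using r(1) by simp
  qed
qed

end

theorem corollary7p6p4:
  fixes C :: "('o, 'a) ccc" and T :: "('o, 'a) mon_monad"
  assumes "cartesian_closed C"
    and "finitely_well_complete C"
    and "well_pointed C"
    and "symmetric_monoidal_monad C T"
    and "monad_data.has_tensor_products C T"
  shows
    "(\<forall>X \<in> Ob C. \<forall>Y \<in> Ob C. \<forall>\<mu> \<nu>.
       monad_data.accessible C T X \<mu> \<longrightarrow> monad_data.accessible C T Y \<nu> \<longrightarrow>
       (\<exists>!\<rho>. monad_data.accessible C T (Prod C X Y) \<rho> \<and> monad_data.fubini C T X Y \<mu> \<nu> \<rho>))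
     \<and>
     ((\<forall>X \<in> Ob C. monad_data.reflexive C T (monad_data.cotensor C T X (monad_data.R C T))) \<longrightarrow>
     (\<forall>X \<in> Ob C. \<forall>Y \<in> Ob C.
       \<forall>\<mu> \<in> Hom (EM C T) (monad_data.cotensor C T X (monad_data.R C T)) (monad_data.R C T).
       \<forall>\<nu> \<in> Hom (EM C T) (monad_data.cotensor C T Y (monad_data.R C T)) (monad_data.R C T).
       \<exists>!\<rho>. \<rho> \<in> Hom (EM C T) (monad_data.cotensor C T (Prod C X Y) (monad_data.R C T))
                    (monad_data.R C T) \<and>
            monad_data.fubini C T X Y \<mu> \<nu> \<rho>))"
proof -
  interpret symmetric_monoidal_monad_setting C T
    by (intro symmetric_monoidal_monad_setting.intro well_pointed_ccc.intro
        well_pointed_ccc_axioms.intro symmetric_monoidal_monad_setting_axioms.intro assms)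
  show ?thesis
    using product_distribution_accessible product_distribution_reflexive by blast
qed

end
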